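(* Let $p:\Omega\to\Lambda$ be a universal covering of $k$-graphs, $x\in\Lambda^0$, $v\in p^{-1}(x)$, and $H$ a subgroup of $\pi(\Lambda,x)$. Let $H$ act on $(\Omega,p)$ by the right action described in the context. Then the associated covering $q:\Omega/H\to\Lambda$, $q(\lambda H)=p(\lambda)$, is connected, and \[ H=q_*\pi(\Omega/H,vH). \] Moreover, every connected covering of $\Lambda$ is isomorphic to one of these coverings $\Omega/H\to\Lambda$.
   Context: A $k$-graph is a small category $\Lambda$ with a functor $d:\Lambda\to\mathbb N^k$ (the degree) satisfying the factorization property: if $d(\alpha)=n+l$ with $n,l\in\mathbb N^k$, there are unique $\beta,\gamma\in\Lambda$ with $d(\beta)=n$, $d(\gamma)=l$, $\alpha=\beta\gamma$. $\Lambda^0$ is the set of objects (vertices, identified with identity morphisms); $s(\alpha)$ and $r(\alpha)$ are the domain and codomain of $\alpha$. $u\mathcal C=r^{-1}(u)$, $\mathcal C v=s^{-1}(v)$, $u\mathcal Cv=u\mathcal C\cap\mathcal Cv$. A small category $\mathcal C$ is connected if the equivalence relation on $\mathcal C^0$ generated by $\{(u,v)\mid u\mathcal Cv\neq\emptyset\}$ is all of $\mathcal C^0\times\mathcal C^0$. A $k$-graph morphism is a degree-preserving functor. A covering of $\Lambda$ is a surjective $k$-graph morphism $p:\Omega\to\Lambda$ such that for all $v\in\Omega^0$, $p$ maps $\Omega v$ bijectively onto $\Lambda p(v)$ and $v\Omega$ bijectively onto $p(v)\Lambda$. It is connected if $\Omega$ (hence $\Lambda$) is connected. A morphism of coverings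 $(\Omega,p)\to(\Sigma,q)$ of $\Lambda$ is a $k$-graph morphism $\phi:\Omega\to\Sigma$ with $q\circ\phi=p$. A covering $(\Omega,p)$ is universal if it is connected and for every connected covering $(\Sigma,q)$ of $\Lambda$ there is a morphism $(\Omega,p)\to(\Sigma,q)$. The fundamental groupoid of $\Lambda$ is the groupoid $\mathcal G(\Lambda)$ with $\mathcal G(\Lambda)^0=\Lambda^0$, together with a functor $i:\Lambda\to\mathcal G(\Lambda)$ that is the identity on $\Lambda^0$, such that every functor from $\Lambda$ to a groupoid factors uniquely through $i$. The fundamental group at $x\in\Lambda^0$ is $\pi(\Lambda,x)=x\mathcal G(\Lambda)x$. A covering $p$ induces homomorphisms $p_*:\pi(\Omega,v)\to\pi(\Lambda,p(v))$. $\mathcal G(\Lambda)$ acts on $\Omega^0$: each $a\in x\mathcal G(\Lambda)y$ gives a bijection $u\mapsto au$ from $p^{-1}(y)$ to $p^{-1}(x)$, functorially, determined by $i(\alpha)u=r(\lambda)$ if $\alpha=p(\lambda)$ and $u=s(\lambda)$ with $\lambda\in\Omega$. For a connected covering this action is transitive ($\Omega^0=\mathcal G(\Lambda)v$). For a universal covering $p_*\pi(\Omega,v)$ is trivial, and all of $\pi(\Lambda,x)$ acts freely on the right of $(\Omega,p)$ by covering automorphisms as follows: for $\lambda\in\Omega$ and $c\in\pi(\Lambda,x)$, choose $a\in\mathcal G(\Lambda)$ with $s(\lambda)=av$; then $\lambda c$ is the unique element of $\Omega$ with $p(\lambda c)=p(\lambda)$ and $s(\lambda c)=acv$. $H$ acts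 by restriction. For a free right action of a group $H$ on $\Omega$ by automorphisms, the orbit set $\Omega/H$ is a $k$-graph with $s(\lambda H)=s(\lambda)H$, $r(\lambda H)=r(\lambda)H$, $(\lambda H)(\mu H)=(\lambda\mu)H$ (representatives chosen with $s(\lambda)=r(\mu)$), $d(\lambda H)=d(\lambda)$; when $H$ acts by covering automorphisms of $(\Omega,p)$, the map $\lambda H\mapsto p(\lambda)$ is a covering of $\Lambda$. *)

theory Defs
  imports
    "HOL-Algebra.Group"
    "HOL-Library.Function_Algebras"
begin

section \<open>Small categories, functors, groupoids\<close>

text \<open>Composition is written as for functions: \<open>\<alpha> \<cdot> \<beta>\<close> is meaningful when \<open>src \<alpha> = rng \<beta>\<close>.\<close>

record ('o, 'm) cat =
  obj :: "'o set"
  mor :: "'m set"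
  src :: "'m \<Rightarrow> 'o"
  rng :: "'m \<Rightarrow> 'o"
  idm :: "'o \<Rightarrow> 'm"
  cmp :: "'m \<Rightarrow> 'm \<Rightarrow> 'm"  (infixl "\<cdot>\<index>" 70)

locale category =
  fixes C :: "('o, 'm, 'z) cat_scheme" (structure)
  assumes src_closed: "\<alpha> \<in> mor C \<Longrightarrow> src C \<alpha> \<in> obj C"
    and rng_closed: "\<alpha> \<in> mor C \<Longrightarrow> rng C \<alpha> \<in> obj C"
    and idm_closed: "x \<in> obj C \<Longrightarrow> idm C x \<in> mor C"
    and src_idm: "x \<in> obj C \<Longrightarrow> src C (idm C x) = x"
    and rng_idm: "x \<in> obj C \<Longrightarrow> rng C (idm C x) = x"
    and cmp_closed: "\<lbrakk>\<alpha> \<in> mor C; \<beta> \<in> mor C; src C \<alpha> = rng C \<beta>\<rbrakk> \<Longrightarrow> \<alpha> \<cdot> \<beta> \<in> mor C"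
    and src_cmp: "\<lbrakk>\<alpha> \<in> mor C; \<beta> \<in> mor C; src C \<alpha> = rng C \<beta>\<rbrakk> \<Longrightarrow> src C (\<alpha> \<cdot> \<beta>) = src C \<beta>"
    and rng_cmp: "\<lbrakk>\<alpha> \<in> mor C; \<beta> \<in> mor C; src C \<alpha> = rng C \<beta>\<rbrakk> \<Longrightarrow> rng C (\<alpha> \<cdot> \<beta>) = rng C \<alpha>"
    and cmp_assoc: "\<lbrakk>\<alpha> \<in> mor C; \<beta> \<in> mor C; \<gamma> \<in> mor C; src C \<alpha> = rng C \<beta>; src C \<beta> = rng C \<gamma>\<rbrakk>
          \<Longrightarrow> (\<alpha> \<cdot> \<beta>) \<cdot> \<gamma> = \<alpha> \<cdot> (\<beta> \<cdot> \<gamma>)"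
    and idm_left: "\<alpha> \<in> mor C \<Longrightarrow> idm C (rng C \<alpha>) \<cdot> \<alpha> = \<alpha>"
    and idm_right: "\<alpha> \<in> mor C \<Longrightarrow> \<alpha> \<cdot> idm C (src C \<alpha>) = \<alpha>"

locale groupoid = category C for C :: "('o, 'm, 'z) cat_scheme" (structure) +
  assumes inverse_ex: "\<alpha> \<in> mor C \<Longrightarrow> \<exists>\<beta>\<in>mor C. src C \<beta> = rng C \<alpha> \<and> rng C \<beta> = src C \<alpha>
            \<and> \<alpha> \<cdot> \<beta> = idm C (rng C \<alpha>) \<and> \<beta> \<cdot> \<alpha> = idm C (src C \<alpha>)"

definition connected_cat :: "('o, 'm, 'z) cat_scheme \<Rightarrow> bool" where
  "connected_cat C \<longleftrightarrow>
     (\<forall>u\<in>obj C. \<forall>v\<in>obj C. equivclp (\<lambda>x y. \<exists>\<alpha>\<in>mor C. rng C \<alpha> = x \<and> src C \<alpha> = y) u v)"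

record ('o, 'm, 'p, 'n) cat_map =
  onob :: "'o \<Rightarrow> 'p"
  onmor :: "'m \<Rightarrow> 'n"

definition is_functor ::
  "('o, 'm, 'z) cat_scheme \<Rightarrow> ('p, 'n, 'y) cat_scheme \<Rightarrow> ('o, 'm, 'p, 'n) cat_map \<Rightarrow> bool" where
  "is_functor C D F \<longleftrightarrow>
     (\<forall>x\<in>obj C. onob F x \<in> obj D \<and> onmor F (idm C x) = idm D (onob F x)) \<and>
     (\<forall>\<alpha>\<in>mor C. onmor F \<alpha> \<in> mor D \<and> src D (onmor F \<alpha>) = onob F (src C \<alpha>)
                 \<and> rng D (onmor F \<alpha>) = onob F (rng C \<alpha>)) \<and>
     (\<forall>\<alpha>\<in>mor C. \<forall>\<beta>\<in>mor C. src C \<alpha> = rng C \<beta> \<longrightarrow>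
        onmor F (\<alpha> \<cdot>\<^bsub>C\<^esub> \<beta>) = onmor F \<alpha> \<cdot>\<^bsub>D\<^esub> onmor F \<beta>)"

definition comp_map ::
  "('p, 'n, 'q, 'l) cat_map \<Rightarrow> ('o, 'm, 'p, 'n) cat_map \<Rightarrow> ('o, 'm, 'q, 'l) cat_map" where
  "comp_map G F = \<lparr>onob = onob G \<circ> onob F, onmor = onmor G \<circ> onmor F\<rparr>"

definition id_map :: "('o, 'm, 'o, 'm) cat_map" where
  "id_map = \<lparr>onob = id, onmor = id\<rparr>"

text \<open>Equality of functors defined on \<open>C\<close>: values off the carriers are irrelevant.\<close>

definition eq_map ::
  "('o, 'm, 'z) cat_scheme \<Rightarrow> ('o, 'm, 'p, 'n) cat_map \<Rightarrow> ('o, 'm, 'p, 'n) cat_map \<Rightarrow> bool" where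
  "eq_map C F G \<longleftrightarrow>
     (\<forall>x\<in>obj C. onob F x = onob G x) \<and> (\<forall>\<alpha>\<in>mor C. onmor F \<alpha> = onmor G \<alpha>)"


section \<open>\<open>k\<close>-graphs and coverings\<close>

text \<open>Elements of \<open>\<nat>\<^sup>k\<close> are the functions \<open>nat \<Rightarrow> nat\<close> vanishing from index \<open>k\<close> on, added pointwise.\<close>

definition Nk :: "nat \<Rightarrow> (nat \<Rightarrow> nat) set" where
  "Nk k = {n. \<forall>i\<ge>k. n i = 0}"

record ('o, 'm) kcat = "('o, 'm) cat" +
  deg :: "'m \<Rightarrow> nat \<Rightarrow> nat"

locale kgraph = category \<Lambda> for k :: nat and \<Lambda> :: "('o, 'm, 'z) kcat_scheme" (structure) +
  assumes deg_closed: "\<alpha> \<in> mor \<Lambda> \<Longrightarrow> deg \<Lambda> \<alpha> \<in> Nk k"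
    and deg_idm: "x \<in> obj \<Lambda> \<Longrightarrow> deg \<Lambda> (idm \<Lambda> x) = 0"
    and deg_cmp: "\<lbrakk>\<alpha> \<in> mor \<Lambda>; \<beta> \<in> mor \<Lambda>; src \<Lambda> \<alpha> = rng \<Lambda> \<beta>\<rbrakk> \<Longrightarrow> deg \<Lambda> (\<alpha> \<cdot> \<beta>) = deg \<Lambda> \<alpha> + deg \<Lambda> \<beta>"
    and factorization: "\<lbrakk>\<alpha> \<in> mor \<Lambda>; n \<in> Nk k; l \<in> Nk k; deg \<Lambda> \<alpha> = n + l\<rbrakk> \<Longrightarrow>
          \<exists>!f. case f of (\<beta>, \<gamma>) \<Rightarrow> \<beta> \<in> mor \<Lambda> \<and> \<gamma> \<in> mor \<Lambda> \<and> src \<Lambda> \<beta> = rng \<Lambda> \<gamma>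
               \<and> deg \<Lambda> \<beta> = n \<and> deg \<Lambda> \<gamma> = l \<and> \<alpha> = \<beta> \<cdot> \<gamma>"

definition kgraph_morphism ::
  "('o, 'm, 'z) kcat_scheme \<Rightarrow> ('p, 'n, 'y) kcat_scheme \<Rightarrow> ('o, 'm, 'p, 'n) cat_map \<Rightarrow> bool" where
  "kgraph_morphism \<Omega> \<Lambda> p \<longleftrightarrow>
     is_functor \<Omega> \<Lambda> p \<and> (\<forall>\<alpha>\<in>mor \<Omega>. deg \<Lambda> (onmor p \<alpha>) = deg \<Omega> \<alpha>)"

text \<open>\<open>covering k \<Omega> p \<Lambda>\<close>: \<open>(\<Omega>, p)\<close> is a covering of the \<open>k\<close>-graph \<open>\<Lambda>\<close>.  Surjectivity on
  morphisms entails surjectivity on objects.\<close>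

definition covering ::
  "nat \<Rightarrow> ('u, 'a, 'z) kcat_scheme \<Rightarrow> ('u, 'a, 'o, 'm) cat_map \<Rightarrow> ('o, 'm, 'y) kcat_scheme \<Rightarrow> bool" where
  "covering k \<Omega> p \<Lambda> \<longleftrightarrow>
     kgraph k \<Omega> \<and> kgraph k \<Lambda> \<and> kgraph_morphism \<Omega> \<Lambda> p \<and>
     onmor p ` mor \<Omega> = mor \<Lambda> \<and>
     (\<forall>v\<in>obj \<Omega>.
        bij_betw (onmor p) {\<omega> \<in> mor \<Omega>. src \<Omega> \<omega> = v} {\<alpha> \<in> mor \<Lambda>. src \<Lambda> \<alpha> = onob p v} \<and>
        bij_betw (onmor p) {\<omega> \<in> mor \<Omega>. rng \<Omega> \<omega> = v} {\<alpha> \<in> mor \<Lambda>. rng \<Lambda> \<alpha> = onob p v})"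

definition connected_covering ::
  "nat \<Rightarrow> ('u, 'a, 'z) kcat_scheme \<Rightarrow> ('u, 'a, 'o, 'm) cat_map \<Rightarrow> ('o, 'm, 'y) kcat_scheme \<Rightarrow> bool" where
  "connected_covering k \<Omega> p \<Lambda> \<longleftrightarrow> covering k \<Omega> p \<Lambda> \<and> connected_cat \<Omega>"

definition covering_morphism ::
  "('u, 'a, 'z) kcat_scheme \<Rightarrow> ('u, 'a, 'o, 'm) cat_map \<Rightarrow>
   ('w, 'b, 'y) kcat_scheme \<Rightarrow> ('w, 'b, 'o, 'm) cat_map \<Rightarrow> ('u, 'a, 'w, 'b) cat_map \<Rightarrow> bool" where
  "covering_morphism \<Omega> p \<Sigma> q \<phi> \<longleftrightarrow> kgraph_morphism \<Omega> \<Sigma> \<phi> \<and> eq_map \<Omega> (comp_map q \<phi>) p"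

definition covering_isomorphic ::
  "('u, 'a, 'z) kcat_scheme \<Rightarrow> ('u, 'a, 'o, 'm) cat_map \<Rightarrow>
   ('w, 'b, 'y) kcat_scheme \<Rightarrow> ('w, 'b, 'o, 'm) cat_map \<Rightarrow> bool" where
  "covering_isomorphic \<Omega> p \<Sigma> q \<longleftrightarrow>
     (\<exists>\<phi> \<psi>. covering_morphism \<Omega> p \<Sigma> q \<phi> \<and> covering_morphism \<Sigma> q \<Omega> p \<psi> \<and>
        eq_map \<Omega> (comp_map \<psi> \<phi>) id_map \<and> eq_map \<Sigma> (comp_map \<phi> \<psi>) id_map)"

datatype 'm step = Fwd 'm | Bwd 'm

text \<open>Higher-order logic cannot quantify over types inside a definition, so the coverings \<open>\<Sigma>\<close> below
  range over two fixed types, built from words in the morphisms of \<open>\<Lambda>\<close>.  Every connected covering of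
  \<open>\<Lambda>\<close> is isomorphic to one on these types; the lemma \<open>universal_coveringD\<close> below derives from this
  definition the universal property for connected coverings on arbitrary types.\<close>

definition universal_covering ::
  "nat \<Rightarrow> ('u, 'a, 'z) kcat_scheme \<Rightarrow> ('u, 'a, 'o, 'm) cat_map \<Rightarrow> ('o, 'm, 'y) kcat_scheme \<Rightarrow> bool" where
  "universal_covering k \<Omega> p \<Lambda> \<longleftrightarrow>
     connected_covering k \<Omega> p \<Lambda> \<and>
     (\<forall>(\<Sigma> :: ('m step list, 'm step list \<times> 'm) kcat) q.
        connected_covering k \<Sigma> q \<Lambda> \<longrightarrow> (\<exists>\<phi>. covering_morphism \<Omega> p \<Sigma> q \<phi>))"


section \<open>The fundamental groupoid\<close>

text \<open>The groupoid presented by the morphisms of \<open>C\<close> and the relations holding in \<open>C\<close>.  That it has the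
  defining universal property, with respect to groupoids on arbitrary types, is proved in the lemma
  \<open>fund_groupoid_universal\<close> below.  \<open>walk C x w y\<close> says that \<open>w\<close> is a word of morphisms and formal
  inverses with range \<open>x\<close> and source \<open>y\<close>.\<close>

fun walk :: "('o, 'm, 'z) cat_scheme \<Rightarrow> 'o \<Rightarrow> 'm step list \<Rightarrow> 'o \<Rightarrow> bool" where
  "walk C x [] y \<longleftrightarrow> x \<in> obj C \<and> x = y"
| "walk C x (Fwd \<alpha> # w) y \<longleftrightarrow> \<alpha> \<in> mor C \<and> rng C \<alpha> = x \<and> walk C (src C \<alpha>) w y"
| "walk C x (Bwd \<alpha> # w) y \<longleftrightarrow> \<alpha> \<in> mor C \<and> src C \<alpha> = x \<and> walk C (rng C \<alpha>) w y"

inductive walk_eq :: "('o, 'm, 'z) cat_scheme \<Rightarrow> 'o \<Rightarrow> 'o \<Rightarrow> 'm step list \<Rightarrow> 'm step list \<Rightarrow> bool"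
  for C where
  refl: "walk C x w y \<Longrightarrow> walk_eq C x y w w"
| sym: "walk_eq C x y w w' \<Longrightarrow> walk_eq C x y w' w"
| trans: "walk_eq C x y w w' \<Longrightarrow> walk_eq C x y w' w'' \<Longrightarrow> walk_eq C x y w w''"
| cong: "walk_eq C x y u u' \<Longrightarrow> walk_eq C y z w w' \<Longrightarrow> walk_eq C x z (u @ w) (u' @ w')"
| unit: "x \<in> obj C \<Longrightarrow> walk_eq C x x [Fwd (idm C x)] []"
| comp: "\<lbrakk>\<alpha> \<in> mor C; \<beta> \<in> mor C; src C \<alpha> = rng C \<beta>\<rbrakk> \<Longrightarrow>
    walk_eq C (rng C \<alpha>) (src C \<beta>) [Fwd (\<alpha> \<cdot>\<^bsub>C\<^esub> \<beta>)] [Fwd \<alpha>, Fwd \<beta>]"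
| inv_right: "\<alpha> \<in> mor C \<Longrightarrow> walk_eq C (rng C \<alpha>) (rng C \<alpha>) [Fwd \<alpha>, Bwd \<alpha>] []"
| inv_left: "\<alpha> \<in> mor C \<Longrightarrow> walk_eq C (src C \<alpha>) (src C \<alpha>) [Bwd \<alpha>, Fwd \<alpha>] []"

text \<open>The endpoints are recorded in a morphism because the empty word does not determine them.\<close>

definition walk_class :: "('o, 'm, 'z) cat_scheme \<Rightarrow> 'o \<Rightarrow> 'm step list \<Rightarrow> 'o \<Rightarrow> 'o \<times> 'm step list set \<times> 'o" where
  "walk_class C x w y = (x, {w'. walk_eq C x y w w'}, y)"

definition fund_groupoid :: "('o, 'm, 'z) cat_scheme \<Rightarrow> ('o, 'o \<times> 'm step list set \<times> 'o) cat" where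
  "fund_groupoid C = \<lparr>
     obj = obj C,
     mor = {walk_class C x w y |x w y. walk C x w y},
     src = (\<lambda>(x, A, y). y),
     rng = (\<lambda>(x, A, y). x),
     idm = (\<lambda>x. walk_class C x [] x),
     cmp = (\<lambda>(x, A, y) (y', B, z). (x, {w. \<exists>u\<in>A. \<exists>u'\<in>B. walk_eq C x z (u @ u') w}, z))\<rparr>"

definition fund_incl :: "('o, 'm, 'z) cat_scheme \<Rightarrow> ('o, 'm, 'o, 'o \<times> 'm step list set \<times> 'o) cat_map" where
  "fund_incl C = \<lparr>onob = id, onmor = (\<lambda>\<alpha>. walk_class C (rng C \<alpha>) [Fwd \<alpha>] (src C \<alpha>))\<rparr>"

definition fund_group :: "('o, 'm, 'z) cat_scheme \<Rightarrow> 'o \<Rightarrow> ('o \<times> 'm step list set \<times> 'o) monoid" where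
  "fund_group C x = \<lparr>
     carrier = {a \<in> mor (fund_groupoid C). rng (fund_groupoid C) a = x \<and> src (fund_groupoid C) a = x},
     mult = cmp (fund_groupoid C),
     one = idm (fund_groupoid C) x\<rparr>"

text \<open>For a functor \<open>p\<close> from \<open>\<Omega>\<close> to \<open>\<Lambda>\<close>, the functor \<open>p\<^sub>*\<close> obtained by factoring \<open>i \<circ> p\<close> through the
  fundamental groupoid of \<open>\<Omega>\<close>; existence and uniqueness follow from the universal property
  (lemma \<open>fund_map\<close>).\<close>

definition fund_map ::
  "('u, 'a, 'z) cat_scheme \<Rightarrow> ('o, 'm, 'y) cat_scheme \<Rightarrow> ('u, 'a, 'o, 'm) cat_map \<Rightarrow>
   ('u, 'u \<times> 'a step list set \<times> 'u, 'o, 'o \<times> 'm step list set \<times> 'o) cat_map" where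
  "fund_map \<Omega> \<Lambda> p =
     (SOME F. is_functor (fund_groupoid \<Omega>) (fund_groupoid \<Lambda>) F \<and>
        eq_map \<Omega> (comp_map F (fund_incl \<Omega>)) (comp_map (fund_incl \<Lambda>) p))"


section \<open>The action of the fundamental groupoid on a covering\<close>

definition fibre :: "('u, 'a, 'z) cat_scheme \<Rightarrow> ('u, 'a, 'o, 'm) cat_map \<Rightarrow> 'o \<Rightarrow> 'u set" where
  "fibre \<Omega> p x = {u \<in> obj \<Omega>. onob p u = x}"

definition is_fund_action ::
  "('u, 'a, 'z) cat_scheme \<Rightarrow> ('u, 'a, 'o, 'm) cat_map \<Rightarrow> ('o, 'm, 'y) cat_scheme \<Rightarrow>
   ('o \<times> 'm step list set \<times> 'o \<Rightarrow> 'u \<Rightarrow> 'u) \<Rightarrow> bool" where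
  "is_fund_action \<Omega> p \<Lambda> act \<longleftrightarrow>
     (\<forall>a\<in>mor (fund_groupoid \<Lambda>).
        bij_betw (act a) (fibre \<Omega> p (src (fund_groupoid \<Lambda>) a)) (fibre \<Omega> p (rng (fund_groupoid \<Lambda>) a))) \<and>
     (\<forall>a\<in>mor (fund_groupoid \<Lambda>). \<forall>b\<in>mor (fund_groupoid \<Lambda>).
        src (fund_groupoid \<Lambda>) a = rng (fund_groupoid \<Lambda>) b \<longrightarrow>
        (\<forall>u\<in>fibre \<Omega> p (src (fund_groupoid \<Lambda>) b). act (a \<cdot>\<^bsub>fund_groupoid \<Lambda>\<^esub> b) u = act a (act b u))) \<and>
     (\<forall>x\<in>obj \<Lambda>. \<forall>u\<in>fibre \<Omega> p x. act (idm (fund_groupoid \<Lambda>) x) u = u) \<and>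
     (\<forall>\<omega>\<in>mor \<Omega>. act (onmor (fund_incl \<Lambda>) (onmor p \<omega>)) (src \<Omega> \<omega>) = rng \<Omega> \<omega>)"

text \<open>See the lemmas \<open>fund_act\<close> and \<open>fund_act_unique\<close> for existence and uniqueness.\<close>

definition fund_act ::
  "('u, 'a, 'z) cat_scheme \<Rightarrow> ('u, 'a, 'o, 'm) cat_map \<Rightarrow> ('o, 'm, 'y) cat_scheme \<Rightarrow>
   'o \<times> 'm step list set \<times> 'o \<Rightarrow> 'u \<Rightarrow> 'u" where
  "fund_act \<Omega> p \<Lambda> = (SOME act. is_fund_action \<Omega> p \<Lambda> act)"

text \<open>The right action of \<open>c \<in> \<pi>(\<Lambda>, p(v))\<close>, on objects (\<open>u = a v\<close> goes to \<open>a c v\<close>) and on morphisms.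
  On the identity morphism of \<open>u\<close> the second one is the identity of the image of \<open>u\<close> under the first.\<close>

definition right_act_ob ::
  "('u, 'a, 'z) cat_scheme \<Rightarrow> ('u, 'a, 'o, 'm) cat_map \<Rightarrow> ('o, 'm, 'y) cat_scheme \<Rightarrow> 'u \<Rightarrow>
   'u \<Rightarrow> 'o \<times> 'm step list set \<times> 'o \<Rightarrow> 'u" where
  "right_act_ob \<Omega> p \<Lambda> v u c =
     (let a = (SOME a. a \<in> mor (fund_groupoid \<Lambda>) \<and> src (fund_groupoid \<Lambda>) a = onob p v \<and>
                 fund_act \<Omega> p \<Lambda> a v = u)
      in fund_act \<Omega> p \<Lambda> (a \<cdot>\<^bsub>fund_groupoid \<Lambda>\<^esub> c) v)"

definition right_act ::
  "('u, 'a, 'z) cat_scheme \<Rightarrow> ('u, 'a, 'o, 'm) cat_map \<Rightarrow> ('o, 'm, 'y) cat_scheme \<Rightarrow> 'u \<Rightarrow>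
   'a \<Rightarrow> 'o \<times> 'm step list set \<times> 'o \<Rightarrow> 'a" where
  "right_act \<Omega> p \<Lambda> v \<omega> c =
     (THE \<mu>. \<mu> \<in> mor \<Omega> \<and> onmor p \<mu> = onmor p \<omega> \<and> src \<Omega> \<mu> = right_act_ob \<Omega> p \<Lambda> v (src \<Omega> \<omega>) c)"


section \<open>Orbit \<open>k\<close>-graphs\<close>

definition orbit :: "('b \<Rightarrow> 'h \<Rightarrow> 'b) \<Rightarrow> 'h set \<Rightarrow> 'b \<Rightarrow> 'b set" where
  "orbit act H b = act b ` H"

text \<open>The structure maps are computed on representatives: for a free action by automorphisms
  (\<open>act0\<close> on objects, \<open>act1\<close> on morphisms), \<open>src \<Omega> ` (\<omega>H) = (src \<Omega> \<omega>)H\<close>, and likewise for ranges and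
  identities; the set of all products of composable representatives of \<open>\<omega>H\<close> and \<open>\<mu>H\<close> is the orbit
  \<open>(\<omega>\<mu>)H\<close> of a single such product; and the degree is constant on orbits.  See the lemma
  \<open>orbit_graph_structure\<close>.\<close>

definition orbit_graph ::
  "('u, 'a, 'z) kcat_scheme \<Rightarrow> ('u \<Rightarrow> 'h \<Rightarrow> 'u) \<Rightarrow> ('a \<Rightarrow> 'h \<Rightarrow> 'a) \<Rightarrow> 'h set \<Rightarrow> ('u set, 'a set) kcat" where
  "orbit_graph \<Omega> act0 act1 H = \<lparr>
     obj = orbit act0 H ` obj \<Omega>,
     mor = orbit act1 H ` mor \<Omega>,
     src = (\<lambda>X. src \<Omega> ` X),
     rng = (\<lambda>X. rng \<Omega> ` X),
     idm = (\<lambda>U. idm \<Omega> ` U),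
     cmp = (\<lambda>X Y. {\<omega> \<cdot>\<^bsub>\<Omega>\<^esub> \<mu> |\<omega> \<mu>. \<omega> \<in> X \<and> \<mu> \<in> Y \<and> src \<Omega> \<omega> = rng \<Omega> \<mu>}),
     deg = (\<lambda>X. the_elem (deg \<Omega> ` X))\<rparr>"

definition orbit_covering :: "('u, 'a, 'o, 'm) cat_map \<Rightarrow> ('u set, 'a set, 'o, 'm) cat_map" where
  "orbit_covering p = \<lparr>onob = (\<lambda>U. the_elem (onob p ` U)), onmor = (\<lambda>X. the_elem (onmor p ` X))\<rparr>"

text \<open>The orbit graph \<open>\<Omega>/H\<close> for the right action of \<open>H \<subseteq> \<pi>(\<Lambda>, p(v))\<close> based at \<open>v\<close>.\<close>

definition quotient_graph ::
  "('u, 'a, 'z) kcat_scheme \<Rightarrow> ('u, 'a, 'o, 'm) cat_map \<Rightarrow> ('o, 'm, 'y) kcat_scheme \<Rightarrow> 'u \<Rightarrow>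
   ('o \<times> 'm step list set \<times> 'o) set \<Rightarrow> ('u set, 'a set) kcat" where
  "quotient_graph \<Omega> p \<Lambda> v H = orbit_graph \<Omega> (right_act_ob \<Omega> p \<Lambda> v) (right_act \<Omega> p \<Lambda> v) H"


section \<open>Justification of the definitions\<close>

context category begin

lemma walk_append: "walk C x u y \<Longrightarrow> walk C y w z \<Longrightarrow> walk C x (u @ w) z"
proof (induction u arbitrary: x)
  case (Cons a u)
  then show ?case by (cases a) auto
qed auto

lemma walk_ends: "walk C x w y \<Longrightarrow> x \<in> obj C \<and> y \<in> obj C"
proof (induction w arbitrary: x)
  case (Cons a u)
  then show ?case by (cases a) (auto simp: src_closed rng_closed)
qed auto

lemma walk_eq_walk: "walk_eq C x y w w' \<Longrightarrow> walk C x w y \<and> walk C x w' y"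
  by (induction rule: walk_eq.induct)
     (auto simp: walk_append idm_closed src_idm rng_idm cmp_closed src_cmp rng_cmp src_closed rng_closed)

lemma walk_class_eq_iff:
  assumes "walk C x w y"
  shows "walk_class C x w y = walk_class C x' w' y' \<longleftrightarrow> x = x' \<and> y = y' \<and> walk_eq C x y w w'"
  unfolding walk_class_def using assms
  by (auto intro: walk_eq.refl walk_eq.sym walk_eq.trans)

lemma fund_cmp:
  assumes "walk C x u y" "walk C y w z"
  shows "walk_class C x u y \<cdot>\<^bsub>fund_groupoid C\<^esub> walk_class C y w z = walk_class C x (u @ w) z"
proof -
  have "(\<exists>a. walk_eq C x y u a \<and> (\<exists>b. walk_eq C y z w b \<and> walk_eq C x z (a @ b) t))
      \<longleftrightarrow> walk_eq C x z (u @ w) t" for t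
    by (meson assms walk_eq.cong walk_eq.refl walk_eq.sym walk_eq.trans)
  then show ?thesis
    by (auto simp: fund_groupoid_def walk_class_def)
qed

end

fun inv_step :: "'m step \<Rightarrow> 'm step" where
  "inv_step (Fwd \<alpha>) = Bwd \<alpha>"
| "inv_step (Bwd \<alpha>) = Fwd \<alpha>"

definition inv_walk :: "'m step list \<Rightarrow> 'm step list" where
  "inv_walk w = rev (map inv_step w)"

lemma inv_inv_step: "inv_step (inv_step a) = a"
  by (cases a) auto

lemma inv_inv_walk: "inv_walk (inv_walk w) = w"
  by (simp add: inv_walk_def rev_map o_def inv_inv_step)

context category begin

lemma walk_inv: "walk C x w y \<Longrightarrow> walk C y (inv_walk w) x \<and> walk_eq C x x (w @ inv_walk w) []"
proof (induction w arbitrary: x)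
  case Nil
  then show ?case by (auto simp: inv_walk_def intro: walk_eq.refl)
next
  case (Cons a w)
  obtain z where a: "walk C x [a] z" "walk C z [inv_step a] x" "walk_eq C x x ([a] @ [inv_step a]) []"
      and w: "walk C z w y"
  proof (cases a)
    case (Fwd \<alpha>)
    then show thesis using Cons.prems that[of "src C \<alpha>"]
      by (auto simp: src_closed rng_closed walk_eq.inv_right)
  next
    case (Bwd \<alpha>)
    then show thesis using Cons.prems that[of "rng C \<alpha>"]
      by (auto simp: src_closed rng_closed walk_eq.inv_left)
  qed
  note IH = Cons.IH[OF w]
  have "walk_eq C x x ([a] @ (w @ inv_walk w) @ [inv_step a]) ([a] @ [] @ [inv_step a])"
    using a IH by (intro walk_eq.cong walk_eq.refl) auto
  then have "walk_eq C x x ([a] @ (w @ inv_walk w) @ [inv_step a]) []"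
    using a(3) by (auto intro: walk_eq.trans)
  moreover have "walk C y (inv_walk w @ [inv_step a]) x"
    using walk_append IH a by blast
  ultimately show ?case by (simp add: inv_walk_def)
qed

lemma walk_inv': "walk C x w y \<Longrightarrow> walk_eq C y y (inv_walk w @ w) []"
  using walk_inv[of y "inv_walk w" x] walk_inv[of x w y] by (simp add: inv_inv_walk)

lemma fund_sel [simp]:
  "obj (fund_groupoid C) = obj C"
  "src (fund_groupoid C) (walk_class C x w y) = y"
  "rng (fund_groupoid C) (walk_class C x w y) = x"
  "idm (fund_groupoid C) x = walk_class C x [] x"
  by (auto simp: fund_groupoid_def walk_class_def)

lemma fund_morE:
  assumes "a \<in> mor (fund_groupoid C)"
  obtains x w y where "a = walk_class C x w y" "walk C x w y"
  using assms by (auto simp: fund_groupoid_def)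

lemma fund_morI: "walk C x w y \<Longrightarrow> walk_class C x w y \<in> mor (fund_groupoid C)"
  by (auto simp: fund_groupoid_def)

lemma groupoid_fund_groupoid: "groupoid (fund_groupoid C)"
proof (unfold_locales, goal_cases)
  case (6 \<alpha> \<beta>)
  then show ?case by (auto elim!: fund_morE simp: fund_cmp walk_append intro!: fund_morI)
next
  case (9 \<alpha> \<beta> \<gamma>)
  then show ?case by (auto elim!: fund_morE simp: fund_cmp walk_append)
next
  case (10 \<alpha>)
  then show ?case by (elim fund_morE) (use walk_ends in \<open>auto simp: fund_cmp\<close>)
next
  case (11 \<alpha>)
  then show ?case by (elim fund_morE) (use walk_ends in \<open>auto simp: fund_cmp\<close>)
next
  case (12 \<alpha>)
  then obtain x w y where w: "\<alpha> = walk_class C x w y" "walk C x w y" by (elim fund_morE)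
  note i = walk_inv[OF w(2)] walk_inv'[OF w(2)]
  show ?case
    by (rule bexI[of _ "walk_class C y (inv_walk w) x"])
       (use w i in \<open>auto simp: fund_cmp fund_morI walk_class_eq_iff walk_append\<close>)
qed (auto elim!: fund_morE simp: fund_cmp fund_morI dest: walk_ends)

lemma fund_incl_functor: "is_functor C (fund_groupoid C) (fund_incl C)"
proof -
  have "walk_class C x [Fwd (idm C x)] x = walk_class C x [] x" if "x \<in> obj C" for x
    using that by (subst walk_class_eq_iff) (auto simp: idm_closed src_idm rng_idm intro: walk_eq.unit)
  moreover have "walk_class C (rng C \<alpha>) [Fwd (\<alpha> \<cdot> \<beta>)] (src C \<beta>) =
      walk_class C (rng C \<alpha>) [Fwd \<alpha>, Fwd \<beta>] (src C \<beta>)"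
    if "\<alpha> \<in> mor C" "\<beta> \<in> mor C" "src C \<alpha> = rng C \<beta>" for \<alpha> \<beta>
    using that
    by (subst walk_class_eq_iff) (auto simp: cmp_closed src_cmp rng_cmp src_closed intro: walk_eq.comp)
  ultimately show ?thesis
    by (auto simp: is_functor_def fund_incl_def src_idm rng_idm src_cmp rng_cmp fund_cmp
        src_closed rng_closed intro!: fund_morI)
qed

end

context groupoid begin

definition ginv :: "'m \<Rightarrow> 'm" where
  "ginv \<alpha> = (SOME \<beta>. \<beta> \<in> mor C \<and> src C \<beta> = rng C \<alpha> \<and> rng C \<beta> = src C \<alpha>
            \<and> \<alpha> \<cdot> \<beta> = idm C (rng C \<alpha>) \<and> \<beta> \<cdot> \<alpha> = idm C (src C \<alpha>))"

lemma ginv: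
  assumes "\<alpha> \<in> mor C"
  shows "ginv \<alpha> \<in> mor C" "src C (ginv \<alpha>) = rng C \<alpha>" "rng C (ginv \<alpha>) = src C \<alpha>"
    "\<alpha> \<cdot> ginv \<alpha> = idm C (rng C \<alpha>)" "ginv \<alpha> \<cdot> \<alpha> = idm C (src C \<alpha>)"
proof -
  from inverse_ex[OF assms] have "\<exists>\<beta>. \<beta> \<in> mor C \<and> src C \<beta> = rng C \<alpha> \<and> rng C \<beta> = src C \<alpha>
            \<and> \<alpha> \<cdot> \<beta> = idm C (rng C \<alpha>) \<and> \<beta> \<cdot> \<alpha> = idm C (src C \<alpha>)" by blast
  from someI_ex[OF this] show "ginv \<alpha> \<in> mor C" "src C (ginv \<alpha>) = rng C \<alpha>" "rng C (ginv \<alpha>) = src C \<alpha>"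
    "\<alpha> \<cdot> ginv \<alpha> = idm C (rng C \<alpha>)" "ginv \<alpha> \<cdot> \<alpha> = idm C (src C \<alpha>)"
    unfolding ginv_def by blast+
qed

lemma ginv_unique:
  assumes "\<alpha> \<in> mor C" "\<beta> \<in> mor C" "src C \<alpha> = rng C \<beta>" "\<beta> \<cdot> \<alpha> = idm C (src C \<alpha>)" "src C \<beta> = rng C \<alpha>"
  shows "\<beta> = ginv \<alpha>"
proof -
  have "\<beta> = \<beta> \<cdot> (\<alpha> \<cdot> ginv \<alpha>)"
    using assms idm_right[of \<beta>] by (simp add: ginv)
  also have "\<dots> = (\<beta> \<cdot> \<alpha>) \<cdot> ginv \<alpha>"
    by (rule cmp_assoc[symmetric]) (use assms in \<open>simp_all add: ginv\<close>)
  also have "\<dots> = ginv \<alpha>"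
    using assms idm_left[of "ginv \<alpha>"] by (simp add: ginv)
  finally show ?thesis .
qed

fun weval :: "('p, 'n, 'o, 'm) cat_map \<Rightarrow> 'n step list \<Rightarrow> 'p \<Rightarrow> 'm" where
  "weval F [] y = idm C (onob F y)"
| "weval F (Fwd \<alpha> # w) y = onmor F \<alpha> \<cdot> weval F w y"
| "weval F (Bwd \<alpha> # w) y = ginv (onmor F \<alpha>) \<cdot> weval F w y"

end

locale functor_to_groupoid = D: category D + groupoid C
  for D :: "('p, 'n, 'y) cat_scheme" and C :: "('o, 'm, 'z) cat_scheme" (structure) +
  fixes F :: "('p, 'n, 'o, 'm) cat_map"
  assumes F: "is_functor D C F"
begin

lemma F_ob: "x \<in> obj D \<Longrightarrow> onob F x \<in> obj C"
  and F_idm: "x \<in> obj D \<Longrightarrow> onmor F (idm D x) = idm C (onob F x)"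
  and F_mor: "\<alpha> \<in> mor D \<Longrightarrow> onmor F \<alpha> \<in> mor C"
  and F_src: "\<alpha> \<in> mor D \<Longrightarrow> src C (onmor F \<alpha>) = onob F (src D \<alpha>)"
  and F_rng: "\<alpha> \<in> mor D \<Longrightarrow> rng C (onmor F \<alpha>) = onob F (rng D \<alpha>)"
  and F_cmp: "\<alpha> \<in> mor D \<Longrightarrow> \<beta> \<in> mor D \<Longrightarrow> src D \<alpha> = rng D \<beta> \<Longrightarrow>
      onmor F (\<alpha> \<cdot>\<^bsub>D\<^esub> \<beta>) = onmor F \<alpha> \<cdot> onmor F \<beta>"
  using F by (auto simp: is_functor_def)

lemmas F_simps = F_ob F_idm F_mor F_src F_rng F_cmp ginv src_cmp rng_cmp cmp_closed
  src_idm rng_idm idm_closed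

lemma weval:
  "walk D x w y \<Longrightarrow> weval F w y \<in> mor C \<and> src C (weval F w y) = onob F y \<and> rng C (weval F w y) = onob F x"
proof (induction w arbitrary: x)
  case (Cons a w)
  then show ?case by (cases a) (auto simp: F_simps)
qed (auto simp: F_simps)

lemma weval_append:
  "walk D x u y \<Longrightarrow> walk D y w z \<Longrightarrow> weval F (u @ w) z = weval F u y \<cdot> weval F w z"
proof (induction u arbitrary: x)
  case Nil
  then show ?case using weval[of y w z] idm_left[of "weval F w z"] by auto
next
  case (Cons a u)
  then show ?case using weval[of _ u y] weval[of y w z]
    by (cases a) (auto simp: F_simps cmp_assoc)
qed

lemma weval_cong: "walk_eq D x y w w' \<Longrightarrow> weval F w y = weval F w' y"
proof (induction rule: walk_eq.induct)
  case (cong x y u u' z w w')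
  then show ?case
    using D.walk_eq_walk weval_append by metis
next
  case (unit x)
  then show ?case using idm_left[of "idm C (onob F x)"] by (auto simp: F_simps)
next
  case (comp \<alpha> \<beta>)
  then show ?case using idm_right[of "onmor F \<beta>"] idm_right[of "onmor F \<alpha> \<cdot> onmor F \<beta>"]
    by (auto simp: F_simps)
next
  case (inv_right \<alpha>)
  then show ?case using idm_right[of "ginv (onmor F \<alpha>)"] by (auto simp: F_simps)
next
  case (inv_left \<alpha>)
  then show ?case using idm_right[of "onmor F \<alpha>"] by (auto simp: F_simps)
qed auto

definition extension where
  "extension = \<lparr>onob = onob F, onmor = (\<lambda>(x, A, y). weval F (SOME w. w \<in> A) y)\<rparr>"

lemma extension_class: "walk D x w y \<Longrightarrow> onmor extension (walk_class D x w y) = weval F w y"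
proof -
  assume w: "walk D x w y"
  then have "walk_eq D x y w (SOME w'. walk_eq D x y w w')"
    by (metis walk_eq.refl someI)
  then show ?thesis by (auto simp: extension_def walk_class_def dest: weval_cong)
qed

lemma extension_functor: "is_functor (fund_groupoid D) C extension"
proof -
  have [simp]: "onob extension = onob F" by (simp add: extension_def)
  show ?thesis unfolding is_functor_def
    by (auto elim!: D.fund_morE simp: extension_class F_simps weval D.fund_cmp D.walk_append weval_append)
qed

lemma extension_incl: "eq_map D (comp_map extension (fund_incl D)) F"
proof -
  have "onmor F \<alpha> \<cdot> idm C (onob F (src D \<alpha>)) = onmor F \<alpha>" if "\<alpha> \<in> mor D" for \<alpha>
    using that idm_right[of "onmor F \<alpha>"] by (simp add: F_simps)
  then show ?thesis
    by (auto simp: eq_map_def comp_map_def fund_incl_def extension_class D.src_closed)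
       (simp add: extension_def)
qed

lemma extension_unique:
  assumes G: "is_functor (fund_groupoid D) C G" and e: "eq_map D (comp_map G (fund_incl D)) F"
  shows "eq_map (fund_groupoid D) G extension"
proof -
  have ob: "onob G x = onob F x" if "x \<in> obj D" for x
    using e that by (auto simp: eq_map_def comp_map_def fund_incl_def)
  have G_cmp: "onmor G (walk_class D x (u @ w) z) = onmor G (walk_class D x u y) \<cdot> onmor G (walk_class D y w z)"
    if "walk D x u y" "walk D y w z" for x y z u w
    using G that D.fund_morI[OF that(1)] D.fund_morI[OF that(2)]
    by (simp add: is_functor_def D.fund_cmp[symmetric])
  have G_nil: "onmor G (walk_class D x [] x) = idm C (onob F x)" if "x \<in> obj D" for x
    using G that ob by (auto simp: is_functor_def)
  have G_mor: "onmor G (walk_class D x w y) \<in> mor C \<and> src C (onmor G (walk_class D x w y)) = onob F y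
      \<and> rng C (onmor G (walk_class D x w y)) = onob F x" if "walk D x w y" for x w y
    using G D.fund_morI[OF that] ob D.walk_ends[OF that] by (auto simp: is_functor_def)
  have G_fwd: "onmor G (walk_class D (rng D \<alpha>) [Fwd \<alpha>] (src D \<alpha>)) = onmor F \<alpha>" if "\<alpha> \<in> mor D" for \<alpha>
    using e that by (auto simp: eq_map_def comp_map_def fund_incl_def)
  have G_bwd: "onmor G (walk_class D (src D \<alpha>) [Bwd \<alpha>] (rng D \<alpha>)) = ginv (onmor F \<alpha>)"
    if \<alpha>: "\<alpha> \<in> mor D" for \<alpha>
  proof (rule ginv_unique)
    have w: "walk D (src D \<alpha>) [Bwd \<alpha>] (rng D \<alpha>)" "walk D (rng D \<alpha>) [Fwd \<alpha>] (src D \<alpha>)"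
      using \<alpha> by (auto simp: D.src_closed D.rng_closed)
    have "walk_class D (src D \<alpha>) [Bwd \<alpha>, Fwd \<alpha>] (src D \<alpha>) = walk_class D (src D \<alpha>) [] (src D \<alpha>)"
      using \<alpha> by (subst D.walk_class_eq_iff) (auto simp: D.src_closed intro: walk_eq.inv_left)
    then show "onmor G (walk_class D (src D \<alpha>) [Bwd \<alpha>] (rng D \<alpha>)) \<cdot> onmor F \<alpha> = idm C (src C (onmor F \<alpha>))"
      using G_cmp[OF w] \<alpha> G_fwd G_nil by (auto simp: F_simps D.src_closed)
    show "onmor F \<alpha> \<in> mor C" using \<alpha> by (simp add: F_simps)
    show "onmor G (walk_class D (src D \<alpha>) [Bwd \<alpha>] (rng D \<alpha>)) \<in> mor C"
      "src C (onmor F \<alpha>) = rng C (onmor G (walk_class D (src D \<alpha>) [Bwd \<alpha>] (rng D \<alpha>)))"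
      "src C (onmor G (walk_class D (src D \<alpha>) [Bwd \<alpha>] (rng D \<alpha>))) = rng C (onmor F \<alpha>)"
      using G_mor[OF w(1)] \<alpha> by (auto simp: F_simps)
  qed
  have "onmor G (walk_class D x w y) = weval F w y" if "walk D x w y" for x w y
    using that
  proof (induction w arbitrary: x)
    case Nil
    then show ?case using G_nil by auto
  next
    case (Cons a w)
    show ?case
    proof (cases a)
      case (Fwd \<alpha>)
      then show ?thesis using Cons G_fwd[of \<alpha>] G_cmp[of x "[a]" "src D \<alpha>" w y]
        by (auto simp: D.src_closed)
    next
      case (Bwd \<alpha>)
      then show ?thesis using Cons G_bwd[of \<alpha>] G_cmp[of x "[a]" "rng D \<alpha>" w y]
        by (auto simp: D.rng_closed)
    qed
  qed
  then show ?thesis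
    by (auto simp: eq_map_def ob extension_class elim!: D.fund_morE) (simp add: extension_def)
qed

end

lemma fund_groupoid_universal:
  assumes C: "category C" and K: "groupoid K" and F: "is_functor C K F"
  shows "\<exists>G. is_functor (fund_groupoid C) K G \<and> eq_map C (comp_map G (fund_incl C)) F \<and>
           (\<forall>G'. is_functor (fund_groupoid C) K G' \<and> eq_map C (comp_map G' (fund_incl C)) F
                 \<longrightarrow> eq_map (fund_groupoid C) G' G)"
proof -
  interpret C: category C by fact
  interpret K: groupoid K by fact
  interpret functor_to_groupoid C K F by unfold_locales fact
  show ?thesis using extension_functor extension_incl extension_unique by blast
qed

lemma (in category) group_fund_group:
  assumes "x \<in> obj C"
  shows "group (fund_group C x)"
proof -
  interpret G: groupoid "fund_groupoid C" by (rule groupoid_fund_groupoid)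
  show ?thesis
  proof (rule groupI, goal_cases)
    case (5 a)
    then show ?case using G.inverse_ex[of a] by (auto simp: fund_group_def)
  next
    case (4 a)
    then show ?case using G.idm_left[of a] by (auto simp: fund_group_def)
  qed (use assms in \<open>auto simp: fund_group_def G.cmp_closed G.src_cmp G.rng_cmp G.cmp_assoc fund_morI\<close>)
qed

lemma is_functor_comp:
  "is_functor C D F \<Longrightarrow> is_functor D E G \<Longrightarrow> is_functor C E (comp_map G F)"
  unfolding is_functor_def comp_map_def by simp

lemma fund_map:
  assumes "category \<Omega>" "category \<Lambda>" "is_functor \<Omega> \<Lambda> p"
  shows "is_functor (fund_groupoid \<Omega>) (fund_groupoid \<Lambda>) (fund_map \<Omega> \<Lambda> p)"
    and "eq_map \<Omega> (comp_map (fund_map \<Omega> \<Lambda> p) (fund_incl \<Omega>)) (comp_map (fund_incl \<Lambda>) p)"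
    and "\<lbrakk>is_functor (fund_groupoid \<Omega>) (fund_groupoid \<Lambda>) F;
          eq_map \<Omega> (comp_map F (fund_incl \<Omega>)) (comp_map (fund_incl \<Lambda>) p)\<rbrakk>
         \<Longrightarrow> eq_map (fund_groupoid \<Omega>) F (fund_map \<Omega> \<Lambda> p)"
proof -
  note U = fund_groupoid_universal[OF assms(1) category.groupoid_fund_groupoid[OF assms(2)]
      is_functor_comp[OF assms(3) category.fund_incl_functor[OF assms(2)]]]
  then obtain F' where "is_functor (fund_groupoid \<Omega>) (fund_groupoid \<Lambda>) F' \<and>
      eq_map \<Omega> (comp_map F' (fund_incl \<Omega>)) (comp_map (fund_incl \<Lambda>) p)" by blast
  from someI[of "\<lambda>F. is_functor (fund_groupoid \<Omega>) (fund_groupoid \<Lambda>) F \<and>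
      eq_map \<Omega> (comp_map F (fund_incl \<Omega>)) (comp_map (fund_incl \<Lambda>) p)", OF this]
  show a: "is_functor (fund_groupoid \<Omega>) (fund_groupoid \<Lambda>) (fund_map \<Omega> \<Lambda> p)"
    and b: "eq_map \<Omega> (comp_map (fund_map \<Omega> \<Lambda> p) (fund_incl \<Omega>)) (comp_map (fund_incl \<Lambda>) p)"
    unfolding fund_map_def by blast+
  assume "is_functor (fund_groupoid \<Omega>) (fund_groupoid \<Lambda>) F"
          "eq_map \<Omega> (comp_map F (fund_incl \<Omega>)) (comp_map (fund_incl \<Lambda>) p)"
  then show "eq_map (fund_groupoid \<Omega>) F (fund_map \<Omega> \<Lambda> p)"
    using U a b unfolding eq_map_def by metis
qed

text \<open>Existence and uniqueness of the action on the objects of a covering: it is the functor to the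
  groupoid of bijections between fibres that extends \<open>\<alpha> \<mapsto> (u \<mapsto> rng (lift of \<alpha> at u))\<close>.\<close>

locale covering_context =
  fixes k and \<Omega> :: "('u, 'a, 'z) kcat_scheme" and p :: "('u, 'a, 'o, 'm) cat_map"
    and \<Lambda> :: "('o, 'm, 'y) kcat_scheme"
  assumes cov: "covering k \<Omega> p \<Lambda>"
begin

sublocale \<Omega>: kgraph k \<Omega> using cov by (simp add: covering_def)
sublocale \<Lambda>: kgraph k \<Lambda> using cov by (simp add: covering_def)

lemma p_functor: "is_functor \<Omega> \<Lambda> p"
  using cov by (auto simp: covering_def kgraph_morphism_def)

lemma p_ob: "u \<in> obj \<Omega> \<Longrightarrow> onob p u \<in> obj \<Lambda>"
  and p_idm: "u \<in> obj \<Omega> \<Longrightarrow> onmor p (idm \<Omega> u) = idm \<Lambda> (onob p u)"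
  and p_mor: "\<omega> \<in> mor \<Omega> \<Longrightarrow> onmor p \<omega> \<in> mor \<Lambda>"
  and p_src: "\<omega> \<in> mor \<Omega> \<Longrightarrow> src \<Lambda> (onmor p \<omega>) = onob p (src \<Omega> \<omega>)"
  and p_rng: "\<omega> \<in> mor \<Omega> \<Longrightarrow> rng \<Lambda> (onmor p \<omega>) = onob p (rng \<Omega> \<omega>)"
  and p_cmp: "\<omega> \<in> mor \<Omega> \<Longrightarrow> \<mu> \<in> mor \<Omega> \<Longrightarrow> src \<Omega> \<omega> = rng \<Omega> \<mu> \<Longrightarrow>
      onmor p (\<omega> \<cdot>\<^bsub>\<Omega>\<^esub> \<mu>) = onmor p \<omega> \<cdot>\<^bsub>\<Lambda>\<^esub> onmor p \<mu>"
  using p_functor by (auto simp: is_functor_def)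

lemma lift_src_ex:
  assumes "\<alpha> \<in> mor \<Lambda>" "u \<in> fibre \<Omega> p (src \<Lambda> \<alpha>)"
  shows "\<exists>\<omega>\<in>mor \<Omega>. onmor p \<omega> = \<alpha> \<and> src \<Omega> \<omega> = u"
proof -
  have "bij_betw (onmor p) {\<omega> \<in> mor \<Omega>. src \<Omega> \<omega> = u} {\<alpha> \<in> mor \<Lambda>. src \<Lambda> \<alpha> = onob p u}"
    using cov assms(2) by (auto simp: covering_def fibre_def)
  from bij_betw_imp_surj_on[OF this] assms show ?thesis by (force simp: fibre_def)
qed

lemma lift_rng_ex:
  assumes "\<alpha> \<in> mor \<Lambda>" "u \<in> fibre \<Omega> p (rng \<Lambda> \<alpha>)"
  shows "\<exists>\<omega>\<in>mor \<Omega>. onmor p \<omega> = \<alpha> \<and> rng \<Omega> \<omega> = u"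
proof -
  have "bij_betw (onmor p) {\<omega> \<in> mor \<Omega>. rng \<Omega> \<omega> = u} {\<alpha> \<in> mor \<Lambda>. rng \<Lambda> \<alpha> = onob p u}"
    using cov assms(2) by (auto simp: covering_def fibre_def)
  from bij_betw_imp_surj_on[OF this] assms show ?thesis by (force simp: fibre_def)
qed

lemma lift_src_unique:
  assumes "\<omega> \<in> mor \<Omega>" "\<mu> \<in> mor \<Omega>" "onmor p \<omega> = onmor p \<mu>" "src \<Omega> \<omega> = src \<Omega> \<mu>"
  shows "\<omega> = \<mu>"
proof -
  have "inj_on (onmor p) {\<nu> \<in> mor \<Omega>. src \<Omega> \<nu> = src \<Omega> \<mu>}"
    using cov assms(2) \<Omega>.src_closed by (auto simp: covering_def bij_betw_def)
  then show ?thesis using assms by (auto dest: inj_onD)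
qed

lemma lift_rng_unique:
  assumes "\<omega> \<in> mor \<Omega>" "\<mu> \<in> mor \<Omega>" "onmor p \<omega> = onmor p \<mu>" "rng \<Omega> \<omega> = rng \<Omega> \<mu>"
  shows "\<omega> = \<mu>"
proof -
  have "inj_on (onmor p) {\<nu> \<in> mor \<Omega>. rng \<Omega> \<nu> = rng \<Omega> \<mu>}"
    using cov assms(2) \<Omega>.rng_closed by (auto simp: covering_def bij_betw_def)
  then show ?thesis using assms by (auto dest: inj_onD)
qed

definition lift where
  "lift \<alpha> u = (SOME \<omega>. \<omega> \<in> mor \<Omega> \<and> onmor p \<omega> = \<alpha> \<and> src \<Omega> \<omega> = u)"

lemma lift:
  assumes "\<alpha> \<in> mor \<Lambda>" "u \<in> fibre \<Omega> p (src \<Lambda> \<alpha>)"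
  shows "lift \<alpha> u \<in> mor \<Omega>" "onmor p (lift \<alpha> u) = \<alpha>" "src \<Omega> (lift \<alpha> u) = u"
proof -
  have "\<exists>\<omega>. \<omega> \<in> mor \<Omega> \<and> onmor p \<omega> = \<alpha> \<and> src \<Omega> \<omega> = u"
    using lift_src_ex[OF assms] by blast
  from someI_ex[OF this] show "lift \<alpha> u \<in> mor \<Omega>" "onmor p (lift \<alpha> u) = \<alpha>" "src \<Omega> (lift \<alpha> u) = u"
    unfolding lift_def by blast+
qed

lemma lift_eqI: "\<omega> \<in> mor \<Omega> \<Longrightarrow> onmor p \<omega> = \<alpha> \<Longrightarrow> src \<Omega> \<omega> = u \<Longrightarrow> lift \<alpha> u = \<omega>"
  using lift[of \<alpha> u] lift_src_unique[of "lift \<alpha> u" \<omega>] p_mor[of \<omega>] p_src[of \<omega>] \<Omega>.src_closed[of \<omega>]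
  by (auto simp: fibre_def)

definition fibre_groupoid :: "('o, 'o \<times> ('u \<Rightarrow> 'u) \<times> 'o) cat" where
  "fibre_groupoid = \<lparr>
     obj = obj \<Lambda>,
     mor = {(x, f, y). x \<in> obj \<Lambda> \<and> y \<in> obj \<Lambda> \<and> f \<in> extensional (fibre \<Omega> p y) \<and>
              bij_betw f (fibre \<Omega> p y) (fibre \<Omega> p x)},
     src = (\<lambda>(x, f, y). y),
     rng = (\<lambda>(x, f, y). x),
     idm = (\<lambda>x. (x, restrict id (fibre \<Omega> p x), x)),
     cmp = (\<lambda>(x, f, y) (y', g, z). (x, compose (fibre \<Omega> p z) f g, z))\<rparr>"

lemma groupoid_fibre_groupoid: "groupoid fibre_groupoid"
proof (unfold_locales, goal_cases)
  case (6 \<alpha> \<beta>)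
  then show ?case
    by (auto simp: fibre_groupoid_def intro: bij_betw_compose)
next
  case (9 \<alpha> \<beta> \<gamma>)
  then show ?case
    by (auto simp: fibre_groupoid_def compose_def fun_eq_iff dest: bij_betwE)
next
  case (10 \<alpha>)
  then show ?case
    by (auto simp: fibre_groupoid_def compose_def fun_eq_iff extensional_def dest: bij_betwE)
next
  case (11 \<alpha>)
  then show ?case
    by (auto simp: fibre_groupoid_def compose_def fun_eq_iff extensional_def)
next
  case (12 \<alpha>)
  then obtain x f y where f: "\<alpha> = (x, f, y)" "x \<in> obj \<Lambda>" "y \<in> obj \<Lambda>"
      "bij_betw f (fibre \<Omega> p y) (fibre \<Omega> p x)" "f \<in> extensional (fibre \<Omega> p y)"
    by (auto simp: fibre_groupoid_def)
  let ?g = "restrict (inv_into (fibre \<Omega> p y) f) (fibre \<Omega> p x)"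
  have g: "bij_betw ?g (fibre \<Omega> p x) (fibre \<Omega> p y)"
    using bij_betw_inv_into[OF f(4)] by (simp cong: bij_betw_cong)
  have "compose (fibre \<Omega> p x) f ?g = restrict id (fibre \<Omega> p x)"
    using f(4) by (auto simp: compose_def fun_eq_iff bij_betw_inv_into_right)
  moreover have "compose (fibre \<Omega> p y) ?g f = restrict id (fibre \<Omega> p y)"
    using f(4) bij_betwE[OF f(4)] by (auto simp: compose_def fun_eq_iff bij_betw_inv_into_left)
  ultimately show ?case
    using f g by (intro bexI[of _ "(y, ?g, x)"]) (auto simp: fibre_groupoid_def)
next
  case (3 x)
  then show ?case by (auto simp: fibre_groupoid_def bij_betw_def inj_on_def)
qed (auto simp: fibre_groupoid_def)

definition fibre_functor :: "('o, 'm, 'o, 'o \<times> ('u \<Rightarrow> 'u) \<times> 'o) cat_map" where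
  "fibre_functor = \<lparr>onob = id,
     onmor = (\<lambda>\<alpha>. (rng \<Lambda> \<alpha>, \<lambda>u\<in>fibre \<Omega> p (src \<Lambda> \<alpha>). rng \<Omega> (lift \<alpha> u), src \<Lambda> \<alpha>))\<rparr>"

lemma rng_lift:
  assumes "\<alpha> \<in> mor \<Lambda>" "u \<in> fibre \<Omega> p (src \<Lambda> \<alpha>)"
  shows "rng \<Omega> (lift \<alpha> u) \<in> fibre \<Omega> p (rng \<Lambda> \<alpha>)"
  using lift[OF assms] p_rng[of "lift \<alpha> u"] \<Omega>.rng_closed by (auto simp: fibre_def)

lemma bij_lift:
  assumes \<alpha>: "\<alpha> \<in> mor \<Lambda>"
  shows "bij_betw (\<lambda>u. rng \<Omega> (lift \<alpha> u)) (fibre \<Omega> p (src \<Lambda> \<alpha>)) (fibre \<Omega> p (rng \<Lambda> \<alpha>))"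
  unfolding bij_betw_def
proof (intro conjI inj_onI subset_antisym subsetI)
  fix u u' assume u: "u \<in> fibre \<Omega> p (src \<Lambda> \<alpha>)" "u' \<in> fibre \<Omega> p (src \<Lambda> \<alpha>)"
    and "rng \<Omega> (lift \<alpha> u) = rng \<Omega> (lift \<alpha> u')"
  then have "lift \<alpha> u = lift \<alpha> u'"
    using lift[OF \<alpha>] by (intro lift_rng_unique) auto
  then show "u = u'" using lift(3)[OF \<alpha>] u by metis
next
  fix w assume "w \<in> fibre \<Omega> p (rng \<Lambda> \<alpha>)"
  from lift_rng_ex[OF \<alpha> this] obtain \<omega> where "\<omega> \<in> mor \<Omega>" "onmor p \<omega> = \<alpha>" "rng \<Omega> \<omega> = w"
    by blast
  then show "w \<in> (\<lambda>u. rng \<Omega> (lift \<alpha> u)) ` fibre \<Omega> p (src \<Lambda> \<alpha>)"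
    using lift_eqI[of \<omega> \<alpha> "src \<Omega> \<omega>"] p_src[of \<omega>] \<Omega>.src_closed[of \<omega>]
    by (intro image_eqI[of _ _ "src \<Omega> \<omega>"]) (auto simp: fibre_def)
qed (auto simp: rng_lift \<alpha>)

lemma fibre_functor: "is_functor \<Lambda> fibre_groupoid fibre_functor"
proof -
  have "lift (idm \<Lambda> x) u = idm \<Omega> u" if "u \<in> fibre \<Omega> p x" for x u
    using that by (intro lift_eqI) (auto simp: fibre_def p_idm \<Omega>.idm_closed \<Omega>.src_idm)
  then have idm: "(\<lambda>u\<in>fibre \<Omega> p x. rng \<Omega> (lift (idm \<Lambda> x) u)) = restrict id (fibre \<Omega> p x)" for x
    by (auto simp: fun_eq_iff fibre_def \<Omega>.rng_idm)
  have cmp: "rng \<Omega> (lift (\<alpha> \<cdot>\<^bsub>\<Lambda>\<^esub> \<beta>) u) = rng \<Omega> (lift \<alpha> (rng \<Omega> (lift \<beta> u)))"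
    if \<alpha>: "\<alpha> \<in> mor \<Lambda>" and \<beta>: "\<beta> \<in> mor \<Lambda>" "src \<Lambda> \<alpha> = rng \<Lambda> \<beta>" and u: "u \<in> fibre \<Omega> p (src \<Lambda> \<beta>)"
    for \<alpha> \<beta> u
  proof -
    note l = lift[OF \<beta>(1) u] and r = rng_lift[OF \<beta>(1) u]
    note l' = lift[OF \<alpha> r[folded \<beta>(2)]]
    have "lift (\<alpha> \<cdot>\<^bsub>\<Lambda>\<^esub> \<beta>) u = lift \<alpha> (rng \<Omega> (lift \<beta> u)) \<cdot>\<^bsub>\<Omega>\<^esub> lift \<beta> u"
      using l l' by (intro lift_eqI) (auto simp: \<Omega>.cmp_closed \<Omega>.src_cmp p_cmp)
    then show ?thesis using l l' by (simp add: \<Omega>.rng_cmp)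
  qed
  show ?thesis
    unfolding is_functor_def
    using bij_lift
    by (auto simp: fibre_groupoid_def fibre_functor_def idm \<Lambda>.src_idm \<Lambda>.rng_idm \<Lambda>.src_closed
        \<Lambda>.rng_closed \<Lambda>.src_cmp \<Lambda>.rng_cmp compose_def fun_eq_iff cmp rng_lift cong: bij_betw_cong)
qed

lemma fund_act_ex:
  "\<exists>G. is_functor (fund_groupoid \<Lambda>) fibre_groupoid G \<and>
       eq_map \<Lambda> (comp_map G (fund_incl \<Lambda>)) fibre_functor \<and>
       (\<forall>G'. is_functor (fund_groupoid \<Lambda>) fibre_groupoid G' \<and>
          eq_map \<Lambda> (comp_map G' (fund_incl \<Lambda>)) fibre_functor \<longrightarrow> eq_map (fund_groupoid \<Lambda>) G' G)"
  by (rule fund_groupoid_universal[OF \<Lambda>.category_axioms groupoid_fibre_groupoid fibre_functor])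

lemma fund_action_of_functor:
  assumes G: "is_functor (fund_groupoid \<Lambda>) fibre_groupoid G"
    and i: "eq_map \<Lambda> (comp_map G (fund_incl \<Lambda>)) fibre_functor"
  shows "is_fund_action \<Omega> p \<Lambda> (\<lambda>a. fst (snd (onmor G a)))"
proof -
  interpret FG: groupoid "fund_groupoid \<Lambda>" by (rule \<Lambda>.groupoid_fund_groupoid)
  have ob: "onob G x = x" if "x \<in> obj \<Lambda>" for x
    using i that by (auto simp: eq_map_def comp_map_def fund_incl_def fibre_functor_def)
  have shape: "\<exists>f. onmor G a = (rng (fund_groupoid \<Lambda>) a, f, src (fund_groupoid \<Lambda>) a) \<and>
      bij_betw f (fibre \<Omega> p (src (fund_groupoid \<Lambda>) a)) (fibre \<Omega> p (rng (fund_groupoid \<Lambda>) a))"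
    if a: "a \<in> mor (fund_groupoid \<Lambda>)" for a
  proof -
    have "src (fund_groupoid \<Lambda>) a \<in> obj \<Lambda>" "rng (fund_groupoid \<Lambda>) a \<in> obj \<Lambda>"
      using FG.src_closed[OF a] FG.rng_closed[OF a] by auto
    moreover have "onmor G a \<in> mor fibre_groupoid"
      "src fibre_groupoid (onmor G a) = onob G (src (fund_groupoid \<Lambda>) a)"
      "rng fibre_groupoid (onmor G a) = onob G (rng (fund_groupoid \<Lambda>) a)"
      using G a by (auto simp: is_functor_def)
    ultimately show ?thesis
      by (cases "onmor G a") (auto simp: fibre_groupoid_def ob)
  qed
  have mul: "onmor G (a \<cdot>\<^bsub>fund_groupoid \<Lambda>\<^esub> b) = onmor G a \<cdot>\<^bsub>fibre_groupoid\<^esub> onmor G b"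
    if "a \<in> mor (fund_groupoid \<Lambda>)" "b \<in> mor (fund_groupoid \<Lambda>)"
      "src (fund_groupoid \<Lambda>) a = rng (fund_groupoid \<Lambda>) b" for a b
    using G that by (auto simp: is_functor_def)
  have unit: "onmor G (idm (fund_groupoid \<Lambda>) x) = (x, restrict id (fibre \<Omega> p x), x)" if "x \<in> obj \<Lambda>" for x
    using G that ob by (auto simp: is_functor_def fibre_groupoid_def)
  have edge: "onmor G (onmor (fund_incl \<Lambda>) (onmor p \<omega>)) =
      (rng \<Lambda> (onmor p \<omega>), \<lambda>u\<in>fibre \<Omega> p (src \<Lambda> (onmor p \<omega>)). rng \<Omega> (lift (onmor p \<omega>) u), src \<Lambda> (onmor p \<omega>))"
    if "\<omega> \<in> mor \<Omega>" for \<omega>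
    using i p_mor[OF that] by (auto simp: eq_map_def comp_map_def fibre_functor_def)
  show ?thesis
    unfolding is_fund_action_def
  proof (intro conjI ballI impI)
    fix a assume "a \<in> mor (fund_groupoid \<Lambda>)"
    then show "bij_betw (fst (snd (onmor G a))) (fibre \<Omega> p (src (fund_groupoid \<Lambda>) a))
        (fibre \<Omega> p (rng (fund_groupoid \<Lambda>) a))"
      using shape by fastforce
  next
    fix a b u assume "a \<in> mor (fund_groupoid \<Lambda>)" "b \<in> mor (fund_groupoid \<Lambda>)"
      "src (fund_groupoid \<Lambda>) a = rng (fund_groupoid \<Lambda>) b" "u \<in> fibre \<Omega> p (src (fund_groupoid \<Lambda>) b)"
    then show "fst (snd (onmor G (a \<cdot>\<^bsub>fund_groupoid \<Lambda>\<^esub> b))) u =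
        fst (snd (onmor G a)) (fst (snd (onmor G b)) u)"
      using shape[of a] shape[of b] mul[of a b] by (auto simp: fibre_groupoid_def compose_def)
  next
    fix x u assume "x \<in> obj \<Lambda>" "u \<in> fibre \<Omega> p x"
    then show "fst (snd (onmor G (idm (fund_groupoid \<Lambda>) x))) u = u"
      by (simp only: unit) simp
  next
    fix \<omega> assume \<omega>: "\<omega> \<in> mor \<Omega>"
    then show "fst (snd (onmor G (onmor (fund_incl \<Lambda>) (onmor p \<omega>)))) (src \<Omega> \<omega>) = rng \<Omega> \<omega>"
      using lift_eqI[of \<omega> "onmor p \<omega>" "src \<Omega> \<omega>"]
      by (simp add: edge p_src fibre_def \<Omega>.src_closed)
  qed
qed

lemma fund_action_unique:
  assumes act: "is_fund_action \<Omega> p \<Lambda> act"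
    and G: "\<And>G'. is_functor (fund_groupoid \<Lambda>) fibre_groupoid G' \<Longrightarrow>
       eq_map \<Lambda> (comp_map G' (fund_incl \<Lambda>)) fibre_functor \<Longrightarrow> eq_map (fund_groupoid \<Lambda>) G' G"
    and a: "a \<in> mor (fund_groupoid \<Lambda>)" "u \<in> fibre \<Omega> p (src (fund_groupoid \<Lambda>) a)"
  shows "act a u = fst (snd (onmor G a)) u"
proof -
  interpret FG: groupoid "fund_groupoid \<Lambda>" by (rule \<Lambda>.groupoid_fund_groupoid)
  define G' :: "('o, 'o \<times> 'm step list set \<times> 'o, 'o, 'o \<times> ('u \<Rightarrow> 'u) \<times> 'o) cat_map" where
    "G' = \<lparr>onob = id, onmor = (\<lambda>a. (rng (fund_groupoid \<Lambda>) a,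
        restrict (act a) (fibre \<Omega> p (src (fund_groupoid \<Lambda>) a)), src (fund_groupoid \<Lambda>) a))\<rparr>"
  have bij: "bij_betw (act a) (fibre \<Omega> p (src (fund_groupoid \<Lambda>) a)) (fibre \<Omega> p (rng (fund_groupoid \<Lambda>) a))"
    if "a \<in> mor (fund_groupoid \<Lambda>)" for a
    using act that by (auto simp: is_fund_action_def)
  have mul: "act (a \<cdot>\<^bsub>fund_groupoid \<Lambda>\<^esub> b) u = act a (act b u)"
    if "a \<in> mor (fund_groupoid \<Lambda>)" "b \<in> mor (fund_groupoid \<Lambda>)"
      "src (fund_groupoid \<Lambda>) a = rng (fund_groupoid \<Lambda>) b" "u \<in> fibre \<Omega> p (src (fund_groupoid \<Lambda>) b)" for a b u
    using act that by (auto simp: is_fund_action_def)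
  have unit: "act (idm (fund_groupoid \<Lambda>) x) u = u" if "x \<in> obj \<Lambda>" "u \<in> fibre \<Omega> p x" for x u
    using act that by (auto simp: is_fund_action_def)
  have edge: "act (onmor (fund_incl \<Lambda>) \<alpha>) u = rng \<Omega> (lift \<alpha> u)"
    if "\<alpha> \<in> mor \<Lambda>" "u \<in> fibre \<Omega> p (src \<Lambda> \<alpha>)" for \<alpha> u
  proof -
    have "act (onmor (fund_incl \<Lambda>) (onmor p (lift \<alpha> u))) (src \<Omega> (lift \<alpha> u)) = rng \<Omega> (lift \<alpha> u)"
      using act lift(1)[OF that] unfolding is_fund_action_def by blast
    then show ?thesis by (simp add: lift[OF that])
  qed
  have "is_functor (fund_groupoid \<Lambda>) fibre_groupoid G'"
    unfolding is_functor_def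
  proof (intro conjI ballI impI)
    fix x assume "x \<in> obj (fund_groupoid \<Lambda>)"
    then show "onmor G' (idm (fund_groupoid \<Lambda>) x) = idm fibre_groupoid (onob G' x)"
      using FG.src_idm[of x] FG.rng_idm[of x] unit[of x]
      unfolding G'_def fibre_groupoid_def by (auto simp: fun_eq_iff simp del: \<Lambda>.fund_sel(4))
  next
    fix a assume a: "a \<in> mor (fund_groupoid \<Lambda>)"
    show "onmor G' a \<in> mor fibre_groupoid"
      using bij[OF a] FG.src_closed[OF a] FG.rng_closed[OF a]
      by (auto simp: G'_def fibre_groupoid_def cong: bij_betw_cong)
  next
    fix a b assume ab: "a \<in> mor (fund_groupoid \<Lambda>)" "b \<in> mor (fund_groupoid \<Lambda>)"
      "src (fund_groupoid \<Lambda>) a = rng (fund_groupoid \<Lambda>) b"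
    then show "onmor G' (a \<cdot>\<^bsub>fund_groupoid \<Lambda>\<^esub> b) = onmor G' a \<cdot>\<^bsub>fibre_groupoid\<^esub> onmor G' b"
      using mul[OF ab] bij_betwE[OF bij[OF ab(2)]]
      by (auto simp: G'_def fibre_groupoid_def FG.src_cmp FG.rng_cmp compose_def fun_eq_iff)
  qed (auto simp: G'_def fibre_groupoid_def)
  moreover have "eq_map \<Lambda> (comp_map G' (fund_incl \<Lambda>)) fibre_functor"
  proof -
    have "src (fund_groupoid \<Lambda>) (onmor (fund_incl \<Lambda>) \<alpha>) = src \<Lambda> \<alpha>"
      "rng (fund_groupoid \<Lambda>) (onmor (fund_incl \<Lambda>) \<alpha>) = rng \<Lambda> \<alpha>" for \<alpha>
      by (simp_all add: fund_incl_def)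
    then show ?thesis
      using edge by (auto simp: eq_map_def comp_map_def G'_def fibre_functor_def fun_eq_iff)
        (simp_all add: fund_incl_def)
  qed
  ultimately have "eq_map (fund_groupoid \<Lambda>) G' G" by (rule G)
  then have "onmor G a = onmor G' a" using a by (auto simp: eq_map_def)
  then show ?thesis using a by (simp add: G'_def)
qed

end

lemma fund_act:
  assumes "covering k \<Omega> p \<Lambda>"
  shows "is_fund_action \<Omega> p \<Lambda> (fund_act \<Omega> p \<Lambda>)"
proof -
  interpret covering_context k \<Omega> p \<Lambda> by unfold_locales fact
  obtain G where "is_functor (fund_groupoid \<Lambda>) fibre_groupoid G"
    "eq_map \<Lambda> (comp_map G (fund_incl \<Lambda>)) fibre_functor" using fund_act_ex by metis
  then show ?thesis
    unfolding fund_act_def using fund_action_of_functor someI by metis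
qed

lemma fund_act_unique:
  assumes "covering k \<Omega> p \<Lambda>" "is_fund_action \<Omega> p \<Lambda> act"
    "a \<in> mor (fund_groupoid \<Lambda>)" "u \<in> fibre \<Omega> p (src (fund_groupoid \<Lambda>) a)"
  shows "act a u = fund_act \<Omega> p \<Lambda> a u"
proof -
  interpret covering_context k \<Omega> p \<Lambda> by unfold_locales fact
  obtain G where "is_functor (fund_groupoid \<Lambda>) fibre_groupoid G"
      "eq_map \<Lambda> (comp_map G (fund_incl \<Lambda>)) fibre_functor"
    and G: "\<And>G'. is_functor (fund_groupoid \<Lambda>) fibre_groupoid G' \<Longrightarrow>
      eq_map \<Lambda> (comp_map G' (fund_incl \<Lambda>)) fibre_functor \<Longrightarrow> eq_map (fund_groupoid \<Lambda>) G' G"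
    using fund_act_ex by blast
  show ?thesis
    using fund_action_unique[OF assms(2) G assms(3,4)]
      fund_action_unique[OF fund_act[OF assms(1)] G assms(3,4)] by simp
qed

definition transport ::
  "('u, 'a, 'z) kcat_scheme \<Rightarrow> ('u \<Rightarrow> 'w) \<Rightarrow> ('a \<Rightarrow> 'b) \<Rightarrow> ('w, 'b) kcat" where
  "transport \<Sigma> f g = \<lparr>
     obj = f ` obj \<Sigma>,
     mor = g ` mor \<Sigma>,
     src = (\<lambda>m. f (src \<Sigma> (inv_into (mor \<Sigma>) g m))),
     rng = (\<lambda>m. f (rng \<Sigma> (inv_into (mor \<Sigma>) g m))),
     idm = (\<lambda>x. g (idm \<Sigma> (inv_into (obj \<Sigma>) f x))),
     cmp = (\<lambda>m n. g (inv_into (mor \<Sigma>) g m \<cdot>\<^bsub>\<Sigma>\<^esub> inv_into (mor \<Sigma>) g n)),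
     deg = (\<lambda>m. deg \<Sigma> (inv_into (mor \<Sigma>) g m))\<rparr>"

definition transport_inv ::
  "('u, 'a, 'z) kcat_scheme \<Rightarrow> ('u \<Rightarrow> 'w) \<Rightarrow> ('a \<Rightarrow> 'b) \<Rightarrow> ('w, 'b, 'u, 'a) cat_map" where
  "transport_inv \<Sigma> f g = \<lparr>onob = inv_into (obj \<Sigma>) f, onmor = inv_into (mor \<Sigma>) g\<rparr>"

locale transport_context = kgraph k \<Sigma> for k and \<Sigma> :: "('u, 'a, 'z) kcat_scheme" (structure) +
  fixes f :: "'u \<Rightarrow> 'w" and g :: "'a \<Rightarrow> 'b"
  assumes f: "inj_on f (obj \<Sigma>)" and g: "inj_on g (mor \<Sigma>)"
begin

abbreviation T :: "('w, 'b) kcat" where "T \<equiv> transport \<Sigma> f g"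

lemma T_sel:
  "obj T = f ` obj \<Sigma>" "mor T = g ` mor \<Sigma>"
  "\<alpha> \<in> mor \<Sigma> \<Longrightarrow> src T (g \<alpha>) = f (src \<Sigma> \<alpha>)"
  "\<alpha> \<in> mor \<Sigma> \<Longrightarrow> rng T (g \<alpha>) = f (rng \<Sigma> \<alpha>)"
  "x \<in> obj \<Sigma> \<Longrightarrow> idm T (f x) = g (idm \<Sigma> x)"
  "\<alpha> \<in> mor \<Sigma> \<Longrightarrow> \<beta> \<in> mor \<Sigma> \<Longrightarrow> g \<alpha> \<cdot>\<^bsub>T\<^esub> g \<beta> = g (\<alpha> \<cdot> \<beta>)"
  "\<alpha> \<in> mor \<Sigma> \<Longrightarrow> deg T (g \<alpha>) = deg \<Sigma> \<alpha>"
  using f g by (simp_all add: transport_def)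

lemma f_eq: "x \<in> obj \<Sigma> \<Longrightarrow> y \<in> obj \<Sigma> \<Longrightarrow> f x = f y \<longleftrightarrow> x = y"
  using f by (auto dest: inj_onD)

lemma g_eq: "\<alpha> \<in> mor \<Sigma> \<Longrightarrow> \<beta> \<in> mor \<Sigma> \<Longrightarrow> g \<alpha> = g \<beta> \<longleftrightarrow> \<alpha> = \<beta>"
  using g by (auto dest: inj_onD)

lemmas T_simps = T_sel f_eq src_closed rng_closed idm_closed src_idm rng_idm cmp_closed src_cmp rng_cmp
  idm_left idm_right deg_closed deg_idm deg_cmp

lemma kgraph_T: "kgraph k T"
proof (unfold_locales, goal_cases)
  case (9 \<alpha> \<beta> \<gamma>)
  then obtain a b c where abc: "\<alpha> = g a" "\<beta> = g b" "\<gamma> = g c" "a \<in> mor \<Sigma>" "b \<in> mor \<Sigma>" "c \<in> mor \<Sigma>"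
    by (auto simp: T_sel)
  have "src \<Sigma> a = rng \<Sigma> b"
    using 9(4) abc T_sel(3)[of a] T_sel(4)[of b] f_eq[of "src \<Sigma> a" "rng \<Sigma> b"] src_closed[of a] rng_closed[of b]
    by metis
  moreover have "src \<Sigma> b = rng \<Sigma> c"
    using 9(5) abc T_sel(3)[of b] T_sel(4)[of c] f_eq[of "src \<Sigma> b" "rng \<Sigma> c"] src_closed[of b] rng_closed[of c]
    by metis
  ultimately show ?case
    using abc cmp_assoc[of a b c] cmp_closed[of a b] cmp_closed[of b c] rng_cmp[of b c] src_cmp[of a b]
    by (simp only: T_sel(6))
next
  case (15 \<alpha> n l)
  then obtain \<alpha>' where \<alpha>': "\<alpha> = g \<alpha>'" "\<alpha>' \<in> mor \<Sigma>" by (auto simp: T_simps)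
  then have "deg \<Sigma> \<alpha>' = n + l" using 15 by (simp add: T_simps)
  from factorization[OF \<alpha>'(2) 15(2,3) this] obtain h0 where
    h0: "case h0 of (\<beta>, \<gamma>) \<Rightarrow> \<beta> \<in> mor \<Sigma> \<and> \<gamma> \<in> mor \<Sigma> \<and> src \<Sigma> \<beta> = rng \<Sigma> \<gamma>
               \<and> deg \<Sigma> \<beta> = n \<and> deg \<Sigma> \<gamma> = l \<and> \<alpha>' = \<beta> \<cdot> \<gamma>"
    and u0: "\<And>h. (case h of (\<beta>, \<gamma>) \<Rightarrow> \<beta> \<in> mor \<Sigma> \<and> \<gamma> \<in> mor \<Sigma> \<and> src \<Sigma> \<beta> = rng \<Sigma> \<gamma>
               \<and> deg \<Sigma> \<beta> = n \<and> deg \<Sigma> \<gamma> = l \<and> \<alpha>' = \<beta> \<cdot> \<gamma>) \<Longrightarrow> h = h0"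
    by (elim ex1E) blast
  obtain \<beta> \<gamma> where h0_eq: "h0 = (\<beta>, \<gamma>)" by (cases h0)
  have bc: "\<beta> \<in> mor \<Sigma>" "\<gamma> \<in> mor \<Sigma>" "src \<Sigma> \<beta> = rng \<Sigma> \<gamma>" "deg \<Sigma> \<beta> = n" "deg \<Sigma> \<gamma> = l" "\<alpha>' = \<beta> \<cdot> \<gamma>"
    using h0 by (auto simp: h0_eq)
  have u: "\<beta>' = \<beta> \<and> \<gamma>' = \<gamma>" if "\<beta>' \<in> mor \<Sigma>" "\<gamma>' \<in> mor \<Sigma>" "src \<Sigma> \<beta>' = rng \<Sigma> \<gamma>'" "deg \<Sigma> \<beta>' = n"
      "deg \<Sigma> \<gamma>' = l" "\<alpha>' = \<beta>' \<cdot> \<gamma>'" for \<beta>' \<gamma>'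
    using u0[of "(\<beta>', \<gamma>')"] that by (simp add: h0_eq)
  show ?case
  proof (rule ex1I[of _ "(g \<beta>, g \<gamma>)"])
    show "case (g \<beta>, g \<gamma>) of (\<beta>, \<gamma>) \<Rightarrow> \<beta> \<in> mor T \<and> \<gamma> \<in> mor T \<and> src T \<beta> = rng T \<gamma>
        \<and> deg T \<beta> = n \<and> deg T \<gamma> = l \<and> \<alpha> = \<beta> \<cdot>\<^bsub>T\<^esub> \<gamma>"
      using bc \<alpha>' by (simp add: T_simps)
  next
    fix h assume h: "case h of (\<beta>, \<gamma>) \<Rightarrow> \<beta> \<in> mor T \<and> \<gamma> \<in> mor T \<and> src T \<beta> = rng T \<gamma>
        \<and> deg T \<beta> = n \<and> deg T \<gamma> = l \<and> \<alpha> = \<beta> \<cdot>\<^bsub>T\<^esub> \<gamma>"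
    then obtain b c where bc': "h = (g b, g c)" "b \<in> mor \<Sigma>" "c \<in> mor \<Sigma>"
      by (cases h) (auto simp: T_sel)
    then have "src \<Sigma> b = rng \<Sigma> c" using h by (simp add: T_simps)
    moreover from this have "\<alpha>' = b \<cdot> c" "deg \<Sigma> b = n" "deg \<Sigma> c = l"
      using h bc' \<alpha>' by (simp_all add: T_simps g_eq)
    ultimately show "h = (g \<beta>, g \<gamma>)" using u[of b c] bc' by simp
  qed
qed (auto simp: T_simps)

lemma transport_inv_morphism: "kgraph_morphism T \<Sigma> (transport_inv \<Sigma> f g)"
  using f g
  by (auto simp: kgraph_morphism_def is_functor_def transport_inv_def T_simps)

lemma connected_T:
  assumes "connected_cat \<Sigma>"
  shows "connected_cat T"
proof -
  have "equivclp (\<lambda>x y. \<exists>\<alpha>\<in>mor T. rng T \<alpha> = x \<and> src T \<alpha> = y) (f u) (f v)"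
    if "equivclp (\<lambda>x y. \<exists>\<alpha>\<in>mor \<Sigma>. rng \<Sigma> \<alpha> = x \<and> src \<Sigma> \<alpha> = y) u v" for u v
    using that
  proof (induction rule: equivclp_induct)
    case (step y z)
    then have "(\<exists>\<alpha>\<in>mor T. rng T \<alpha> = f y \<and> src T \<alpha> = f z) \<or> (\<exists>\<alpha>\<in>mor T. rng T \<alpha> = f z \<and> src T \<alpha> = f y)"
      by (auto simp: T_sel)
    with step.IH show ?case by (rule equivclp_into_equivclp)
  qed auto
  then show ?thesis using assms by (auto simp: connected_cat_def T_sel)
qed

lemma covering_T:
  assumes q: "covering k \<Sigma> q \<Lambda>"
  shows "covering k T (comp_map q (transport_inv \<Sigma> f g)) \<Lambda>"
proof -
  interpret q: covering_context k \<Sigma> q \<Lambda> by unfold_locales fact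
  have surj: "onmor q ` mor \<Sigma> = mor \<Lambda>" using q by (simp add: covering_def)
  have fib:
    "bij_betw (onmor q) {\<omega> \<in> mor \<Sigma>. src \<Sigma> \<omega> = v} {\<alpha> \<in> mor \<Lambda>. src \<Lambda> \<alpha> = onob q v}"
    "bij_betw (onmor q) {\<omega> \<in> mor \<Sigma>. rng \<Sigma> \<omega> = v} {\<alpha> \<in> mor \<Lambda>. rng \<Lambda> \<alpha> = onob q v}"
    if "v \<in> obj \<Sigma>" for v using q that by (auto simp: covering_def)
  have m: "kgraph_morphism T \<Lambda> (comp_map q (transport_inv \<Sigma> f g))"
    using transport_inv_morphism q is_functor_comp[of T \<Sigma> "transport_inv \<Sigma> f g" \<Lambda> q]
    by (auto simp: kgraph_morphism_def covering_def is_functor_def comp_map_def)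
  have inv: "bij_betw (inv_into (mor \<Sigma>) g) {\<omega> \<in> mor T. src T \<omega> = f v} {\<omega> \<in> mor \<Sigma>. src \<Sigma> \<omega> = v}"
    "bij_betw (inv_into (mor \<Sigma>) g) {\<omega> \<in> mor T. rng T \<omega> = f v} {\<omega> \<in> mor \<Sigma>. rng \<Sigma> \<omega> = v}"
    if "v \<in> obj \<Sigma>" for v
    using that g by (auto intro!: bij_betw_byWitness[of _ g] simp: T_simps)
  have "onmor (comp_map q (transport_inv \<Sigma> f g)) ` mor T = mor \<Lambda>"
    using g by (simp add: comp_map_def transport_inv_def T_sel image_image surj cong: image_cong_simp)
  moreover have
    "bij_betw (onmor (comp_map q (transport_inv \<Sigma> f g))) {\<omega> \<in> mor T. src T \<omega> = v}
       {\<alpha> \<in> mor \<Lambda>. src \<Lambda> \<alpha> = onob (comp_map q (transport_inv \<Sigma> f g)) v} \<and>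
     bij_betw (onmor (comp_map q (transport_inv \<Sigma> f g))) {\<omega> \<in> mor T. rng T \<omega> = v}
       {\<alpha> \<in> mor \<Lambda>. rng \<Lambda> \<alpha> = onob (comp_map q (transport_inv \<Sigma> f g)) v}" if v: "v \<in> obj T" for v
  proof -
    obtain u where u: "u \<in> obj \<Sigma>" "v = f u" using v by (auto simp: T_sel)
    show ?thesis
      using bij_betw_trans[OF inv(1) fib(1)] bij_betw_trans[OF inv(2) fib(2)] u f
      by (simp add: comp_map_def transport_inv_def)
  qed
  ultimately show ?thesis
    using q kgraph_T m by (auto simp: covering_def)
qed

end

context covering_context begin

definition base_walk :: "'u \<Rightarrow> 'u \<Rightarrow> 'a step list" where
  "base_walk b u = (SOME w. walk \<Omega> b w u)"

lemma base_walk: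
  assumes "connected_cat \<Omega>" "b \<in> obj \<Omega>" "u \<in> obj \<Omega>"
  shows "walk \<Omega> b (base_walk b u) u"
proof -
  have "equivclp (\<lambda>x y. \<exists>\<alpha>\<in>mor \<Omega>. rng \<Omega> \<alpha> = x \<and> src \<Omega> \<alpha> = y) b u"
    using assms by (auto simp: connected_cat_def)
  then have "\<exists>w. walk \<Omega> b w u"
  proof (induction rule: equivclp_induct)
    case base
    then show ?case using assms by (intro exI[of _ "[]"]) auto
  next
    case (step y z)
    then obtain w where w: "walk \<Omega> b w y" by blast
    from step.hyps(2) have "\<exists>a. walk \<Omega> y [a] z"
    proof
      assume "\<exists>\<alpha>\<in>mor \<Omega>. rng \<Omega> \<alpha> = y \<and> src \<Omega> \<alpha> = z"
      then obtain \<alpha> where "\<alpha> \<in> mor \<Omega>" "rng \<Omega> \<alpha> = y" "src \<Omega> \<alpha> = z" by blast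
      then have "walk \<Omega> y [Fwd \<alpha>] z" by (auto simp: \<Omega>.src_closed)
      then show ?thesis ..
    next
      assume "\<exists>\<alpha>\<in>mor \<Omega>. rng \<Omega> \<alpha> = z \<and> src \<Omega> \<alpha> = y"
      then obtain \<alpha> where "\<alpha> \<in> mor \<Omega>" "rng \<Omega> \<alpha> = z" "src \<Omega> \<alpha> = y" by blast
      then have "walk \<Omega> y [Bwd \<alpha>] z" by (auto simp: \<Omega>.rng_closed)
      then show ?thesis ..
    qed
    then show ?case using \<Omega>.walk_append[OF w] by blast
  qed
  then show ?thesis unfolding base_walk_def by (rule someI_ex)
qed

lemma walk_lift_unique:
  "walk \<Omega> x w y \<Longrightarrow> walk \<Omega> x w' y' \<Longrightarrow> map (map_step (onmor p)) w = map (map_step (onmor p)) w' \<Longrightarrow> y = y'"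
proof (induction w arbitrary: x w')
  case Nil
  then show ?case by auto
next
  case (Cons a w)
  from Cons.prems(3) obtain a' v where w': "w' = a' # v" by (cases w') auto
  show ?case
  proof (cases a)
    case (Fwd \<alpha>)
    then obtain \<alpha>' where a': "a' = Fwd \<alpha>'" using Cons.prems(3) w' by (cases a') auto
    have "\<alpha> = \<alpha>'" using Cons.prems Fwd a' w' by (intro lift_rng_unique) auto
    then show ?thesis using Cons Fwd a' w' by auto
  next
    case (Bwd \<alpha>)
    then obtain \<alpha>' where a': "a' = Bwd \<alpha>'" using Cons.prems(3) w' by (cases a') auto
    have "\<alpha> = \<alpha>'" using Cons.prems Bwd a' w' by (intro lift_src_unique) auto
    then show ?thesis using Cons Bwd a' w' by auto
  qed
qed

lemma small_codes:
  assumes "connected_cat \<Omega>"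
  obtains f :: "'u \<Rightarrow> 'm step list" and g :: "'a \<Rightarrow> 'm step list \<times> 'm"
  where "inj_on f (obj \<Omega>)" "inj_on g (mor \<Omega>)"
proof -
  define b where "b = (SOME b. b \<in> obj \<Omega>)"
  define f where "f u = map (map_step (onmor p)) (base_walk b u)" for u
  define g where "g \<omega> = (f (src \<Omega> \<omega>), onmor p \<omega>)" for \<omega>
  have b: "b \<in> obj \<Omega>" if "u \<in> obj \<Omega>" for u unfolding b_def using that by (rule someI)
  have f: "inj_on f (obj \<Omega>)"
  proof (rule inj_onI)
    fix u u' assume "u \<in> obj \<Omega>" "u' \<in> obj \<Omega>" "f u = f u'"
    then show "u = u'"
      using walk_lift_unique base_walk[OF assms b] unfolding f_def by metis
  qed
  then have "inj_on g (mor \<Omega>)"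
    using lift_src_unique \<Omega>.src_closed unfolding g_def inj_on_def by blast
  with f that show thesis by blast
qed

end

lemma universal_coveringD:
  fixes \<Omega> :: "('u, 'a, 'z) kcat_scheme" and \<Lambda> :: "('o, 'm, 'y) kcat_scheme"
    and \<Sigma> :: "('w, 'b, 'x) kcat_scheme"
  assumes U: "universal_covering k \<Omega> p \<Lambda>" and \<Sigma>: "connected_covering k \<Sigma> q \<Lambda>"
  shows "\<exists>\<phi>. covering_morphism \<Omega> p \<Sigma> q \<phi>"
proof -
  interpret covering_context k \<Sigma> q \<Lambda>
    using \<Sigma> by unfold_locales (simp add: connected_covering_def)
  obtain f :: "'w \<Rightarrow> 'm step list" and g :: "'b \<Rightarrow> 'm step list \<times> 'm"
    where fg: "inj_on f (obj \<Sigma>)" "inj_on g (mor \<Sigma>)"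
    using small_codes \<Sigma> by (auto simp: connected_covering_def)
  interpret transport_context k \<Sigma> f g by unfold_locales (fact fg)+
  have "connected_covering k T (comp_map q (transport_inv \<Sigma> f g)) \<Lambda>"
    using \<Sigma> covering_T connected_T by (auto simp: connected_covering_def)
  then obtain \<phi> where "covering_morphism \<Omega> p T (comp_map q (transport_inv \<Sigma> f g)) \<phi>"
    using U unfolding universal_covering_def by blast
  then have "covering_morphism \<Omega> p \<Sigma> q (comp_map (transport_inv \<Sigma> f g) \<phi>)"
    using transport_inv_morphism is_functor_comp[of \<Omega> T \<phi> \<Sigma> "transport_inv \<Sigma> f g"]
    unfolding covering_morphism_def kgraph_morphism_def
    by (auto simp: is_functor_def eq_map_def comp_map_def)
  then show ?thesis by blast
qed

lemma orbit_graph_structure: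
  assumes src: "\<And>\<omega> c. \<lbrakk>\<omega> \<in> mor \<Omega>; c \<in> H\<rbrakk> \<Longrightarrow> src \<Omega> (act1 \<omega> c) = act0 (src \<Omega> \<omega>) c"
    and rng: "\<And>\<omega> c. \<lbrakk>\<omega> \<in> mor \<Omega>; c \<in> H\<rbrakk> \<Longrightarrow> rng \<Omega> (act1 \<omega> c) = act0 (rng \<Omega> \<omega>) c"
    and idm: "\<And>u c. \<lbrakk>u \<in> obj \<Omega>; c \<in> H\<rbrakk> \<Longrightarrow> idm \<Omega> (act0 u c) = act1 (idm \<Omega> u) c"
    and cmp: "\<And>\<omega> \<mu> c. \<lbrakk>\<omega> \<in> mor \<Omega>; \<mu> \<in> mor \<Omega>; src \<Omega> \<omega> = rng \<Omega> \<mu>; c \<in> H\<rbrakk> \<Longrightarrow>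
                act1 (\<omega> \<cdot>\<^bsub>\<Omega>\<^esub> \<mu>) c = act1 \<omega> c \<cdot>\<^bsub>\<Omega>\<^esub> act1 \<mu> c"
    and deg: "\<And>\<omega> c. \<lbrakk>\<omega> \<in> mor \<Omega>; c \<in> H\<rbrakk> \<Longrightarrow> deg \<Omega> (act1 \<omega> c) = deg \<Omega> \<omega>"
    and free: "\<And>u. u \<in> obj \<Omega> \<Longrightarrow> inj_on (act0 u) H"
    and "category \<Omega>" and "H \<noteq> {}"
  shows "\<omega> \<in> mor \<Omega> \<Longrightarrow> src (orbit_graph \<Omega> act0 act1 H) (orbit act1 H \<omega>) = orbit act0 H (src \<Omega> \<omega>)"
    and "\<omega> \<in> mor \<Omega> \<Longrightarrow> rng (orbit_graph \<Omega> act0 act1 H) (orbit act1 H \<omega>) = orbit act0 H (rng \<Omega> \<omega>)"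
    and "u \<in> obj \<Omega> \<Longrightarrow> idm (orbit_graph \<Omega> act0 act1 H) (orbit act0 H u) = orbit act1 H (idm \<Omega> u)"
    and "\<lbrakk>\<omega> \<in> mor \<Omega>; \<mu> \<in> mor \<Omega>; src \<Omega> \<omega> = rng \<Omega> \<mu>\<rbrakk> \<Longrightarrow>
           orbit act1 H \<omega> \<cdot>\<^bsub>orbit_graph \<Omega> act0 act1 H\<^esub> orbit act1 H \<mu> = orbit act1 H (\<omega> \<cdot>\<^bsub>\<Omega>\<^esub> \<mu>)"
    and "\<omega> \<in> mor \<Omega> \<Longrightarrow> deg (orbit_graph \<Omega> act0 act1 H) (orbit act1 H \<omega>) = deg \<Omega> \<omega>"
proof -
  interpret category \<Omega> by fact
  show "\<omega> \<in> mor \<Omega> \<Longrightarrow> src (orbit_graph \<Omega> act0 act1 H) (orbit act1 H \<omega>) = orbit act0 H (src \<Omega> \<omega>)"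
    "\<omega> \<in> mor \<Omega> \<Longrightarrow> rng (orbit_graph \<Omega> act0 act1 H) (orbit act1 H \<omega>) = orbit act0 H (rng \<Omega> \<omega>)"
    "u \<in> obj \<Omega> \<Longrightarrow> idm (orbit_graph \<Omega> act0 act1 H) (orbit act0 H u) = orbit act1 H (idm \<Omega> u)"
    by (simp_all add: orbit_graph_def orbit_def image_image src rng idm cong: image_cong_simp)
  show "deg (orbit_graph \<Omega> act0 act1 H) (orbit act1 H \<omega>) = deg \<Omega> \<omega>" if "\<omega> \<in> mor \<Omega>"
  proof -
    have "deg \<Omega> ` act1 \<omega> ` H = {deg \<Omega> \<omega>}" using \<open>H \<noteq> {}\<close> deg[OF that]
      by (simp add: image_image image_constant_conv cong: image_cong_simp)
    then show ?thesis by (simp add: orbit_graph_def orbit_def)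
  qed
  show "orbit act1 H \<omega> \<cdot>\<^bsub>orbit_graph \<Omega> act0 act1 H\<^esub> orbit act1 H \<mu> = orbit act1 H (\<omega> \<cdot>\<^bsub>\<Omega>\<^esub> \<mu>)"
    if m: "\<omega> \<in> mor \<Omega>" "\<mu> \<in> mor \<Omega>" "src \<Omega> \<omega> = rng \<Omega> \<mu>"
  proof -
    have "c = c'" if "c \<in> H" "c' \<in> H" "act0 (rng \<Omega> \<mu>) c = act0 (rng \<Omega> \<mu>) c'" for c c'
      using free[OF rng_closed[OF m(2)]] that by (auto dest: inj_onD)
    then have "(src \<Omega> (act1 \<omega> c) = rng \<Omega> (act1 \<mu> c')) \<longleftrightarrow> c = c'" if "c \<in> H" "c' \<in> H" for c c'
      using that m src rng by metis
    then have "{a \<cdot>\<^bsub>\<Omega>\<^esub> b |a b. a \<in> act1 \<omega> ` H \<and> b \<in> act1 \<mu> ` H \<and> src \<Omega> a = rng \<Omega> b} =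
        {act1 \<omega> c \<cdot>\<^bsub>\<Omega>\<^esub> act1 \<mu> c |c. c \<in> H}"
      by blast
    also have "\<dots> = act1 (\<omega> \<cdot>\<^bsub>\<Omega>\<^esub> \<mu>) ` H" using cmp[OF m] by (auto simp: image_def)
    finally show ?thesis by (simp add: orbit_graph_def orbit_def)
  qed
qed

end

theory Submission
  imports Defs
begin

text \<open>For every covering, \<open>q\<^sub>*\<pi>(\<Sigma>, s)\<close> is the stabilizer of \<open>s\<close> under the action of
  \<open>\<pi>(\<Lambda>, q(s))\<close>, because walks lift uniquely; and covering morphisms are equivariant for the action of
  \<open>\<G>(\<Lambda>)\<close>.  The elements of \<open>\<G>(\<Lambda>)x\<close> are the objects of a connected covering on which
  \<open>\<G>(\<Lambda>)\<close> acts by left multiplication; a universal covering maps to it, so \<open>a \<mapsto> a v\<close> is a bijection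
  from \<open>\<G>(\<Lambda>)x\<close> to \<open>\<Omega>\<^sup>0\<close>.  Hence the right action is well defined and free, and an element
  \<open>c\<close> of \<open>\<pi>(\<Lambda>, x)\<close> fixes \<open>vH\<close> exactly if \<open>c v \<in> vH\<close>, that is, \<open>c \<in> H\<close>.  Finally, a morphism \<open>\<phi>\<close> from
  \<open>\<Omega>\<close> to a connected covering \<open>\<Sigma>\<close> factors through an isomorphism from \<open>\<Omega>/K\<close>, where \<open>K\<close> is the
  stabilizer of \<open>\<phi>(v)\<close>.\<close>

section \<open>Walks and the action of the fundamental groupoid\<close>

lemma walk_map:
  assumes "is_functor C D F"
  shows "walk C x w y \<Longrightarrow> walk D (onob F x) (map (map_step (onmor F)) w) (onob F y)"
proof (induction w arbitrary: x)
  case Nil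
  then show ?case using assms by (auto simp: is_functor_def)
next
  case (Cons a w)
  then show ?case using assms by (cases a) (auto simp: is_functor_def)
qed

context category begin

lemma walk_class_Cons:
  assumes "walk C x [a] y" "walk C y w z"
  shows "walk_class C x (a # w) z = walk_class C x [a] y \<cdot>\<^bsub>fund_groupoid C\<^esub> walk_class C y w z"
  using fund_cmp[OF assms] by simp

lemma walk_class_Bwd_Fwd:
  assumes "\<alpha> \<in> mor C"
  shows "walk_class C (src C \<alpha>) [Bwd \<alpha>] (rng C \<alpha>) \<cdot>\<^bsub>fund_groupoid C\<^esub> walk_class C (rng C \<alpha>) [Fwd \<alpha>] (src C \<alpha>)
    = walk_class C (src C \<alpha>) [] (src C \<alpha>)"
  using assms
  by (subst fund_cmp) (auto simp: src_closed rng_closed walk_class_eq_iff intro: walk_eq.inv_left)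

lemma fund_incl_sel [simp]:
  "onob (fund_incl C) x = x"
  "onmor (fund_incl C) \<alpha> = walk_class C (rng C \<alpha>) [Fwd \<alpha>] (src C \<alpha>)"
  by (simp_all add: fund_incl_def)

lemma carrier_fund_group:
  "carrier (fund_group C x) = {walk_class C x w x |w. walk C x w x}"
  by (auto simp: fund_group_def elim!: fund_morE intro: fund_morI)

end

text \<open>\<open>fund_map\<close> is picked by a choice operator, so only its defining property is
  at hand. Uniqueness of the extension of \<open>i \<circ> F\<close> identifies it with the
  evaluation \<open>weval\<close> of words, and in the fundamental groupoid that evaluation just
  maps a word letter by letter.\<close>

lemma fund_map_walk_class:
  assumes C: "category C" and D: "category D" and func: "is_functor C D F" and w: "walk C x w y"
  shows "onmor (fund_map C D F) (walk_class C x w y) =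
    walk_class D (onob F x) (map (map_step (onmor F)) w) (onob F y)"
proof -
  interpret C: category C by fact
  interpret D: category D by fact
  interpret G: groupoid "fund_groupoid D" by (rule D.groupoid_fund_groupoid)
  let ?F = "comp_map (fund_incl D) F"
  interpret functor_to_groupoid C "fund_groupoid D" ?F
    by unfold_locales (rule is_functor_comp[OF func D.fund_incl_functor])
  have F_sel: "onob F x \<in> obj D" "onmor F \<alpha> \<in> mor D"
    "src D (onmor F \<alpha>) = onob F (src C \<alpha>)" "rng D (onmor F \<alpha>) = onob F (rng C \<alpha>)"
    if "x \<in> obj C" "\<alpha> \<in> mor C" for x \<alpha>
    using func that by (auto simp: is_functor_def)
  \<comment> \<open>A backward letter evaluates to the chosen inverse \<open>ginv\<close>. Inverses
    in a groupoid are unique, so it suffices that the class of the backward letter is a left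
    inverse.\<close>
  have ginv: "G.ginv (walk_class D (rng D \<alpha>) [Fwd \<alpha>] (src D \<alpha>)) = walk_class D (src D \<alpha>) [Bwd \<alpha>] (rng D \<alpha>)"
    if "\<alpha> \<in> mor D" for \<alpha>
    using that D.walk_class_Bwd_Fwd[OF that]
    by (intro G.ginv_unique[symmetric]) (auto intro!: D.fund_morI simp: D.src_closed D.rng_closed)
  have "G.weval ?F w y = walk_class D (onob F x) (map (map_step (onmor F)) w) (onob F y)"
    using w
  proof (induction w arbitrary: x)
    case Nil
    then show ?case by (auto simp: comp_map_def)
  next
    case (Cons a w)
    show ?case
    proof (cases a)
      case (Fwd \<alpha>)
      with Cons have \<alpha>: "\<alpha> \<in> mor C" "rng C \<alpha> = x" "walk C (src C \<alpha>) w y" by auto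
      show ?thesis
        using Cons.IH[OF \<alpha>(3)] \<alpha> walk_map[OF func \<alpha>(3)] Fwd F_sel[OF C.src_closed] C.walk_ends[OF \<alpha>(3)]
        by (simp add: comp_map_def D.fund_cmp C.src_closed)
    next
      case (Bwd \<alpha>)
      with Cons have \<alpha>: "\<alpha> \<in> mor C" "src C \<alpha> = x" "walk C (rng C \<alpha>) w y" by auto
      show ?thesis
        using Cons.IH[OF \<alpha>(3)] \<alpha> walk_map[OF func \<alpha>(3)] Bwd F_sel[OF C.rng_closed] ginv[of "onmor F \<alpha>"]
        by (simp add: comp_map_def D.fund_cmp C.src_closed)
    qed
  qed
  then show ?thesis
    using extension_unique[OF fund_map(1,2)[OF C D func]] C.fund_morI[OF w] extension_class[OF w]
    by (simp add: eq_map_def)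
qed

section \<open>The groupoid action computed by lifting walks\<close>

context covering_context begin

abbreviation "\<G> \<equiv> fund_groupoid \<Lambda>"
abbreviation "act \<equiv> fund_act \<Omega> p \<Lambda>"

sublocale \<G>: groupoid \<G> by (rule \<Lambda>.groupoid_fund_groupoid)

lemma act_bij: "a \<in> mor \<G> \<Longrightarrow> bij_betw (act a) (fibre \<Omega> p (src \<G> a)) (fibre \<Omega> p (rng \<G> a))"
  and act_cmp: "\<lbrakk>a \<in> mor \<G>; b \<in> mor \<G>; src \<G> a = rng \<G> b; u \<in> fibre \<Omega> p (src \<G> b)\<rbrakk> \<Longrightarrow>
    act (a \<cdot>\<^bsub>\<G>\<^esub> b) u = act a (act b u)"
  and act_idm: "u \<in> obj \<Omega> \<Longrightarrow> act (walk_class \<Lambda> (onob p u) [] (onob p u)) u = u"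
  and act_edge: "\<omega> \<in> mor \<Omega> \<Longrightarrow>
    act (walk_class \<Lambda> (onob p (rng \<Omega> \<omega>)) [Fwd (onmor p \<omega>)] (onob p (src \<Omega> \<omega>))) (src \<Omega> \<omega>) = rng \<Omega> \<omega>"
  using fund_act[OF cov] p_ob by (auto simp: is_fund_action_def p_src p_rng fibre_def)

lemma act_closed: "\<lbrakk>a \<in> mor \<G>; u \<in> obj \<Omega>; src \<G> a = onob p u\<rbrakk> \<Longrightarrow> act a u \<in> obj \<Omega>"
  and p_act: "\<lbrakk>a \<in> mor \<G>; u \<in> obj \<Omega>; src \<G> a = onob p u\<rbrakk> \<Longrightarrow> onob p (act a u) = rng \<G> a"
  using act_bij[of a] by (auto simp: fibre_def dest!: bij_betwE)

text \<open>The groupoid element of the leftmost letter acts last. By induction the rest of the word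
  has brought \<open>y\<close> to the source end of that letter, which then carries it on to
  \<open>x\<close>.\<close>

lemma act_walk:
  "walk \<Omega> x w y \<Longrightarrow> act (walk_class \<Lambda> (onob p x) (map (map_step (onmor p)) w) (onob p y)) y = x"
proof (induction w arbitrary: x)
  case Nil
  then show ?case by (auto simp: act_idm)
next
  case (Cons a w)
  show ?case
  proof (cases a)
    case (Fwd \<alpha>)
    with Cons have \<alpha>: "\<alpha> \<in> mor \<Omega>" "rng \<Omega> \<alpha> = x" "walk \<Omega> (src \<Omega> \<alpha>) w y" by auto
    note w = walk_map[OF p_functor \<alpha>(3)]
    have f: "walk \<Lambda> (onob p x) [Fwd (onmor p \<alpha>)] (onob p (src \<Omega> \<alpha>))"
      using \<alpha> by (auto simp: p_mor p_rng p_src p_ob \<Omega>.src_closed)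
    have "act (walk_class \<Lambda> (onob p x) (Fwd (onmor p \<alpha>) # map (map_step (onmor p)) w) (onob p y)) y =
      act (walk_class \<Lambda> (onob p x) [Fwd (onmor p \<alpha>)] (onob p (src \<Omega> \<alpha>))) (src \<Omega> \<alpha>)"
      unfolding \<Lambda>.walk_class_Cons[OF f w]
      using \<Omega>.walk_ends[OF \<alpha>(3)]
      by (subst act_cmp) (simp_all add: Cons.IH[OF \<alpha>(3)] \<Lambda>.fund_morI[OF w] \<Lambda>.fund_morI[OF f] fibre_def)
    then show ?thesis using act_edge[OF \<alpha>(1)] \<alpha>(2) Fwd by simp
  next
    case (Bwd \<alpha>)
    with Cons have \<alpha>: "\<alpha> \<in> mor \<Omega>" "src \<Omega> \<alpha> = x" "walk \<Omega> (rng \<Omega> \<alpha>) w y" by auto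
    note w = walk_map[OF p_functor \<alpha>(3)]
    have b: "walk \<Lambda> (onob p x) [Bwd (onmor p \<alpha>)] (onob p (rng \<Omega> \<alpha>))"
      and f: "walk \<Lambda> (onob p (rng \<Omega> \<alpha>)) [Fwd (onmor p \<alpha>)] (onob p x)"
      using \<alpha> by (auto simp: p_mor p_rng p_src p_ob \<Omega>.src_closed \<Omega>.rng_closed)
    have x: "x \<in> obj \<Omega>" using \<alpha> \<Omega>.src_closed by blast
    have "act (walk_class \<Lambda> (onob p x) (Bwd (onmor p \<alpha>) # map (map_step (onmor p)) w) (onob p y)) y =
      act (walk_class \<Lambda> (onob p x) [Bwd (onmor p \<alpha>)] (onob p (rng \<Omega> \<alpha>))) (rng \<Omega> \<alpha>)"
      unfolding \<Lambda>.walk_class_Cons[OF b w]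
      using \<Omega>.walk_ends[OF \<alpha>(3)]
      by (subst act_cmp) (simp_all add: Cons.IH[OF \<alpha>(3)] \<Lambda>.fund_morI[OF w] \<Lambda>.fund_morI[OF b] fibre_def)
    \<comment> \<open>The action is prescribed on forward edges only. The vertex reached so far is
      therefore written as the image of \<open>x\<close> under the forward edge, which the backward
      edge cancels.\<close>
    also have "\<dots> = act (walk_class \<Lambda> (onob p x) [Bwd (onmor p \<alpha>)] (onob p (rng \<Omega> \<alpha>)))
        (act (walk_class \<Lambda> (onob p (rng \<Omega> \<alpha>)) [Fwd (onmor p \<alpha>)] (onob p x)) x)"
      using act_edge[OF \<alpha>(1)] \<alpha>(2) by simp
    also have "\<dots> = act (walk_class \<Lambda> (onob p x) [] (onob p x)) x"
      using x \<Lambda>.walk_class_Bwd_Fwd[OF p_mor[OF \<alpha>(1)]] \<alpha>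
      by (subst act_cmp[symmetric])
        (simp_all add: \<Lambda>.fund_morI[OF b] \<Lambda>.fund_morI[OF f] fibre_def p_src p_rng)
    finally show ?thesis using Bwd x by (simp add: act_idm)
  qed
qed

text \<open>The lift is built from the source end \<open>y\<close> towards the left. A forward
  letter is lifted with prescribed source, a backward letter with prescribed range, so both
  bijections in the definition of a covering are used.\<close>

lemma lift_walk:
  assumes "y \<in> obj \<Omega>"
  shows "walk \<Lambda> z w (onob p y) \<Longrightarrow>
    \<exists>x w'. walk \<Omega> x w' y \<and> map (map_step (onmor p)) w' = w \<and> onob p x = z"
proof (induction w arbitrary: z)
  case Nil
  then show ?case using assms by (intro exI[of _ y] exI[of _ "[]"]) auto
next
  case (Cons a w)
  show ?case
  proof (cases a)
    case (Fwd \<alpha>)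
    with Cons.prems have \<alpha>: "\<alpha> \<in> mor \<Lambda>" "rng \<Lambda> \<alpha> = z" "walk \<Lambda> (src \<Lambda> \<alpha>) w (onob p y)" by auto
    from Cons.IH[OF \<alpha>(3)] obtain x w' where
      w': "walk \<Omega> x w' y" "map (map_step (onmor p)) w' = w" "onob p x = src \<Lambda> \<alpha>" by blast
    have "x \<in> fibre \<Omega> p (src \<Lambda> \<alpha>)" using w' \<Omega>.walk_ends by (auto simp: fibre_def)
    from lift_src_ex[OF \<alpha>(1) this] obtain \<omega> where "\<omega> \<in> mor \<Omega>" "onmor p \<omega> = \<alpha>" "src \<Omega> \<omega> = x" by blast
    then show ?thesis using w' \<alpha> Fwd p_rng[of \<omega>]
      by (intro exI[of _ "rng \<Omega> \<omega>"] exI[of _ "Fwd \<omega> # w'"]) auto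
  next
    case (Bwd \<alpha>)
    with Cons.prems have \<alpha>: "\<alpha> \<in> mor \<Lambda>" "src \<Lambda> \<alpha> = z" "walk \<Lambda> (rng \<Lambda> \<alpha>) w (onob p y)" by auto
    from Cons.IH[OF \<alpha>(3)] obtain x w' where
      w': "walk \<Omega> x w' y" "map (map_step (onmor p)) w' = w" "onob p x = rng \<Lambda> \<alpha>" by blast
    have "x \<in> fibre \<Omega> p (rng \<Lambda> \<alpha>)" using w' \<Omega>.walk_ends by (auto simp: fibre_def)
    from lift_rng_ex[OF \<alpha>(1) this] obtain \<omega> where "\<omega> \<in> mor \<Omega>" "onmor p \<omega> = \<alpha>" "rng \<Omega> \<omega> = x" by blast
    then show ?thesis using w' \<alpha> Bwd p_src[of \<omega>]
      by (intro exI[of _ "src \<Omega> \<omega>"] exI[of _ "Bwd \<omega> # w'"]) auto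
  qed
qed

text \<open>Lifting a word for \<open>a\<close> with source \<open>u\<close> gives a walk whose left
  end must be \<open>act a u\<close> by \<open>act_walk\<close>. Questions about the action thereby
  become questions about walks in \<open>\<Omega>\<close>.\<close>

lemma act_liftE:
  assumes "a \<in> mor \<G>" "u \<in> obj \<Omega>" "src \<G> a = onob p u"
  obtains w where "walk \<Omega> (act a u) w u"
    "a = walk_class \<Lambda> (onob p (act a u)) (map (map_step (onmor p)) w) (onob p u)"
proof -
  obtain z w where a: "a = walk_class \<Lambda> z w (onob p u)" "walk \<Lambda> z w (onob p u)"
    using assms by (auto elim: \<Lambda>.fund_morE)
  from lift_walk[OF assms(2) a(2)] obtain x w' where
    "walk \<Omega> x w' u" "map (map_step (onmor p)) w' = w" "onob p x = z" by blast
  with act_walk[of x w' u] a show thesis by (auto intro: that)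
qed

text \<open>Connectedness provides a walk in \<open>\<Omega>\<close> between the two vertices, and
  the class of its projection does the transport.\<close>

lemma act_transitive:
  assumes "connected_cat \<Omega>" "u \<in> obj \<Omega>" "v \<in> obj \<Omega>"
  obtains a where "a \<in> mor \<G>" "src \<G> a = onob p v" "rng \<G> a = onob p u" "act a v = u"
proof -
  note w = base_walk[OF assms]
  show thesis
    by (rule that[OF \<Lambda>.fund_morI[OF walk_map[OF p_functor w]]]) (simp_all add: act_walk[OF w])
qed

text \<open>The projection of a loop at \<open>u\<close> fixes \<open>u\<close> by
  \<open>act_walk\<close>. Conversely, an element that fixes \<open>u\<close> lifts to a walk that
  closes up at \<open>u\<close>.\<close>

lemma fund_map_image:
  assumes u: "u \<in> obj \<Omega>"
  shows "onmor (fund_map \<Omega> \<Lambda> p) ` carrier (fund_group \<Omega> u) =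
    {c \<in> carrier (fund_group \<Lambda> (onob p u)). act c u = u}"
proof (intro subset_antisym subsetI)
  fix c assume "c \<in> onmor (fund_map \<Omega> \<Lambda> p) ` carrier (fund_group \<Omega> u)"
  then obtain w where w: "walk \<Omega> u w u" and c: "c = onmor (fund_map \<Omega> \<Lambda> p) (walk_class \<Omega> u w u)"
    by (auto simp: \<Omega>.carrier_fund_group)
  show "c \<in> {c \<in> carrier (fund_group \<Lambda> (onob p u)). act c u = u}"
    unfolding c fund_map_walk_class[OF \<Omega>.category_axioms \<Lambda>.category_axioms p_functor w]
    using walk_map[OF p_functor w] act_walk[OF w] by (auto simp: \<Lambda>.carrier_fund_group)
next
  fix c assume "c \<in> {c \<in> carrier (fund_group \<Lambda> (onob p u)). act c u = u}"
  then have "c \<in> mor \<G>" "src \<G> c = onob p u" "act c u = u" by (auto simp: fund_group_def)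
  with act_liftE[of c u] u obtain w where w: "walk \<Omega> u w u"
    "c = walk_class \<Lambda> (onob p u) (map (map_step (onmor p)) w) (onob p u)" by metis
  have "walk_class \<Omega> u w u \<in> carrier (fund_group \<Omega> u)"
    using w(1) by (auto simp: \<Omega>.carrier_fund_group)
  then show "c \<in> onmor (fund_map \<Omega> \<Lambda> p) ` carrier (fund_group \<Omega> u)"
    using w fund_map_walk_class[OF \<Omega>.category_axioms \<Lambda>.category_axioms p_functor w(1)]
    by (intro image_eqI[of _ _ "walk_class \<Omega> u w u"]) simp_all
qed

end

text \<open>A walk in \<open>\<Omega>\<close> that realizes the action of \<open>a\<close> on
  \<open>u\<close> is sent by \<phi> to a walk in \<open>\<Sigma>\<close> with the same projection
  to \<open>\<Lambda>\<close>. Reading off its left end gives the equivariance.\<close>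

lemma act_covering_morphism:
  assumes \<Omega>: "covering k \<Omega> p \<Lambda>" and \<Sigma>: "covering k \<Sigma> q \<Lambda>" and \<phi>: "covering_morphism \<Omega> p \<Sigma> q \<phi>"
    and a: "a \<in> mor (fund_groupoid \<Lambda>)" "u \<in> obj \<Omega>" "src (fund_groupoid \<Lambda>) a = onob p u"
  shows "onob \<phi> (fund_act \<Omega> p \<Lambda> a u) = fund_act \<Sigma> q \<Lambda> a (onob \<phi> u)"
proof -
  interpret \<Omega>: covering_context k \<Omega> p \<Lambda> by unfold_locales fact
  interpret \<Sigma>: covering_context k \<Sigma> q \<Lambda> by unfold_locales fact
  have F: "is_functor \<Omega> \<Sigma> \<phi>" and e: "\<And>x. x \<in> obj \<Omega> \<Longrightarrow> onob q (onob \<phi> x) = onob p x"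
    "\<And>\<omega>. \<omega> \<in> mor \<Omega> \<Longrightarrow> onmor q (onmor \<phi> \<omega>) = onmor p \<omega>"
    using \<phi> by (auto simp: covering_morphism_def kgraph_morphism_def eq_map_def comp_map_def)
  \<comment> \<open>The identity \<open>q \<circ> \<phi> = p\<close> holds on the carrier only, so
    the letters must be known to be morphisms of \<open>\<Omega>\<close>.\<close>
  have m: "map (map_step (onmor q)) (map (map_step (onmor \<phi>)) w) = map (map_step (onmor p)) w"
    if "walk \<Omega> x w y" for x w y
    using that
  proof (induction w arbitrary: x)
    case (Cons a w)
    then show ?case by (cases a) (auto simp: e)
  qed simp
  obtain w where w: "walk \<Omega> (fund_act \<Omega> p \<Lambda> a u) w u"
    "a = walk_class \<Lambda> (onob p (fund_act \<Omega> p \<Lambda> a u)) (map (map_step (onmor p)) w) (onob p u)"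
    using \<Omega>.act_liftE[OF a] .
  show ?thesis
    using \<Sigma>.act_walk[OF walk_map[OF F w(1)]] m[OF w(1)] w(2) e(1) \<Omega>.\<Omega>.walk_ends[OF w(1)] by (simp del: map_map)
qed

section \<open>Transfer along functors\<close>

text \<open>Unique lifting with prescribed source already transfers the factorization property:
  factor the image in \<open>\<Lambda>\<close> and lift the two factors. This spares a direct check
  for the path graph and for the orbit graph.\<close>

lemma kgraph_of_src_lifts:
  assumes "category \<Sigma>" "kgraph k \<Lambda>" and q: "kgraph_morphism \<Sigma> \<Lambda> q"
    and lifts: "\<And>v. v \<in> obj \<Sigma> \<Longrightarrow>
      bij_betw (onmor q) {\<omega> \<in> mor \<Sigma>. src \<Sigma> \<omega> = v} {\<alpha> \<in> mor \<Lambda>. src \<Lambda> \<alpha> = onob q v}"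
  shows "kgraph k \<Sigma>"
proof -
  interpret \<Sigma>: category \<Sigma> by fact
  interpret \<Lambda>: kgraph k \<Lambda> by fact
  have q_ob: "onob q x \<in> obj \<Lambda>" "onmor q (idm \<Sigma> x) = idm \<Lambda> (onob q x)" if "x \<in> obj \<Sigma>" for x
    using q that by (auto simp: kgraph_morphism_def is_functor_def)
  have q_mor: "onmor q \<omega> \<in> mor \<Lambda>" "src \<Lambda> (onmor q \<omega>) = onob q (src \<Sigma> \<omega>)"
    "rng \<Lambda> (onmor q \<omega>) = onob q (rng \<Sigma> \<omega>)" "deg \<Sigma> \<omega> = deg \<Lambda> (onmor q \<omega>)" if "\<omega> \<in> mor \<Sigma>" for \<omega>
    using q that by (auto simp: kgraph_morphism_def is_functor_def)
  have q_cmp: "onmor q (\<omega> \<cdot>\<^bsub>\<Sigma>\<^esub> \<mu>) = onmor q \<omega> \<cdot>\<^bsub>\<Lambda>\<^esub> onmor q \<mu>"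
    if "\<omega> \<in> mor \<Sigma>" "\<mu> \<in> mor \<Sigma>" "src \<Sigma> \<omega> = rng \<Sigma> \<mu>" for \<omega> \<mu>
    using q that by (auto simp: kgraph_morphism_def is_functor_def)
  have unique: "\<omega> = \<mu>" if "\<omega> \<in> mor \<Sigma>" "\<mu> \<in> mor \<Sigma>" "src \<Sigma> \<omega> = src \<Sigma> \<mu>" "onmor q \<omega> = onmor q \<mu>" for \<omega> \<mu>
    using bij_betw_imp_inj_on[OF lifts[OF \<Sigma>.src_closed[OF that(2)]]] that by (simp add: inj_on_def)
  have lift_ex: "\<exists>\<omega>\<in>mor \<Sigma>. onmor q \<omega> = \<alpha> \<and> src \<Sigma> \<omega> = u"
    if "\<alpha> \<in> mor \<Lambda>" "u \<in> obj \<Sigma>" "src \<Lambda> \<alpha> = onob q u" for \<alpha> u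
    using bij_betw_imp_surj_on[OF lifts[OF that(2)]] that by (simp add: set_eq_iff image_iff) metis
  show ?thesis
  proof (unfold_locales, goal_cases)
    case (1 \<alpha>)
    then show ?case by (simp add: q_mor \<Lambda>.deg_closed)
  next
    case (2 x)
    then show ?case by (simp add: q_mor(4) q_ob \<Sigma>.idm_closed \<Lambda>.deg_idm)
  next
    case (3 \<alpha> \<beta>)
    then show ?case by (simp add: q_mor \<Sigma>.cmp_closed q_cmp \<Lambda>.deg_cmp)
  next
    case (4 \<alpha> n l)
    from q_mor(4)[OF 4(1)] 4(4) have "deg \<Lambda> (onmor q \<alpha>) = n + l" by simp
    from \<Lambda>.factorization[OF q_mor(1)[OF 4(1)] 4(2,3) this]
    obtain f where f: "case f of (\<beta>, \<gamma>) \<Rightarrow> \<beta> \<in> mor \<Lambda> \<and> \<gamma> \<in> mor \<Lambda> \<and> src \<Lambda> \<beta> = rng \<Lambda> \<gamma>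
               \<and> deg \<Lambda> \<beta> = n \<and> deg \<Lambda> \<gamma> = l \<and> onmor q \<alpha> = \<beta> \<cdot>\<^bsub>\<Lambda>\<^esub> \<gamma>"
      and f_unique: "\<And>g. (case g of (\<beta>, \<gamma>) \<Rightarrow> \<beta> \<in> mor \<Lambda> \<and> \<gamma> \<in> mor \<Lambda> \<and> src \<Lambda> \<beta> = rng \<Lambda> \<gamma>
               \<and> deg \<Lambda> \<beta> = n \<and> deg \<Lambda> \<gamma> = l \<and> onmor q \<alpha> = \<beta> \<cdot>\<^bsub>\<Lambda>\<^esub> \<gamma>) \<Longrightarrow> g = f"
      by (elim ex1E) blast
    obtain \<beta> \<gamma> where bc: "f = (\<beta>, \<gamma>)" "\<beta> \<in> mor \<Lambda>" "\<gamma> \<in> mor \<Lambda>" "src \<Lambda> \<beta> = rng \<Lambda> \<gamma>"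
      "deg \<Lambda> \<beta> = n" "deg \<Lambda> \<gamma> = l" "onmor q \<alpha> = \<beta> \<cdot>\<^bsub>\<Lambda>\<^esub> \<gamma>"
      using f by (cases f) auto
    \<comment> \<open>The right factor is lifted first, at the source of \<alpha>; the range of its
      lift is then the prescribed source for the left factor. The product of the lifts has the
      source and the image of \<alpha>, so it equals \<alpha>.\<close>
    have "src \<Lambda> \<gamma> = onob q (src \<Sigma> \<alpha>)" using bc q_mor[OF 4(1)] \<Lambda>.src_cmp by metis
    from lift_ex[OF bc(3) \<Sigma>.src_closed[OF 4(1)] this]
    obtain \<gamma>' where c: "\<gamma>' \<in> mor \<Sigma>" "onmor q \<gamma>' = \<gamma>" "src \<Sigma> \<gamma>' = src \<Sigma> \<alpha>" by blast
    have "src \<Lambda> \<beta> = onob q (rng \<Sigma> \<gamma>')" using bc q_mor[OF c(1)] c by simp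
    from lift_ex[OF bc(2) \<Sigma>.rng_closed[OF c(1)] this]
    obtain \<beta>' where b: "\<beta>' \<in> mor \<Sigma>" "onmor q \<beta>' = \<beta>" "src \<Sigma> \<beta>' = rng \<Sigma> \<gamma>'" by blast
    have "\<alpha> = \<beta>' \<cdot>\<^bsub>\<Sigma>\<^esub> \<gamma>'"
      using 4(1) b c bc by (intro unique) (simp_all add: \<Sigma>.cmp_closed \<Sigma>.src_cmp q_cmp)
    then have "case (\<beta>', \<gamma>') of (\<beta>, \<gamma>) \<Rightarrow> \<beta> \<in> mor \<Sigma> \<and> \<gamma> \<in> mor \<Sigma> \<and> src \<Sigma> \<beta> = rng \<Sigma> \<gamma>
               \<and> deg \<Sigma> \<beta> = n \<and> deg \<Sigma> \<gamma> = l \<and> \<alpha> = \<beta> \<cdot>\<^bsub>\<Sigma>\<^esub> \<gamma>"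
      using b c bc by (simp add: q_mor(4))
    \<comment> \<open>Any other factorization projects to the unique one in
      \<open>\<Lambda>\<close>. Its right factor has the source of \<alpha> and is thus determined,
      and then so is its left factor.\<close>
    moreover have "g = (\<beta>', \<gamma>')" if g: "case g of (\<beta>, \<gamma>) \<Rightarrow> \<beta> \<in> mor \<Sigma> \<and> \<gamma> \<in> mor \<Sigma> \<and> src \<Sigma> \<beta> = rng \<Sigma> \<gamma>
               \<and> deg \<Sigma> \<beta> = n \<and> deg \<Sigma> \<gamma> = l \<and> \<alpha> = \<beta> \<cdot>\<^bsub>\<Sigma>\<^esub> \<gamma>" for g
    proof -
      obtain b0 c0 where g0: "g = (b0, c0)" "b0 \<in> mor \<Sigma>" "c0 \<in> mor \<Sigma>" "src \<Sigma> b0 = rng \<Sigma> c0"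
        "deg \<Sigma> b0 = n" "deg \<Sigma> c0 = l" "\<alpha> = b0 \<cdot>\<^bsub>\<Sigma>\<^esub> c0"
        using g by (cases g) auto
      have "(onmor q b0, onmor q c0) = f"
        using g0 by (intro f_unique) (simp add: q_mor q_cmp)
      then have e: "onmor q b0 = \<beta>" "onmor q c0 = \<gamma>" using bc(1) by auto
      have "c0 = \<gamma>'" using g0 c e \<Sigma>.src_cmp[of b0 c0] by (intro unique) auto
      moreover from this have "b0 = \<beta>'" using g0 b e by (intro unique) auto
      ultimately show ?thesis using g0 by simp
    qed
    ultimately show ?case by (rule ex1I)
  qed
qed

lemma connected_catI:
  assumes "\<And>u. u \<in> obj C \<Longrightarrow> equivclp (\<lambda>x y. \<exists>\<alpha>\<in>mor C. rng C \<alpha> = x \<and> src C \<alpha> = y) b u"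
  shows "connected_cat C"
  unfolding connected_cat_def by (intro ballI equivclp_trans[OF equivclp_sym[OF assms] assms])

text \<open>A functor carries zigzags to zigzags. The case of interest is the orbit map from
  \<open>\<Omega>\<close> onto its quotient.\<close>

lemma connected_cat_image:
  assumes C: "connected_cat C" and F: "is_functor C D F" and surj: "onob F ` obj C = obj D"
  shows "connected_cat D"
proof -
  have mor: "\<exists>\<beta>\<in>mor D. rng D \<beta> = onob F (rng C \<alpha>) \<and> src D \<beta> = onob F (src C \<alpha>)" if "\<alpha> \<in> mor C" for \<alpha>
    using F that by (intro bexI[of _ "onmor F \<alpha>"]) (simp_all add: is_functor_def)
  have "equivclp (\<lambda>x y. \<exists>\<alpha>\<in>mor D. rng D \<alpha> = x \<and> src D \<alpha> = y) (onob F u) (onob F v)"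
    if "equivclp (\<lambda>x y. \<exists>\<alpha>\<in>mor C. rng C \<alpha> = x \<and> src C \<alpha> = y) u v" for u v
    using that
  proof (induction rule: equivclp_induct)
    case (step y z)
    then have "(\<exists>\<alpha>\<in>mor D. rng D \<alpha> = onob F y \<and> src D \<alpha> = onob F z) \<or>
        (\<exists>\<alpha>\<in>mor D. rng D \<alpha> = onob F z \<and> src D \<alpha> = onob F y)"
      using mor by blast
    with step.IH show ?case by (rule equivclp_into_equivclp)
  qed auto
  then show ?thesis using C by (auto simp: connected_cat_def surj[symmetric])
qed

section \<open>The universal covering acts freely\<close>

text \<open>The morphism \<open>(\<alpha>, a)\<close> is the lift of \<open>\<alpha>\<close> with source \<open>a\<close>.\<close>

definition path_graph ::
  "('o, 'm, 'z) kcat_scheme \<Rightarrow> 'o \<Rightarrow> ('o \<times> 'm step list set \<times> 'o, 'm \<times> 'o \<times> 'm step list set \<times> 'o) kcat" where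
  "path_graph \<Lambda> x = \<lparr>
     obj = {a \<in> mor (fund_groupoid \<Lambda>). src (fund_groupoid \<Lambda>) a = x},
     mor = {(\<alpha>, a). \<alpha> \<in> mor \<Lambda> \<and> a \<in> mor (fund_groupoid \<Lambda>) \<and> src (fund_groupoid \<Lambda>) a = x \<and>
              rng (fund_groupoid \<Lambda>) a = src \<Lambda> \<alpha>},
     src = snd,
     rng = (\<lambda>(\<alpha>, a). onmor (fund_incl \<Lambda>) \<alpha> \<cdot>\<^bsub>fund_groupoid \<Lambda>\<^esub> a),
     idm = (\<lambda>a. (idm \<Lambda> (rng (fund_groupoid \<Lambda>) a), a)),
     cmp = (\<lambda>(\<alpha>, a) (\<beta>, b). (\<alpha> \<cdot>\<^bsub>\<Lambda>\<^esub> \<beta>, b)),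
     deg = (\<lambda>(\<alpha>, a). deg \<Lambda> \<alpha>)\<rparr>"

definition path_proj ::
  "('o, 'm, 'z) kcat_scheme \<Rightarrow>
    ('o \<times> 'm step list set \<times> 'o, 'm \<times> 'o \<times> 'm step list set \<times> 'o, 'o, 'm) cat_map" where
  "path_proj \<Lambda> = \<lparr>onob = rng (fund_groupoid \<Lambda>), onmor = fst\<rparr>"

lemma path_graph_sel:
  "a \<in> obj (path_graph \<Lambda> x) \<longleftrightarrow> a \<in> mor (fund_groupoid \<Lambda>) \<and> src (fund_groupoid \<Lambda>) a = x"
  "(\<alpha>, a) \<in> mor (path_graph \<Lambda> x) \<longleftrightarrow> \<alpha> \<in> mor \<Lambda> \<and> a \<in> mor (fund_groupoid \<Lambda>) \<and>
     src (fund_groupoid \<Lambda>) a = x \<and> rng (fund_groupoid \<Lambda>) a = src \<Lambda> \<alpha>"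
  "src (path_graph \<Lambda> x) (\<alpha>, a) = a"
  "rng (path_graph \<Lambda> x) (\<alpha>, a) = onmor (fund_incl \<Lambda>) \<alpha> \<cdot>\<^bsub>fund_groupoid \<Lambda>\<^esub> a"
  "onob (path_proj \<Lambda>) a = rng (fund_groupoid \<Lambda>) a" "onmor (path_proj \<Lambda>) (\<alpha>, a) = \<alpha>"
  by (simp_all add: path_graph_def path_proj_def)

context kgraph begin

context
  fixes x :: 'o
begin

interpretation G: groupoid "fund_groupoid \<Lambda>" by (rule groupoid_fund_groupoid)

abbreviation (input) "\<G> \<equiv> fund_groupoid \<Lambda>"
abbreviation (input) "\<iota> \<equiv> onmor (fund_incl \<Lambda>)"
abbreviation (input) "P \<equiv> path_graph \<Lambda> x"

text \<open>These rules keep the inclusion folded. The simp rule \<open>fund_incl_sel(2)\<close>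
  would expand it into classes of one-letter words, so it is switched off in the computations with
  the path graph.\<close>

lemma fund_incl_simps:
  "\<alpha> \<in> mor \<Lambda> \<Longrightarrow> \<iota> \<alpha> \<in> mor \<G>"
  "src \<G> (\<iota> \<alpha>) = src \<Lambda> \<alpha>" "rng \<G> (\<iota> \<alpha>) = rng \<Lambda> \<alpha>"
  "y \<in> obj \<Lambda> \<Longrightarrow> \<iota> (idm \<Lambda> y) = idm \<G> y"
  "\<alpha> \<in> mor \<Lambda> \<Longrightarrow> \<beta> \<in> mor \<Lambda> \<Longrightarrow> src \<Lambda> \<alpha> = rng \<Lambda> \<beta> \<Longrightarrow> \<iota> (\<alpha> \<cdot>\<^bsub>\<Lambda>\<^esub> \<beta>) = \<iota> \<alpha> \<cdot>\<^bsub>\<G>\<^esub> \<iota> \<beta>"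
proof -
  show "src \<G> (\<iota> \<alpha>) = src \<Lambda> \<alpha>" "rng \<G> (\<iota> \<alpha>) = rng \<Lambda> \<alpha>" by simp_all
  show "\<alpha> \<in> mor \<Lambda> \<Longrightarrow> \<iota> \<alpha> \<in> mor \<G>" "y \<in> obj \<Lambda> \<Longrightarrow> \<iota> (idm \<Lambda> y) = idm \<G> y"
    "\<alpha> \<in> mor \<Lambda> \<Longrightarrow> \<beta> \<in> mor \<Lambda> \<Longrightarrow> src \<Lambda> \<alpha> = rng \<Lambda> \<beta> \<Longrightarrow> \<iota> (\<alpha> \<cdot>\<^bsub>\<Lambda>\<^esub> \<beta>) = \<iota> \<alpha> \<cdot>\<^bsub>\<G>\<^esub> \<iota> \<beta>"
    using fund_incl_functor unfolding is_functor_def by (auto simp del: fund_incl_sel(2))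
qed

lemmas path_simps = fund_incl_simps src_closed rng_closed idm_closed src_idm rng_idm cmp_closed src_cmp rng_cmp
  G.cmp_closed G.src_cmp G.rng_cmp

lemma rng_fund_closed: "a \<in> mor \<G> \<Longrightarrow> rng \<G> a \<in> obj \<Lambda>"
  using G.rng_closed by simp

text \<open>This is the category of elements of \<open>\<Lambda>\<close> acting on
  \<open>\<G>x\<close> by left multiplication through the inclusion. The range law is functoriality
  of the inclusion together with associativity in the groupoid.\<close>

lemma category_path_graph: "category P"
proof (unfold_locales, goal_cases)
  case (1 \<alpha>)
  then show ?case by (auto simp: path_graph_def simp del: fund_incl_sel(2) fund_sel)
next
  case (2 \<alpha>)
  then show ?case by (auto simp: path_graph_def fund_incl_simps G.cmp_closed G.src_cmp simp del: fund_incl_sel(2) fund_sel)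
next
  case (3 x)
  then show ?case by (auto simp: path_graph_def fund_incl_simps rng_fund_closed idm_closed src_idm simp del: fund_incl_sel(2) fund_sel)
next
  case (4 x)
  then show ?case by (auto simp: path_graph_def simp del: fund_incl_sel(2) fund_sel)
next
  case (5 x)
  then show ?case by (auto simp: path_graph_def fund_incl_simps rng_fund_closed G.idm_left simp del: fund_incl_sel(2) fund_sel)
next
  case (6 \<alpha> \<beta>)
  then show ?case by (auto simp: path_graph_def fund_incl_simps cmp_closed src_cmp G.rng_cmp simp del: fund_incl_sel(2) fund_sel)
next
  case (7 \<alpha> \<beta>)
  then show ?case by (auto simp: path_graph_def simp del: fund_incl_sel(2) fund_sel)
next
  case (8 \<alpha> \<beta>)
  then show ?case by (auto simp: path_graph_def fund_incl_simps G.cmp_assoc G.rng_cmp simp del: fund_incl_sel(2) fund_sel)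
next
  case (9 \<alpha> \<beta> \<gamma>)
  then show ?case by (auto simp: path_graph_def fund_incl_simps G.rng_cmp cmp_assoc simp del: fund_incl_sel(2) fund_sel)
next
  case (10 \<alpha>)
  then show ?case by (auto simp: path_graph_def fund_incl_simps G.rng_cmp idm_left simp del: fund_incl_sel(2) fund_sel)
next
  case (11 \<alpha>)
  then show ?case by (auto simp: path_graph_def idm_right simp del: fund_incl_sel(2) fund_sel)
qed

lemma path_proj_morphism: "kgraph_morphism P \<Lambda> (path_proj \<Lambda>)"
  by (auto simp: kgraph_morphism_def is_functor_def path_graph_def path_proj_def path_simps rng_fund_closed
      simp del: fund_incl_sel(2) fund_sel(2-))

text \<open>The lift of \<alpha> with source \<open>a\<close> is \<alpha> paired with
  \<open>a\<close>; for the lift with range \<open>a\<close>, the partner must be the inverse of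
  \<alpha> times \<open>a\<close>. The assumption \<open>reach\<close> puts a vertex over every
  vertex of \<open>\<Lambda>\<close>, which gives surjectivity.\<close>

lemma covering_path_graph:
  assumes reach: "\<And>y. y \<in> obj \<Lambda> \<Longrightarrow> \<exists>a\<in>mor \<G>. rng \<G> a = y \<and> src \<G> a = x"
  shows "covering k P (path_proj \<Lambda>) \<Lambda>"
proof -
  have src_bij: "bij_betw (onmor (path_proj \<Lambda>)) {\<omega> \<in> mor P. src P \<omega> = a} {\<alpha> \<in> mor \<Lambda>. src \<Lambda> \<alpha> = onob (path_proj \<Lambda>) a}"
    if "a \<in> obj P" for a
    using that by (intro bij_betw_byWitness[of _ "\<lambda>\<alpha>. (\<alpha>, a)"]) (auto simp: path_graph_sel simp del: fund_incl_sel(2))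
  have rng_bij: "bij_betw (onmor (path_proj \<Lambda>)) {\<omega> \<in> mor P. rng P \<omega> = a} {\<alpha> \<in> mor \<Lambda>. rng \<Lambda> \<alpha> = onob (path_proj \<Lambda>) a}"
    if a: "a \<in> obj P" for a
  proof -
    have 1: "G.ginv (\<iota> \<alpha>) \<cdot>\<^bsub>\<G>\<^esub> (\<iota> \<alpha> \<cdot>\<^bsub>\<G>\<^esub> b) = b"
      if "\<alpha> \<in> mor \<Lambda>" "b \<in> mor \<G>" "rng \<G> b = src \<Lambda> \<alpha>" for \<alpha> b
      using that G.idm_left[of b]
      by (subst G.cmp_assoc[symmetric]) (simp_all add: G.ginv path_simps del: fund_incl_sel(2) fund_sel)
    have 2: "\<iota> \<alpha> \<cdot>\<^bsub>\<G>\<^esub> (G.ginv (\<iota> \<alpha>) \<cdot>\<^bsub>\<G>\<^esub> a) = a"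
      if "\<alpha> \<in> mor \<Lambda>" "rng \<G> a = rng \<Lambda> \<alpha>" for \<alpha>
      using that a G.idm_left[of a]
      by (subst G.cmp_assoc[symmetric])
        (simp_all add: path_graph_sel G.ginv path_simps del: fund_incl_sel(2) fund_sel)
    have a': "a \<in> mor \<G>" "src \<G> a = x" using a by (simp_all add: path_graph_sel)
    show ?thesis
    proof (rule bij_betw_byWitness[of _ "\<lambda>\<alpha>. (\<alpha>, G.ginv (\<iota> \<alpha>) \<cdot>\<^bsub>\<G>\<^esub> a)"])
      show "\<forall>\<omega>\<in>{\<omega> \<in> mor P. rng P \<omega> = a}.
          (onmor (path_proj \<Lambda>) \<omega>, G.ginv (\<iota> (onmor (path_proj \<Lambda>) \<omega>)) \<cdot>\<^bsub>\<G>\<^esub> a) = \<omega>"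
        by (auto simp: path_graph_sel 1 simp del: fund_incl_sel(2))
      show "onmor (path_proj \<Lambda>) ` {\<omega> \<in> mor P. rng P \<omega> = a} \<subseteq> {\<alpha> \<in> mor \<Lambda>. rng \<Lambda> \<alpha> = onob (path_proj \<Lambda>) a}"
        by (auto simp: path_graph_sel fund_incl_simps G.rng_cmp simp del: fund_incl_sel(2))
      show "(\<lambda>\<alpha>. (\<alpha>, G.ginv (\<iota> \<alpha>) \<cdot>\<^bsub>\<G>\<^esub> a)) ` {\<alpha> \<in> mor \<Lambda>. rng \<Lambda> \<alpha> = onob (path_proj \<Lambda>) a}
          \<subseteq> {\<omega> \<in> mor P. rng P \<omega> = a}"
      proof (intro image_subsetI CollectI conjI)
        fix \<alpha> assume "\<alpha> \<in> {\<alpha> \<in> mor \<Lambda>. rng \<Lambda> \<alpha> = onob (path_proj \<Lambda>) a}"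
        then have \<alpha>: "\<alpha> \<in> mor \<Lambda>" "rng \<G> a = rng \<Lambda> \<alpha>" by (simp_all add: path_graph_sel)
        then show "(\<alpha>, G.ginv (\<iota> \<alpha>) \<cdot>\<^bsub>\<G>\<^esub> a) \<in> mor P" "rng P (\<alpha>, G.ginv (\<iota> \<alpha>) \<cdot>\<^bsub>\<G>\<^esub> a) = a"
          using a' 2[OF \<alpha>]
          by (simp_all add: path_graph_sel G.ginv fund_incl_simps G.cmp_closed G.src_cmp G.rng_cmp
              del: fund_incl_sel(2) fund_sel)
      qed
    qed (simp add: path_graph_sel)
  qed
  have "onmor (path_proj \<Lambda>) ` mor P = mor \<Lambda>"
  proof (intro subset_antisym subsetI)
    fix \<alpha> assume \<alpha>: "\<alpha> \<in> mor \<Lambda>"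
    obtain a where "a \<in> mor \<G>" "rng \<G> a = src \<Lambda> \<alpha>" "src \<G> a = x"
      using reach[OF src_closed[OF \<alpha>]] by blast
    with \<alpha> show "\<alpha> \<in> onmor (path_proj \<Lambda>) ` mor P"
      by (intro image_eqI[of _ _ "(\<alpha>, a)"]) (auto simp: path_graph_sel)
  qed (auto simp: path_graph_sel)
  then show ?thesis
    using kgraph_of_src_lifts[OF category_path_graph kgraph_axioms path_proj_morphism src_bij]
      kgraph_axioms path_proj_morphism src_bij rng_bij
    by (auto simp: covering_def)
qed

text \<open>The class of any word is joined to the identity at \<open>x\<close> by building up the
  word from the right: prepending one letter moves along one edge of the path graph, forwards or
  backwards.\<close>

lemma connected_path_graph: "connected_cat P"
proof (rule connected_catI)
  fix a assume "a \<in> obj P"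
  then obtain y w where a: "a = walk_class \<Lambda> y w x" "walk \<Lambda> y w x"
    by (auto simp: path_graph_def elim: fund_morE)
  have "equivclp (\<lambda>b c. \<exists>\<omega>\<in>mor P. rng P \<omega> = b \<and> src P \<omega> = c) (walk_class \<Lambda> x [] x) (walk_class \<Lambda> y w x)"
    using a(2)
  proof (induction w arbitrary: y)
    case Nil
    then show ?case by auto
  next
    case (Cons s w)
    show ?case
    proof (cases s)
      case (Fwd \<alpha>)
      with Cons.prems have \<alpha>: "\<alpha> \<in> mor \<Lambda>" "rng \<Lambda> \<alpha> = y" "walk \<Lambda> (src \<Lambda> \<alpha>) w x" by auto
      have "(\<alpha>, walk_class \<Lambda> (src \<Lambda> \<alpha>) w x) \<in> mor P"
        using \<alpha> by (auto simp: path_graph_def intro: fund_morI)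
      moreover have "rng P (\<alpha>, walk_class \<Lambda> (src \<Lambda> \<alpha>) w x) = walk_class \<Lambda> y (s # w) x"
        using \<alpha> Fwd by (simp add: path_graph_def fund_cmp src_closed)
      moreover have "src P (\<alpha>, walk_class \<Lambda> (src \<Lambda> \<alpha>) w x) = walk_class \<Lambda> (src \<Lambda> \<alpha>) w x"
        by (simp add: path_graph_def)
      ultimately show ?thesis by (intro equivclp_into_equivclp[OF Cons.IH[OF \<alpha>(3)]]) blast
    next
      case (Bwd \<alpha>)
      with Cons.prems have \<alpha>: "\<alpha> \<in> mor \<Lambda>" "src \<Lambda> \<alpha> = y" "walk \<Lambda> (rng \<Lambda> \<alpha>) w x" by auto
      have w: "walk \<Lambda> y (s # w) x" using Cons.prems .
      have "(\<alpha>, walk_class \<Lambda> y (s # w) x) \<in> mor P"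
        using \<alpha> fund_morI[OF w] by (auto simp: path_graph_def)
      \<comment> \<open>For a backward letter the roles of the ends are exchanged: the edge labelled
        \<alpha> starts at the longer word, and \<alpha> cancels its formal inverse, which leaves
        \<open>w\<close> as the range.\<close>
      moreover have "walk_eq \<Lambda> (rng \<Lambda> \<alpha>) x ([Fwd \<alpha>, Bwd \<alpha>] @ w) ([] @ w)"
        using \<alpha> by (intro walk_eq.cong[OF walk_eq.inv_right walk_eq.refl])
      then have "rng P (\<alpha>, walk_class \<Lambda> y (s # w) x) = walk_class \<Lambda> (rng \<Lambda> \<alpha>) w x"
        using \<alpha> Bwd w src_closed[OF \<alpha>(1)] by (simp add: path_graph_def fund_cmp walk_class_eq_iff)
      moreover have "src P (\<alpha>, walk_class \<Lambda> y (s # w) x) = walk_class \<Lambda> y (s # w) x"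
        by (simp add: path_graph_def)
      ultimately show ?thesis by (intro equivclp_into_equivclp[OF Cons.IH[OF \<alpha>(3)]]) blast
    qed
  qed
  then show "equivclp (\<lambda>b c. \<exists>\<omega>\<in>mor P. rng P \<omega> = b \<and> src P \<omega> = c) (walk_class \<Lambda> x [] x) a"
    using a by simp
qed

text \<open>Left multiplication satisfies the axioms that characterize the action, so it agrees with
  the chosen \<open>fund_act\<close> by uniqueness.\<close>

lemma fund_act_path_graph:
  assumes reach: "\<And>y. y \<in> obj \<Lambda> \<Longrightarrow> \<exists>a\<in>mor \<G>. rng \<G> a = y \<and> src \<G> a = x"
    and "a \<in> mor \<G>" "b \<in> mor \<G>" "src \<G> a = rng \<G> b" "src \<G> b = x"
  shows "fund_act P (path_proj \<Lambda>) \<Lambda> a b = a \<cdot>\<^bsub>\<G>\<^esub> b"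
proof -
  have fib: "fibre P (path_proj \<Lambda>) y = {b \<in> mor \<G>. src \<G> b = x \<and> rng \<G> b = y}" for y
    by (auto simp: fibre_def path_graph_def path_proj_def)
  have 1: "G.ginv a \<cdot>\<^bsub>\<G>\<^esub> (a \<cdot>\<^bsub>\<G>\<^esub> b) = b" if "a \<in> mor \<G>" "b \<in> mor \<G>" "rng \<G> b = src \<G> a" for a b
    using that G.idm_left[of b] by (subst G.cmp_assoc[symmetric]) (simp_all add: G.ginv del: fund_sel)
  have 2: "a \<cdot>\<^bsub>\<G>\<^esub> (G.ginv a \<cdot>\<^bsub>\<G>\<^esub> b) = b" if "a \<in> mor \<G>" "b \<in> mor \<G>" "rng \<G> b = rng \<G> a" for a b
    using that G.idm_left[of b] by (subst G.cmp_assoc[symmetric]) (simp_all add: G.ginv del: fund_sel)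
  have bij: "bij_betw ((\<cdot>\<^bsub>\<G>\<^esub>) a) (fibre P (path_proj \<Lambda>) (src \<G> a)) (fibre P (path_proj \<Lambda>) (rng \<G> a))"
    if "a \<in> mor \<G>" for a
    using that by (intro bij_betw_byWitness[of _ "(\<cdot>\<^bsub>\<G>\<^esub>) (G.ginv a)"])
      (auto simp: fib G.ginv G.cmp_closed G.src_cmp G.rng_cmp 1 2)
  have "is_fund_action P (path_proj \<Lambda>) \<Lambda> (\<lambda>a b. a \<cdot>\<^bsub>\<G>\<^esub> b)"
    unfolding is_fund_action_def
  proof (intro conjI ballI impI bij)
    fix y b assume "b \<in> fibre P (path_proj \<Lambda>) y"
    then show "idm \<G> y \<cdot>\<^bsub>\<G>\<^esub> b = b" using G.idm_left[of b] by (auto simp only: fib)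
  qed (auto simp: fib G.cmp_assoc, auto simp: path_graph_def path_proj_def)
  from fund_act_unique[OF covering_path_graph[OF reach] this assms(2)] assms show ?thesis by (simp add: fib)
qed

end

end

text \<open>A morphism to the path graph is equivariant, and the groupoid acts on the path graph by left
  multiplication, hence freely.\<close>

lemma universal_act_inj:
  assumes U: "universal_covering k \<Omega> p \<Lambda>" and v: "v \<in> obj \<Omega>"
    and a: "a \<in> mor (fund_groupoid \<Lambda>)" "src (fund_groupoid \<Lambda>) a = onob p v"
    and b: "b \<in> mor (fund_groupoid \<Lambda>)" "src (fund_groupoid \<Lambda>) b = onob p v"
    and eq: "fund_act \<Omega> p \<Lambda> a v = fund_act \<Omega> p \<Lambda> b v"
  shows "a = b"
proof -
  have cov: "covering k \<Omega> p \<Lambda>" and conn: "connected_cat \<Omega>"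
    using U by (auto simp: universal_covering_def connected_covering_def)
  interpret covering_context k \<Omega> p \<Lambda> by unfold_locales fact
  \<comment> \<open>Surjectivity of \<open>p\<close> on morphisms puts a vertex of
    \<open>\<Omega>\<close> over \<open>y\<close>, and transitivity of the action connects it to
    \<open>v\<close>.\<close>
  have reach: "\<exists>a\<in>mor \<G>. rng \<G> a = y \<and> src \<G> a = onob p v" if y: "y \<in> obj \<Lambda>" for y
  proof -
    have "idm \<Lambda> y \<in> onmor p ` mor \<Omega>" using cov \<Lambda>.idm_closed[OF y] by (simp add: covering_def)
    then obtain \<omega> where \<omega>: "\<omega> \<in> mor \<Omega>" "onmor p \<omega> = idm \<Lambda> y" by auto
    then have "onob p (src \<Omega> \<omega>) = y" using p_src \<Lambda>.src_idm y by metis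
    with act_transitive[OF conn \<Omega>.src_closed[OF \<omega>(1)] v] show ?thesis by metis
  qed
  let ?P = "path_graph \<Lambda> (onob p v)"
  have "connected_covering k ?P (path_proj \<Lambda>) \<Lambda>"
    using \<Lambda>.covering_path_graph[OF reach] \<Lambda>.connected_path_graph
    by (simp add: connected_covering_def)
  then obtain \<phi> where \<phi>: "covering_morphism \<Omega> p ?P (path_proj \<Lambda>) \<phi>"
    using universal_coveringD[OF U] by blast
  have v': "onob \<phi> v \<in> mor \<G>" "src \<G> (onob \<phi> v) = onob p v" "rng \<G> (onob \<phi> v) = onob p v"
    using \<phi> v by (auto simp: covering_morphism_def kgraph_morphism_def is_functor_def eq_map_def
        comp_map_def path_proj_def path_graph_def)
  \<comment> \<open>The vertex \<open>onob \<phi> v\<close> is some loop at \<open>onob p v\<close>,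
    not necessarily the identity. Equivariance turns equality of \<open>a v\<close> and
    \<open>b v\<close> into equality of the products with this loop, which is then cancelled on the
    right.\<close>
  have "onob \<phi> (act c v) = c \<cdot>\<^bsub>\<G>\<^esub> onob \<phi> v" if "c \<in> mor \<G>" "src \<G> c = onob p v" for c
    using act_covering_morphism[OF cov \<Lambda>.covering_path_graph[OF reach] \<phi> that(1) v that(2)]
      \<Lambda>.fund_act_path_graph[OF reach that(1) v'(1)] that v' by simp
  then have *: "a \<cdot>\<^bsub>\<G>\<^esub> onob \<phi> v = b \<cdot>\<^bsub>\<G>\<^esub> onob \<phi> v" using a b eq by metis
  have "c = (c \<cdot>\<^bsub>\<G>\<^esub> onob \<phi> v) \<cdot>\<^bsub>\<G>\<^esub> \<G>.ginv (onob \<phi> v)" if "c \<in> mor \<G>" "src \<G> c = onob p v" for c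
    using that v' \<G>.idm_right[of c] by (subst \<G>.cmp_assoc) (simp_all add: \<G>.ginv del: \<Lambda>.fund_sel)
  with * a b show "a = b" by metis
qed

section \<open>Quotients of the universal covering\<close>

locale universal_quotient = covering_context k \<Omega> p \<Lambda>
  for k and \<Omega> :: "('u, 'a, 'z) kcat_scheme" and p :: "('u, 'a, 'o, 'm) cat_map"
    and \<Lambda> :: "('o, 'm, 'y) kcat_scheme" +
  fixes v H
  assumes universal: "universal_covering k \<Omega> p \<Lambda>"
    and v: "v \<in> obj \<Omega>"
    and H: "subgroup H (fund_group \<Lambda> (onob p v))"
begin

abbreviation "\<pi> \<equiv> carrier (fund_group \<Lambda> (onob p v))"
abbreviation "act0 \<equiv> right_act_ob \<Omega> p \<Lambda> v"
abbreviation "act1 \<equiv> right_act \<Omega> p \<Lambda> v"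
abbreviation "Q \<equiv> quotient_graph \<Omega> p \<Lambda> v H"
abbreviation "q \<equiv> orbit_covering p"
abbreviation "orb0 \<equiv> orbit act0 H"
abbreviation "orb1 \<equiv> orbit act1 H"

section \<open>The right action of the fundamental group on vertices and morphisms\<close>

lemma connected: "connected_cat \<Omega>"
  using universal by (simp add: universal_covering_def connected_covering_def)

lemma \<pi>: "c \<in> \<pi> \<longleftrightarrow> c \<in> mor \<G> \<and> src \<G> c = onob p v \<and> rng \<G> c = onob p v"
  by (auto simp: fund_group_def)

lemma \<pi>_ops: "c \<otimes>\<^bsub>fund_group \<Lambda> (onob p v)\<^esub> d = c \<cdot>\<^bsub>\<G>\<^esub> d"
  "\<one>\<^bsub>fund_group \<Lambda> (onob p v)\<^esub> = idm \<G> (onob p v)"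
  by (simp_all add: fund_group_def)

lemma orbit_mapE:
  assumes "u \<in> obj \<Omega>"
  obtains a where "a \<in> mor \<G>" "src \<G> a = onob p v" "rng \<G> a = onob p u" "u = act a v"
  using act_transitive[OF connected assms v] by metis

lemma act_inj:
  "\<lbrakk>a \<in> mor \<G>; src \<G> a = onob p v; b \<in> mor \<G>; src \<G> b = onob p v; act a v = act b v\<rbrakk> \<Longrightarrow> a = b"
  using universal_act_inj[OF universal v] by blast

text \<open>The definition of the right action chooses some \<open>a\<close> that carries
  \<open>v\<close> to the given vertex. Injectivity of \<open>a \<mapsto> a v\<close> leaves one
  candidate, so the formula holds for whichever \<open>a\<close> is at hand.\<close>

lemma act0_act:
  assumes a: "a \<in> mor \<G>" "src \<G> a = onob p v"
  shows "act0 (act a v) c = act (a \<cdot>\<^bsub>\<G>\<^esub> c) v"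
proof -
  have "(SOME b. b \<in> mor \<G> \<and> src \<G> b = onob p v \<and> act b v = act a v) = a"
    using a by (intro some_equality) (auto intro: act_inj)
  then show ?thesis by (simp add: right_act_ob_def)
qed

text \<open>Once \<open>u\<close> is written as \<open>a v\<close>, each claim concerns
  multiplication in the groupoid: associativity makes the right action commute with the left one,
  and freeness amounts to cancelling \<open>a\<close> on the left.\<close>

lemma act0:
  assumes u: "u \<in> obj \<Omega>" and c: "c \<in> \<pi>"
  shows act0_closed: "act0 u c \<in> obj \<Omega>"
    and p_act0: "onob p (act0 u c) = onob p u"
    and act0_one: "act0 u (idm \<G> (onob p v)) = u"
    and act0_mult: "d \<in> \<pi> \<Longrightarrow> act0 u (c \<cdot>\<^bsub>\<G>\<^esub> d) = act0 (act0 u c) d"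
    and act_act0: "b \<in> mor \<G> \<Longrightarrow> src \<G> b = onob p u \<Longrightarrow> act b (act0 u c) = act0 (act b u) c"
    and act0_inj: "d \<in> \<pi> \<Longrightarrow> act0 u c = act0 u d \<Longrightarrow> c = d"
proof -
  from u obtain a where a: "a \<in> mor \<G>" "src \<G> a = onob p v" "rng \<G> a = onob p u" "u = act a v"
    by (rule orbit_mapE)
  have u_act: "act0 u c = act (a \<cdot>\<^bsub>\<G>\<^esub> c) v" for c using act0_act[OF a(1,2)] a(4) by simp
  have ac: "a \<cdot>\<^bsub>\<G>\<^esub> c \<in> mor \<G>" "src \<G> (a \<cdot>\<^bsub>\<G>\<^esub> c) = onob p v" "rng \<G> (a \<cdot>\<^bsub>\<G>\<^esub> c) = onob p u"
    if "c \<in> \<pi>" for c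
    using that a by (simp_all add: \<pi> \<G>.cmp_closed \<G>.src_cmp \<G>.rng_cmp)
  show "act0 u c \<in> obj \<Omega>" "onob p (act0 u c) = onob p u"
    using act_closed[OF ac(1)[OF c] v ac(2)[OF c]] p_act[OF ac(1)[OF c] v ac(2)[OF c]] ac(3)[OF c]
    by (simp_all add: u_act)
  show "act0 u (idm \<G> (onob p v)) = u"
    unfolding u_act using \<G>.idm_right[OF a(1)] a by simp
  show "act0 u (c \<cdot>\<^bsub>\<G>\<^esub> d) = act0 (act0 u c) d" if d: "d \<in> \<pi>"
    unfolding u_act act0_act[OF ac(1,2)[OF c]] using a c d by (simp add: \<G>.cmp_assoc \<pi>)
  show "act b (act0 u c) = act0 (act b u) c" if b: "b \<in> mor \<G>" "src \<G> b = onob p u"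
  proof -
    have "act b (act0 u c) = act (b \<cdot>\<^bsub>\<G>\<^esub> (a \<cdot>\<^bsub>\<G>\<^esub> c)) v"
      unfolding u_act using ac[OF c] b v by (subst act_cmp) (auto simp: fibre_def)
    also have "\<dots> = act ((b \<cdot>\<^bsub>\<G>\<^esub> a) \<cdot>\<^bsub>\<G>\<^esub> c) v"
      using a b c by (simp add: \<G>.cmp_assoc \<pi>)
    also have "\<dots> = act0 (act (b \<cdot>\<^bsub>\<G>\<^esub> a) v) c"
      using a b by (intro act0_act[symmetric]) (simp_all add: \<G>.cmp_closed \<G>.src_cmp)
    also have "act (b \<cdot>\<^bsub>\<G>\<^esub> a) v = act b u"
      using a b v by (subst act_cmp) (auto simp: fibre_def)
    finally show ?thesis .
  qed
  show "c = d" if d: "d \<in> \<pi>" and e: "act0 u c = act0 u d"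
  proof -
    have "a \<cdot>\<^bsub>\<G>\<^esub> c = a \<cdot>\<^bsub>\<G>\<^esub> d"
      using e ac[OF c] ac[OF d] unfolding u_act by (intro act_inj)
    moreover have "\<G>.ginv a \<cdot>\<^bsub>\<G>\<^esub> (a \<cdot>\<^bsub>\<G>\<^esub> c) = c" if "c \<in> \<pi>" for c
      using that a \<G>.idm_left[of c]
      by (subst \<G>.cmp_assoc[symmetric]) (simp_all add: \<G>.ginv \<pi> del: \<Lambda>.fund_sel)
    ultimately show ?thesis using c d by metis
  qed
qed

lemma act1_eqI:
  assumes "\<mu> \<in> mor \<Omega>" "onmor p \<mu> = onmor p \<omega>" "src \<Omega> \<mu> = act0 (src \<Omega> \<omega>) c"
  shows "act1 \<omega> c = \<mu>"
  unfolding right_act_def using assms by (intro the_equality) (auto intro: lift_src_unique)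

text \<open>The translate exists as the lift with translated source. Its range is obtained from the
  source by the left action, which commutes with the right action.\<close>

lemma act1:
  assumes \<omega>: "\<omega> \<in> mor \<Omega>" and c: "c \<in> \<pi>"
  shows act1_closed: "act1 \<omega> c \<in> mor \<Omega>"
    and p_act1: "onmor p (act1 \<omega> c) = onmor p \<omega>"
    and src_act1: "src \<Omega> (act1 \<omega> c) = act0 (src \<Omega> \<omega>) c"
    and rng_act1: "rng \<Omega> (act1 \<omega> c) = act0 (rng \<Omega> \<omega>) c"
proof -
  note s = \<Omega>.src_closed[OF \<omega>]
  have "act0 (src \<Omega> \<omega>) c \<in> fibre \<Omega> p (src \<Lambda> (onmor p \<omega>))"
    using act0[OF s c] by (simp add: fibre_def p_src[OF \<omega>])
  from lift_src_ex[OF p_mor[OF \<omega>] this] obtain \<mu>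
    where \<mu>: "\<mu> \<in> mor \<Omega>" "onmor p \<mu> = onmor p \<omega>" "src \<Omega> \<mu> = act0 (src \<Omega> \<omega>) c" by blast
  have \<mu>_eq: "act1 \<omega> c = \<mu>" by (rule act1_eqI[OF \<mu>])
  show "act1 \<omega> c \<in> mor \<Omega>" "onmor p (act1 \<omega> c) = onmor p \<omega>" "src \<Omega> (act1 \<omega> c) = act0 (src \<Omega> \<omega>) c"
    using \<mu> by (simp_all add: \<mu>_eq)
  \<comment> \<open>This element carries the source of every lift of \<open>onmor p \<omega>\<close>
    to its range, for \<omega> and its translate alike.\<close>
  define e where "e = onmor (fund_incl \<Lambda>) (onmor p \<omega>)"
  have e: "e \<in> mor \<G>" "src \<G> e = onob p (src \<Omega> \<omega>)"
    using \<Lambda>.fund_incl_functor p_mor[OF \<omega>] p_src[OF \<omega>] by (auto simp: is_functor_def e_def simp del: \<Lambda>.fund_incl_sel(2))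
  have e_act: "act e (src \<Omega> \<nu>) = rng \<Omega> \<nu>" if "\<nu> \<in> mor \<Omega>" "onmor p \<nu> = onmor p \<omega>" for \<nu>
    using fund_act[OF cov] that by (auto simp: is_fund_action_def e_def simp del: \<Lambda>.fund_incl_sel(2))
  have "rng \<Omega> \<mu> = act e (act0 (src \<Omega> \<omega>) c)" using e_act[OF \<mu>(1,2)] \<mu>(3) by simp
  also have "\<dots> = act0 (act e (src \<Omega> \<omega>)) c" by (rule act_act0[OF s c e])
  also have "act e (src \<Omega> \<omega>) = rng \<Omega> \<omega>" using e_act[OF \<omega>] by simp
  finally show "rng \<Omega> (act1 \<omega> c) = act0 (rng \<Omega> \<omega>) c" by (simp add: \<mu>_eq)
qed

section \<open>Orbits of the subgroup\<close>

lemma H_closed: "c \<in> H \<Longrightarrow> c \<in> \<pi>"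
  using subgroup.mem_carrier[OF H] .

lemma one_H: "idm \<G> (onob p v) \<in> H"
  using subgroup.one_closed[OF H] by (simp only: \<pi>_ops)

lemma H_nonempty: "H \<noteq> {}"
  using one_H by blast

lemma mult_H: "c \<in> H \<Longrightarrow> d \<in> H \<Longrightarrow> c \<cdot>\<^bsub>\<G>\<^esub> d \<in> H"
  using subgroup.m_closed[OF H] by (simp only: \<pi>_ops)

lemma inv_H:
  assumes "c \<in> H"
  obtains d where "d \<in> H" "c \<cdot>\<^bsub>\<G>\<^esub> d = idm \<G> (onob p v)"
  using that[OF subgroup.m_inv_closed[OF H assms]]
    group.r_inv[OF \<Lambda>.group_fund_group[OF p_ob[OF v]] H_closed[OF assms]]
  by (simp only: \<pi>_ops)

text \<open>With \<open>d\<close> inverse to \<open>c\<close>, the point \<open>u e\<close> is the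
  translate of \<open>u c\<close> by \<open>d e\<close>; so the two orbits contain each
  other.\<close>

lemma orb0_act0:
  assumes u: "u \<in> obj \<Omega>" and c: "c \<in> H"
  shows "orb0 (act0 u c) = orb0 u"
proof -
  obtain d where d: "d \<in> H" "c \<cdot>\<^bsub>\<G>\<^esub> d = idm \<G> (onob p v)" using inv_H[OF c] .
  have mult: "act0 (act0 u c) e = act0 u (c \<cdot>\<^bsub>\<G>\<^esub> e)" if "e \<in> H" for e
    using act0_mult[OF u H_closed[OF c] H_closed[OF that]] by simp
  have "act0 u e = act0 (act0 u c) (d \<cdot>\<^bsub>\<G>\<^esub> e)" if e: "e \<in> H" for e
  proof -
    have "c \<cdot>\<^bsub>\<G>\<^esub> (d \<cdot>\<^bsub>\<G>\<^esub> e) = (c \<cdot>\<^bsub>\<G>\<^esub> d) \<cdot>\<^bsub>\<G>\<^esub> e"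
      using H_closed[OF c] H_closed[OF d(1)] H_closed[OF e] by (subst \<G>.cmp_assoc) (simp_all add: \<pi>)
    also have "\<dots> = e" using d(2) H_closed[OF e] \<G>.idm_left[of e] by (simp add: \<pi> del: \<Lambda>.fund_sel)
    finally show ?thesis using mult[OF mult_H[OF d(1) e]] by simp
  qed
  then have "orb0 u \<subseteq> orb0 (act0 u c)"
    unfolding orbit_def using mult_H[OF d(1)] by blast
  moreover have "orb0 (act0 u c) \<subseteq> orb0 u"
    unfolding orbit_def using mult mult_H[OF c] by auto
  ultimately show ?thesis by blast
qed

lemma self_orb0: "u \<in> obj \<Omega> \<Longrightarrow> u \<in> orb0 u"
  unfolding orbit_def using act0_one[OF _ H_closed[OF one_H]] one_H
  by (intro image_eqI[of _ _ "idm \<G> (onob p v)"]) auto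

lemma orb0_eqD: "u \<in> obj \<Omega> \<Longrightarrow> orb0 u = orb0 u' \<Longrightarrow> \<exists>c\<in>H. u = act0 u' c"
  using self_orb0[of u] by (auto simp: orbit_def)

lemma orb1_act1:
  assumes \<omega>: "\<omega> \<in> mor \<Omega>" and c: "c \<in> H"
  shows "orb1 (act1 \<omega> c) = orb1 \<omega>"
proof -
  note s = \<Omega>.src_closed[OF \<omega>]
  \<comment> \<open>By unique lifting, an orbit of morphisms is determined by its image in
    \<open>\<Lambda>\<close> and the orbit of its source, which reduces the claim to orbits of
    vertices.\<close>
  have orb1_eq: "orb1 \<omega> = {\<mu> \<in> mor \<Omega>. onmor p \<mu> = onmor p \<omega> \<and> src \<Omega> \<mu> \<in> orb0 (src \<Omega> \<omega>)}"
    if "\<omega> \<in> mor \<Omega>" for \<omega>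
    using act1[OF that H_closed] act1_eqI[of _ \<omega>] by (auto simp: orbit_def image_iff) (metis act1_eqI)
  show ?thesis
    using act1[OF \<omega> H_closed[OF c]] by (simp add: orb1_eq \<omega> orb0_act0[OF s c])
qed

lemma act1_idm:
  assumes u: "u \<in> obj \<Omega>" and c: "c \<in> \<pi>"
  shows "act1 (idm \<Omega> u) c = idm \<Omega> (act0 u c)"
  using act0[OF u c]
  by (intro act1_eqI) (simp_all add: \<Omega>.idm_closed p_idm u \<Omega>.src_idm)

text \<open>The product of the translates has the image and the source that characterize the
  translate of the product.\<close>

lemma act1_cmp:
  assumes \<omega>: "\<omega> \<in> mor \<Omega>" and \<mu>: "\<mu> \<in> mor \<Omega>" and m: "src \<Omega> \<omega> = rng \<Omega> \<mu>" and c: "c \<in> \<pi>"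
  shows "act1 (\<omega> \<cdot>\<^bsub>\<Omega>\<^esub> \<mu>) c = act1 \<omega> c \<cdot>\<^bsub>\<Omega>\<^esub> act1 \<mu> c"
  using act1[OF \<omega> c] act1[OF \<mu> c] \<omega> \<mu> m
  by (intro act1_eqI) (simp_all add: \<Omega>.cmp_closed p_cmp \<Omega>.src_cmp)

lemma p_deg: "\<omega> \<in> mor \<Omega> \<Longrightarrow> deg \<Lambda> (onmor p \<omega>) = deg \<Omega> \<omega>"
  using cov by (simp add: covering_def kgraph_morphism_def)

lemma act1_deg: "\<omega> \<in> mor \<Omega> \<Longrightarrow> c \<in> \<pi> \<Longrightarrow> deg \<Omega> (act1 \<omega> c) = deg \<Omega> \<omega>"
  using p_deg act1_closed p_act1 by metis

section \<open>The orbit graph as a category over the base\<close>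

lemma Q_sel:
  "obj Q = orb0 ` obj \<Omega>" "mor Q = orb1 ` mor \<Omega>"
  by (simp_all add: quotient_graph_def orbit_graph_def)

lemma Q_structure:
  shows "\<omega> \<in> mor \<Omega> \<Longrightarrow> src Q (orb1 \<omega>) = orb0 (src \<Omega> \<omega>)"
    and "\<omega> \<in> mor \<Omega> \<Longrightarrow> rng Q (orb1 \<omega>) = orb0 (rng \<Omega> \<omega>)"
    and "u \<in> obj \<Omega> \<Longrightarrow> idm Q (orb0 u) = orb1 (idm \<Omega> u)"
    and "\<lbrakk>\<omega> \<in> mor \<Omega>; \<mu> \<in> mor \<Omega>; src \<Omega> \<omega> = rng \<Omega> \<mu>\<rbrakk> \<Longrightarrow> orb1 \<omega> \<cdot>\<^bsub>Q\<^esub> orb1 \<mu> = orb1 (\<omega> \<cdot>\<^bsub>\<Omega>\<^esub> \<mu>)"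
    and "\<omega> \<in> mor \<Omega> \<Longrightarrow> deg Q (orb1 \<omega>) = deg \<Omega> \<omega>"
proof -
  \<comment> \<open>Freeness guarantees that the composable representatives of two orbits yield one
    orbit of products only.\<close>
  have inj: "inj_on (act0 u) H" if "u \<in> obj \<Omega>" for u
    using act0_inj[OF that] H_closed unfolding inj_on_def by blast
  note S = orbit_graph_structure[OF src_act1[OF _ H_closed] rng_act1[OF _ H_closed]
      act1_idm[OF _ H_closed, symmetric] act1_cmp[OF _ _ _ H_closed] act1_deg[OF _ H_closed]
      inj \<Omega>.category_axioms H_nonempty, folded quotient_graph_def]
  show "\<omega> \<in> mor \<Omega> \<Longrightarrow> src Q (orb1 \<omega>) = orb0 (src \<Omega> \<omega>)"
    "\<omega> \<in> mor \<Omega> \<Longrightarrow> rng Q (orb1 \<omega>) = orb0 (rng \<Omega> \<omega>)"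
    "u \<in> obj \<Omega> \<Longrightarrow> idm Q (orb0 u) = orb1 (idm \<Omega> u)"
    "\<lbrakk>\<omega> \<in> mor \<Omega>; \<mu> \<in> mor \<Omega>; src \<Omega> \<omega> = rng \<Omega> \<mu>\<rbrakk> \<Longrightarrow> orb1 \<omega> \<cdot>\<^bsub>Q\<^esub> orb1 \<mu> = orb1 (\<omega> \<cdot>\<^bsub>\<Omega>\<^esub> \<mu>)"
    "\<omega> \<in> mor \<Omega> \<Longrightarrow> deg Q (orb1 \<omega>) = deg \<Omega> \<omega>"
    by (simp_all add: S)
qed

text \<open>As \<open>p\<close> is constant on orbits and orbits are nonempty, its image of an orbit
  is a singleton, and \<open>the_elem\<close> returns the common value.\<close>

lemma q_sel:
  shows "u \<in> obj \<Omega> \<Longrightarrow> onob q (orb0 u) = onob p u"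
    and "\<omega> \<in> mor \<Omega> \<Longrightarrow> onmor q (orb1 \<omega>) = onmor p \<omega>"
proof -
  have "onob p ` orb0 u = {onob p u}" if "u \<in> obj \<Omega>"
    using p_act0[OF that H_closed] H_nonempty
    by (simp add: orbit_def image_image image_constant_conv cong: image_cong_simp)
  then show "u \<in> obj \<Omega> \<Longrightarrow> onob q (orb0 u) = onob p u" by (simp add: orbit_covering_def)
  have "onmor p ` orb1 \<omega> = {onmor p \<omega>}" if "\<omega> \<in> mor \<Omega>"
    using p_act1[OF that H_closed] H_nonempty
    by (simp add: orbit_def image_image image_constant_conv cong: image_cong_simp)
  then show "\<omega> \<in> mor \<Omega> \<Longrightarrow> onmor q (orb1 \<omega>) = onmor p \<omega>" by (simp add: orbit_covering_def)
qed

text \<open>Translating a representative by an element of \<open>H\<close> moves its source to any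
  chosen point of the orbit. This lets computations with orbits be done in
  \<open>\<Omega>\<close>.\<close>

lemma rep_src:
  assumes "X \<in> mor Q" "src Q X = orb0 u" "u \<in> obj \<Omega>"
  obtains \<omega> where "\<omega> \<in> mor \<Omega>" "X = orb1 \<omega>" "src \<Omega> \<omega> = u"
proof -
  obtain \<omega> where \<omega>: "\<omega> \<in> mor \<Omega>" "X = orb1 \<omega>" using assms(1) by (auto simp: Q_sel)
  then obtain c where c: "c \<in> H" "u = act0 (src \<Omega> \<omega>) c"
    using assms orb0_eqD[of u "src \<Omega> \<omega>"] by (auto simp: Q_structure)
  show thesis
    by (rule that[of "act1 \<omega> c"]) (simp_all add: act1[OF \<omega>(1) H_closed[OF c(1)]] orb1_act1 \<omega> c)
qed

lemma rep_rng:
  assumes "X \<in> mor Q" "rng Q X = orb0 u" "u \<in> obj \<Omega>"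
  obtains \<omega> where "\<omega> \<in> mor \<Omega>" "X = orb1 \<omega>" "rng \<Omega> \<omega> = u"
proof -
  obtain \<omega> where \<omega>: "\<omega> \<in> mor \<Omega>" "X = orb1 \<omega>" using assms(1) by (auto simp: Q_sel)
  then obtain c where c: "c \<in> H" "u = act0 (rng \<Omega> \<omega>) c"
    using assms orb0_eqD[of u "rng \<Omega> \<omega>"] by (auto simp: Q_structure)
  show thesis
    by (rule that[of "act1 \<omega> c"]) (simp_all add: act1[OF \<omega>(1) H_closed[OF c(1)]] orb1_act1 \<omega> c)
qed

lemma rep_composable:
  assumes "X \<in> mor Q" "Y \<in> mor Q" "src Q X = rng Q Y"
  obtains \<omega> \<mu> where "\<omega> \<in> mor \<Omega>" "\<mu> \<in> mor \<Omega>" "X = orb1 \<omega>" "Y = orb1 \<mu>" "src \<Omega> \<omega> = rng \<Omega> \<mu>"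
proof -
  obtain \<omega> where \<omega>: "\<omega> \<in> mor \<Omega>" "X = orb1 \<omega>" using assms(1) by (auto simp: Q_sel)
  have "rng Q Y = orb0 (src \<Omega> \<omega>)" using assms(3) \<omega> by (simp add: Q_structure)
  from rep_rng[OF assms(2) this \<Omega>.src_closed[OF \<omega>(1)]] \<omega> show thesis by (metis that)
qed

text \<open>Each law descends from \<open>\<Omega>\<close> after choosing composable
  representatives; for associativity the third one is chosen to fit the first two.\<close>

lemma category_Q: "category Q"
proof (unfold_locales, goal_cases)
  case (1 X)
  then show ?case by (auto simp: Q_sel Q_structure \<Omega>.src_closed)
next
  case (2 X)
  then show ?case by (auto simp: Q_sel Q_structure \<Omega>.rng_closed)
next
  case (3 U)
  then show ?case by (auto simp: Q_sel Q_structure \<Omega>.idm_closed)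
next
  case (4 U)
  then show ?case by (auto simp: Q_sel Q_structure \<Omega>.idm_closed \<Omega>.src_idm)
next
  case (5 U)
  then show ?case by (auto simp: Q_sel Q_structure \<Omega>.idm_closed \<Omega>.rng_idm)
next
  case (6 X Y)
  show ?case by (rule rep_composable[OF 6]) (simp add: Q_sel Q_structure \<Omega>.cmp_closed)
next
  case (7 X Y)
  show ?case by (rule rep_composable[OF 7]) (simp add: Q_structure \<Omega>.cmp_closed \<Omega>.src_cmp)
next
  case (8 X Y)
  show ?case by (rule rep_composable[OF 8]) (simp add: Q_structure \<Omega>.cmp_closed \<Omega>.rng_cmp)
next
  case (9 X Y Z)
  from 9(1,2,4) obtain \<omega> \<mu> where \<omega>: "\<omega> \<in> mor \<Omega>" "\<mu> \<in> mor \<Omega>" "X = orb1 \<omega>" "Y = orb1 \<mu>" "src \<Omega> \<omega> = rng \<Omega> \<mu>"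
    by (rule rep_composable)
  have "rng Q Z = orb0 (src \<Omega> \<mu>)" using 9(5) \<omega> by (simp add: Q_structure)
  from rep_rng[OF 9(3) this \<Omega>.src_closed[OF \<omega>(2)]]
  obtain \<nu> where "\<nu> \<in> mor \<Omega>" "Z = orb1 \<nu>" "rng \<Omega> \<nu> = src \<Omega> \<mu>" .
  with \<omega> show ?case
    by (simp add: Q_structure \<Omega>.cmp_closed \<Omega>.src_cmp \<Omega>.rng_cmp \<Omega>.cmp_assoc)
next
  case (10 X)
  then obtain \<omega> where \<omega>: "\<omega> \<in> mor \<Omega>" "X = orb1 \<omega>" by (auto simp: Q_sel)
  then show ?case
    using Q_structure(4)[of "idm \<Omega> (rng \<Omega> \<omega>)" \<omega>]
    by (simp add: Q_structure \<Omega>.rng_closed \<Omega>.idm_closed \<Omega>.src_idm \<Omega>.idm_left)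
next
  case (11 X)
  then obtain \<omega> where \<omega>: "\<omega> \<in> mor \<Omega>" "X = orb1 \<omega>" by (auto simp: Q_sel)
  then show ?case
    using Q_structure(4)[of \<omega> "idm \<Omega> (src \<Omega> \<omega>)"]
    by (simp add: Q_structure \<Omega>.src_closed \<Omega>.idm_closed \<Omega>.rng_idm \<Omega>.idm_right)
qed

lemma q_morphism: "kgraph_morphism Q \<Lambda> q"
proof -
  have "onmor q (X \<cdot>\<^bsub>Q\<^esub> Y) = onmor q X \<cdot>\<^bsub>\<Lambda>\<^esub> onmor q Y" if "X \<in> mor Q" "Y \<in> mor Q" "src Q X = rng Q Y" for X Y
    by (rule rep_composable[OF that]) (simp add: Q_structure q_sel \<Omega>.cmp_closed p_cmp)
  then show ?thesis
    by (auto simp: kgraph_morphism_def is_functor_def Q_sel Q_structure q_sel p_ob p_idm p_mor p_src p_rng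
        p_deg \<Omega>.idm_closed \<Omega>.src_closed \<Omega>.rng_closed)
qed

text \<open>Fix \<open>u\<close> in the orbit \<open>U\<close>. Every orbit of morphisms starting at
  \<open>U\<close> has a representative starting at \<open>u\<close>, so lifts at \<open>U\<close>
  inherit existence and uniqueness from lifts at \<open>u\<close>; likewise for ranges.\<close>

lemma covering_Q: "covering k Q q \<Lambda>"
proof -
  have surj: "onmor q ` mor Q = mor \<Lambda>"
  proof -
    have "onmor q ` mor Q = onmor p ` mor \<Omega>" by (simp add: Q_sel image_image q_sel cong: image_cong_simp)
    then show ?thesis using cov by (simp add: covering_def)
  qed
  have src_bij: "bij_betw (onmor q) {X \<in> mor Q. src Q X = U} {\<alpha> \<in> mor \<Lambda>. src \<Lambda> \<alpha> = onob q U}"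
    if U: "U \<in> obj Q" for U
  proof -
    obtain u where u: "u \<in> obj \<Omega>" "U = orb0 u" using U by (auto simp: Q_sel)
    show ?thesis unfolding bij_betw_def
    proof (intro conjI, rule inj_onI)
      fix X Y assume XY: "X \<in> {X \<in> mor Q. src Q X = U}" "Y \<in> {X \<in> mor Q. src Q X = U}" "onmor q X = onmor q Y"
      obtain \<omega> where \<omega>: "\<omega> \<in> mor \<Omega>" "X = orb1 \<omega>" "src \<Omega> \<omega> = u" using XY(1) u by (auto elim: rep_src)
      obtain \<mu> where \<mu>: "\<mu> \<in> mor \<Omega>" "Y = orb1 \<mu>" "src \<Omega> \<mu> = u" using XY(2) u by (auto elim: rep_src)
      have "\<omega> = \<mu>" using XY(3) \<omega> \<mu> by (intro lift_src_unique) (simp_all add: q_sel)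
      then show "X = Y" using \<omega> \<mu> by simp
    next
      have "\<exists>\<omega>\<in>mor \<Omega>. onmor p \<omega> = \<alpha> \<and> src \<Omega> \<omega> = u" if "\<alpha> \<in> mor \<Lambda>" "src \<Lambda> \<alpha> = onob p u" for \<alpha>
        using lift_src_ex[of \<alpha> u] u that by (auto simp: fibre_def)
      then have "\<exists>X\<in>mor Q. onmor q X = \<alpha> \<and> src Q X = U" if "\<alpha> \<in> mor \<Lambda>" "src \<Lambda> \<alpha> = onob p u" for \<alpha>
        using that u by (fastforce simp: Q_sel Q_structure q_sel)
      moreover have "onmor q X \<in> mor \<Lambda> \<and> src \<Lambda> (onmor q X) = onob q (src Q X)" if "X \<in> mor Q" for X
        using q_morphism that by (simp add: kgraph_morphism_def is_functor_def)
      ultimately show "onmor q ` {X \<in> mor Q. src Q X = U} = {\<alpha> \<in> mor \<Lambda>. src \<Lambda> \<alpha> = onob q U}"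
        using u by (auto simp: q_sel image_iff)
    qed
  qed
  have rng_bij: "bij_betw (onmor q) {X \<in> mor Q. rng Q X = U} {\<alpha> \<in> mor \<Lambda>. rng \<Lambda> \<alpha> = onob q U}"
    if U: "U \<in> obj Q" for U
  proof -
    obtain u where u: "u \<in> obj \<Omega>" "U = orb0 u" using U by (auto simp: Q_sel)
    show ?thesis unfolding bij_betw_def
    proof (intro conjI, rule inj_onI)
      fix X Y assume XY: "X \<in> {X \<in> mor Q. rng Q X = U}" "Y \<in> {X \<in> mor Q. rng Q X = U}" "onmor q X = onmor q Y"
      obtain \<omega> where \<omega>: "\<omega> \<in> mor \<Omega>" "X = orb1 \<omega>" "rng \<Omega> \<omega> = u" using XY(1) u by (auto elim: rep_rng)
      obtain \<mu> where \<mu>: "\<mu> \<in> mor \<Omega>" "Y = orb1 \<mu>" "rng \<Omega> \<mu> = u" using XY(2) u by (auto elim: rep_rng)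
      have "\<omega> = \<mu>" using XY(3) \<omega> \<mu> by (intro lift_rng_unique) (simp_all add: q_sel)
      then show "X = Y" using \<omega> \<mu> by simp
    next
      have "\<exists>\<omega>\<in>mor \<Omega>. onmor p \<omega> = \<alpha> \<and> rng \<Omega> \<omega> = u" if "\<alpha> \<in> mor \<Lambda>" "rng \<Lambda> \<alpha> = onob p u" for \<alpha>
        using lift_rng_ex[of \<alpha> u] u that by (auto simp: fibre_def)
      then have "\<exists>X\<in>mor Q. onmor q X = \<alpha> \<and> rng Q X = U" if "\<alpha> \<in> mor \<Lambda>" "rng \<Lambda> \<alpha> = onob p u" for \<alpha>
        using that u by (fastforce simp: Q_sel Q_structure q_sel)
      moreover have "onmor q X \<in> mor \<Lambda> \<and> rng \<Lambda> (onmor q X) = onob q (rng Q X)" if "X \<in> mor Q" for X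
        using q_morphism that by (simp add: kgraph_morphism_def is_functor_def)
      ultimately show "onmor q ` {X \<in> mor Q. rng Q X = U} = {\<alpha> \<in> mor \<Lambda>. rng \<Lambda> \<alpha> = onob q U}"
        using u by (auto simp: q_sel image_iff)
    qed
  qed
  show ?thesis
    using kgraph_of_src_lifts[OF category_Q \<Lambda>.kgraph_axioms q_morphism src_bij]
      \<Lambda>.kgraph_axioms q_morphism surj src_bij rng_bij
    by (simp add: covering_def)
qed

lemma orbit_morphism: "covering_morphism \<Omega> p Q q \<lparr>onob = orb0, onmor = orb1\<rparr>"
  by (simp add: covering_morphism_def kgraph_morphism_def is_functor_def eq_map_def comp_map_def
      Q_sel Q_structure q_sel)

lemma connected_covering_Q: "connected_covering k Q q \<Lambda>"
  using covering_Q connected_cat_image[OF connected, of Q "\<lparr>onob = orb0, onmor = orb1\<rparr>"] orbit_morphism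
  by (simp add: connected_covering_def covering_morphism_def kgraph_morphism_def Q_sel)

text \<open>By \<open>fund_map_image\<close> the image is the stabilizer of the orbit of
  \<open>v\<close>. Equivariance of the orbit map turns fixing that orbit into \<open>c v\<close>
  lying in it, and freeness then forces \<open>c\<close> into \<open>H\<close>.\<close>

lemma fund_map_image_Q: "onmor (fund_map Q \<Lambda> q) ` carrier (fund_group Q (orb0 v)) = H"
proof -
  interpret Q: covering_context k Q q \<Lambda> by unfold_locales (rule covering_Q)
  \<comment> \<open>At the base vertex the left and right actions of a loop agree, since
    \<open>v\<close> is carried to itself by the identity.\<close>
  have act0_v: "act0 v c = act c v" if "c \<in> \<pi>" for c
  proof -
    have "act0 v c = act0 (act (idm \<G> (onob p v)) v) c" using act_idm[OF v] by simp
    also have "\<dots> = act (idm \<G> (onob p v) \<cdot>\<^bsub>\<G>\<^esub> c) v"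
      using \<G>.idm_closed[of "onob p v"] \<G>.src_idm[of "onob p v"] p_ob[OF v] by (intro act0_act) simp_all
    also have "\<dots> = act c v" using \<G>.idm_left[of c] that by (simp add: \<pi>)
    finally show ?thesis .
  qed
  have "Q.act c (orb0 v) = orb0 v \<longleftrightarrow> c \<in> H" if c: "c \<in> \<pi>" for c
  proof -
    have "Q.act c (orb0 v) = orb0 (act0 v c)"
      using act_covering_morphism[OF cov covering_Q orbit_morphism _ v] c by (simp add: \<pi> act0_v)
    also have "\<dots> = orb0 v \<longleftrightarrow> c \<in> H"
      using orb0_act0[OF v] orb0_eqD[OF act0_closed[OF v c]] act0_inj[OF v c] H_closed by metis
    finally show ?thesis .
  qed
  then show ?thesis
    using Q.fund_map_image[of "orb0 v"] v H_closed
    by (simp add: Q_sel q_sel) blast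
qed

end

section \<open>Classification of connected coverings\<close>

text \<open>A morphism of coverings is determined over each vertex by unique lifting, so a bijection
  on vertices forces one on morphisms.\<close>

lemma covering_isomorphicI:
  assumes \<Omega>: "covering k \<Omega> p \<Lambda>" and \<Sigma>: "covering k \<Sigma> q \<Lambda>" and \<phi>: "covering_morphism \<Omega> p \<Sigma> q \<phi>"
    and bij: "bij_betw (onob \<phi>) (obj \<Omega>) (obj \<Sigma>)"
  shows "covering_isomorphic \<Sigma> q \<Omega> p"
proof -
  interpret \<Omega>: covering_context k \<Omega> p \<Lambda> by unfold_locales fact
  interpret \<Sigma>: covering_context k \<Sigma> q \<Lambda> by unfold_locales fact
  have ob: "onob \<phi> x \<in> obj \<Sigma>" "onmor \<phi> (idm \<Omega> x) = idm \<Sigma> (onob \<phi> x)" "onob q (onob \<phi> x) = onob p x"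
    if "x \<in> obj \<Omega>" for x
    using \<phi> that by (auto simp: covering_morphism_def kgraph_morphism_def is_functor_def eq_map_def comp_map_def)
  have mo: "onmor \<phi> \<omega> \<in> mor \<Sigma>" "src \<Sigma> (onmor \<phi> \<omega>) = onob \<phi> (src \<Omega> \<omega>)"
    "rng \<Sigma> (onmor \<phi> \<omega>) = onob \<phi> (rng \<Omega> \<omega>)" "onmor q (onmor \<phi> \<omega>) = onmor p \<omega>"
    "deg \<Sigma> (onmor \<phi> \<omega>) = deg \<Omega> \<omega>" if "\<omega> \<in> mor \<Omega>" for \<omega>
    using \<phi> that by (auto simp: covering_morphism_def kgraph_morphism_def is_functor_def eq_map_def comp_map_def)
  have cmp: "onmor \<phi> (\<omega> \<cdot>\<^bsub>\<Omega>\<^esub> \<mu>) = onmor \<phi> \<omega> \<cdot>\<^bsub>\<Sigma>\<^esub> onmor \<phi> \<mu>"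
    if "\<omega> \<in> mor \<Omega>" "\<mu> \<in> mor \<Omega>" "src \<Omega> \<omega> = rng \<Omega> \<mu>" for \<omega> \<mu>
    using \<phi> that by (auto simp: covering_morphism_def kgraph_morphism_def is_functor_def)
  note inj0 = bij_betw_imp_inj_on[OF bij] and surj0 = bij_betw_imp_surj_on[OF bij]
  have inj1: "inj_on (onmor \<phi>) (mor \<Omega>)"
  proof (rule inj_onI)
    fix \<omega> \<mu> assume *: "\<omega> \<in> mor \<Omega>" "\<mu> \<in> mor \<Omega>" "onmor \<phi> \<omega> = onmor \<phi> \<mu>"
    then have "onob \<phi> (src \<Omega> \<omega>) = onob \<phi> (src \<Omega> \<mu>)" "onmor p \<omega> = onmor p \<mu>" using mo by metis+
    with * show "\<omega> = \<mu>" using inj0 \<Omega>.\<Omega>.src_closed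
      by (intro \<Omega>.lift_src_unique) (auto dest: inj_onD)
  qed
  have surj1: "onmor \<phi> ` mor \<Omega> = mor \<Sigma>"
  proof (intro subset_antisym subsetI)
    fix \<sigma> assume \<sigma>: "\<sigma> \<in> mor \<Sigma>"
    then have "src \<Sigma> \<sigma> \<in> onob \<phi> ` obj \<Omega>" using surj0 \<Sigma>.\<Omega>.src_closed by simp
    then obtain u where u: "u \<in> obj \<Omega>" "src \<Sigma> \<sigma> = onob \<phi> u" by auto
    then have "u \<in> fibre \<Omega> p (src \<Lambda> (onmor q \<sigma>))" using ob \<sigma> \<Sigma>.p_src by (simp add: fibre_def)
    from \<Omega>.lift_src_ex[OF \<Sigma>.p_mor[OF \<sigma>] this] obtain \<omega>
      where \<omega>: "\<omega> \<in> mor \<Omega>" "onmor p \<omega> = onmor q \<sigma>" "src \<Omega> \<omega> = u" by blast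
    then have "\<sigma> = onmor \<phi> \<omega>" using \<sigma> u mo by (intro \<Sigma>.lift_src_unique) simp_all
    then show "\<sigma> \<in> onmor \<phi> ` mor \<Omega>" using \<omega> by blast
  qed (auto simp: mo)
  define \<psi> where "\<psi> = \<lparr>onob = inv_into (obj \<Omega>) (onob \<phi>), onmor = inv_into (mor \<Omega>) (onmor \<phi>)\<rparr>"
  have \<psi>0: "onob \<psi> (onob \<phi> x) = x" if "x \<in> obj \<Omega>" for x using that inj0 by (simp add: \<psi>_def)
  have \<psi>1: "onmor \<psi> (onmor \<phi> \<omega>) = \<omega>" if "\<omega> \<in> mor \<Omega>" for \<omega> using that inj1 by (simp add: \<psi>_def)
  \<comment> \<open>Morphisms with composable images are composable themselves because \<phi> is
    injective on vertices.\<close>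
  have comp: "onmor \<psi> (onmor \<phi> \<omega> \<cdot>\<^bsub>\<Sigma>\<^esub> onmor \<phi> \<mu>) = \<omega> \<cdot>\<^bsub>\<Omega>\<^esub> \<mu>"
    if "\<omega> \<in> mor \<Omega>" "\<mu> \<in> mor \<Omega>" "src \<Sigma> (onmor \<phi> \<omega>) = rng \<Sigma> (onmor \<phi> \<mu>)" for \<omega> \<mu>
  proof -
    have "src \<Omega> \<omega> = rng \<Omega> \<mu>"
      using that inj0 mo \<Omega>.\<Omega>.src_closed \<Omega>.\<Omega>.rng_closed by (metis inj_onD)
    then show ?thesis using that \<psi>1[of "\<omega> \<cdot>\<^bsub>\<Omega>\<^esub> \<mu>"] by (simp add: cmp[symmetric] \<Omega>.\<Omega>.cmp_closed)
  qed
  have idm: "onmor \<psi> (idm \<Sigma> (onob \<phi> x)) = idm \<Omega> x" if "x \<in> obj \<Omega>" for x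
    using that ob(2) \<psi>1 \<Omega>.\<Omega>.idm_closed by metis
  have "covering_morphism \<Sigma> q \<Omega> p \<psi>"
    unfolding covering_morphism_def kgraph_morphism_def is_functor_def eq_map_def comp_map_def
      surj0[symmetric] surj1[symmetric]
    by (auto simp: ob mo \<psi>0 \<psi>1 idm comp \<Omega>.\<Omega>.src_closed \<Omega>.\<Omega>.rng_closed)
  moreover have "eq_map \<Omega> (comp_map \<psi> \<phi>) id_map" "eq_map \<Sigma> (comp_map \<phi> \<psi>) id_map"
    unfolding eq_map_def comp_map_def id_map_def surj0[symmetric] surj1[symmetric]
    by (auto simp: \<psi>0 \<psi>1)
  ultimately show ?thesis using \<phi> unfolding covering_isomorphic_def by blast
qed

lemma (in covering_context) stabilizer_subgroup:
  assumes u: "u \<in> obj \<Omega>"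
  shows "subgroup {c \<in> carrier (fund_group \<Lambda> (onob p u)). act c u = u} (fund_group \<Lambda> (onob p u))"
proof -
  let ?\<pi> = "fund_group \<Lambda> (onob p u)"
  interpret group ?\<pi> using \<Lambda>.group_fund_group[OF p_ob[OF u]] .
  have mult: "act (a \<otimes>\<^bsub>?\<pi>\<^esub> b) u = act a (act b u)" if "a \<in> carrier ?\<pi>" "b \<in> carrier ?\<pi>" for a b
    using that u act_cmp[of a b u] by (simp add: fund_group_def fibre_def)
  have one: "act \<one>\<^bsub>?\<pi>\<^esub> u = u" using act_idm[OF u] by (simp add: fund_group_def)
  show ?thesis
  proof (rule subgroupI)
    show "{c \<in> carrier ?\<pi>. act c u = u} \<noteq> {}" using one one_closed by blast
    fix a assume a: "a \<in> {c \<in> carrier ?\<pi>. act c u = u}"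
    have "act (inv\<^bsub>?\<pi>\<^esub> a) u = act (inv\<^bsub>?\<pi>\<^esub> a \<otimes>\<^bsub>?\<pi>\<^esub> a) u" using a mult[of "inv\<^bsub>?\<pi>\<^esub> a" a] by simp
    then show "inv\<^bsub>?\<pi>\<^esub> a \<in> {c \<in> carrier ?\<pi>. act c u = u}" using a one by simp
    fix b assume "b \<in> {c \<in> carrier ?\<pi>. act c u = u}"
    with a show "a \<otimes>\<^bsub>?\<pi>\<^esub> b \<in> {c \<in> carrier ?\<pi>. act c u = u}" using mult by simp
  qed blast
qed

text \<open>Equivariance reads \<phi> as \<open>a v \<mapsto> a y\<close> with \<open>y\<close> the
  image of \<open>v\<close>. Its fibres are therefore the orbits of the stabilizer of
  \<open>y\<close>, so \<phi> descends to a bijection on the vertices of the quotient.\<close>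

lemma covering_isomorphic_quotient:
  assumes U: "universal_covering k \<Omega> p \<Lambda>" and v: "v \<in> obj \<Omega>"
    and \<Sigma>: "connected_covering k \<Sigma> \<sigma> \<Lambda>"
  shows "\<exists>K. subgroup K (fund_group \<Lambda> (onob p v)) \<and>
    covering_isomorphic \<Sigma> \<sigma> (quotient_graph \<Omega> p \<Lambda> v K) (orbit_covering p)"
proof -
  have cov\<Omega>: "covering k \<Omega> p \<Lambda>" and cov\<Sigma>: "covering k \<Sigma> \<sigma> \<Lambda>" and conn\<Sigma>: "connected_cat \<Sigma>"
    using U \<Sigma> by (simp_all add: universal_covering_def connected_covering_def)
  obtain \<phi> where \<phi>: "covering_morphism \<Omega> p \<Sigma> \<sigma> \<phi>" using universal_coveringD[OF U \<Sigma>] by blast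
  interpret \<Sigma>: covering_context k \<Sigma> \<sigma> \<Lambda> by unfold_locales fact
  have ob: "onob \<phi> x \<in> obj \<Sigma>" "onmor \<phi> (idm \<Omega> x) = idm \<Sigma> (onob \<phi> x)" "onob \<sigma> (onob \<phi> x) = onob p x"
    if "x \<in> obj \<Omega>" for x
    using \<phi> that by (auto simp: covering_morphism_def kgraph_morphism_def is_functor_def eq_map_def comp_map_def)
  have mo: "onmor \<phi> \<omega> \<in> mor \<Sigma>" "src \<Sigma> (onmor \<phi> \<omega>) = onob \<phi> (src \<Omega> \<omega>)"
    "rng \<Sigma> (onmor \<phi> \<omega>) = onob \<phi> (rng \<Omega> \<omega>)" "onmor \<sigma> (onmor \<phi> \<omega>) = onmor p \<omega>"
    "deg \<Sigma> (onmor \<phi> \<omega>) = deg \<Omega> \<omega>" if "\<omega> \<in> mor \<Omega>" for \<omega>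
    using \<phi> that by (auto simp: covering_morphism_def kgraph_morphism_def is_functor_def eq_map_def comp_map_def)
  have cmp: "onmor \<phi> (\<omega> \<cdot>\<^bsub>\<Omega>\<^esub> \<mu>) = onmor \<phi> \<omega> \<cdot>\<^bsub>\<Sigma>\<^esub> onmor \<phi> \<mu>"
    if "\<omega> \<in> mor \<Omega>" "\<mu> \<in> mor \<Omega>" "src \<Omega> \<omega> = rng \<Omega> \<mu>" for \<omega> \<mu>
    using \<phi> that by (auto simp: covering_morphism_def kgraph_morphism_def is_functor_def)
  define y where "y = onob \<phi> v"
  have y: "y \<in> obj \<Sigma>" "onob \<sigma> y = onob p v" using ob v by (simp_all add: y_def)
  define K where "K = {c \<in> carrier (fund_group \<Lambda> (onob p v)). \<Sigma>.act c y = y}"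
  have K: "subgroup K (fund_group \<Lambda> (onob p v))"
    using \<Sigma>.stabilizer_subgroup[OF y(1)] by (simp add: K_def y)
  \<comment> \<open>From here on the orbits, \<open>Q\<close> and the facts about \<open>H\<close>
    refer to the stabilizer \<open>K\<close>.\<close>
  interpret universal_quotient k \<Omega> p \<Lambda> v K
    by (intro universal_quotient.intro covering_context.intro universal_quotient_axioms.intro cov\<Omega> U v K)
  have \<phi>_act: "onob \<phi> (act a v) = \<Sigma>.act a y" if "a \<in> mor \<G>" "src \<G> a = onob p v" for a
    unfolding y_def by (rule act_covering_morphism[OF cov\<Omega> cov\<Sigma> \<phi> that(1) v that(2)])
  have \<Sigma>_cmp: "\<Sigma>.act (a \<cdot>\<^bsub>\<G>\<^esub> b) y = \<Sigma>.act a (\<Sigma>.act b y)"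
    if "a \<in> mor \<G>" "b \<in> mor \<G>" "src \<G> a = rng \<G> b" "src \<G> b = onob p v" for a b
    using that y by (intro \<Sigma>.act_cmp) (simp_all add: fibre_def)
  have K_mor: "c \<in> mor \<G>" "src \<G> c = onob p v" "rng \<G> c = onob p v" "\<Sigma>.act c y = y" if "c \<in> K" for c
    using that by (auto simp: K_def fund_group_def)
  have \<phi>_act0: "onob \<phi> (act0 u c) = onob \<phi> u" if u: "u \<in> obj \<Omega>" and c: "c \<in> K" for u c
  proof -
    obtain a where a: "a \<in> mor \<G>" "src \<G> a = onob p v" "u = act a v" using orbit_mapE[OF u] by metis
    have "onob \<phi> (act0 u c) = \<Sigma>.act (a \<cdot>\<^bsub>\<G>\<^esub> c) y"
      using a K_mor[OF c] by (simp add: act0_act \<phi>_act \<Sigma>.\<G>.cmp_closed \<Sigma>.\<G>.src_cmp)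
    also have "\<dots> = \<Sigma>.act a y" using a K_mor[OF c] by (simp add: \<Sigma>_cmp)
    finally show ?thesis using a by (simp add: \<phi>_act)
  qed
  \<comment> \<open>Both sides lift the same morphism of \<open>\<Lambda>\<close> and have the same
    source.\<close>
  have \<phi>_act1: "onmor \<phi> (act1 \<omega> c) = onmor \<phi> \<omega>" if \<omega>: "\<omega> \<in> mor \<Omega>" and c: "c \<in> K" for \<omega> c
    using \<omega> act1[OF \<omega> H_closed[OF c]] \<phi>_act0[OF \<Omega>.src_closed[OF \<omega>] c]
    by (intro \<Sigma>.lift_src_unique) (simp_all add: mo)
  define \<psi> where "\<psi> = \<lparr>onob = (\<lambda>U. the_elem (onob \<phi> ` U)), onmor = (\<lambda>X. the_elem (onmor \<phi> ` X))\<rparr>"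
  have \<psi>0: "onob \<psi> (orb0 u) = onob \<phi> u" if "u \<in> obj \<Omega>" for u
  proof -
    have "onob \<phi> ` orb0 u = {onob \<phi> u}"
      using \<phi>_act0[OF that] H_nonempty
      by (simp add: orbit_def image_image image_constant_conv cong: image_cong_simp)
    then show ?thesis by (simp add: \<psi>_def)
  qed
  have \<psi>1: "onmor \<psi> (orb1 \<omega>) = onmor \<phi> \<omega>" if "\<omega> \<in> mor \<Omega>" for \<omega>
  proof -
    have "onmor \<phi> ` orb1 \<omega> = {onmor \<phi> \<omega>}"
      using \<phi>_act1[OF that] H_nonempty
      by (simp add: orbit_def image_image image_constant_conv cong: image_cong_simp)
    then show ?thesis by (simp add: \<psi>_def)
  qed
  have \<psi>_cmp: "onmor \<psi> (X \<cdot>\<^bsub>Q\<^esub> Y) = onmor \<psi> X \<cdot>\<^bsub>\<Sigma>\<^esub> onmor \<psi> Y"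
    if "X \<in> mor Q" "Y \<in> mor Q" "src Q X = rng Q Y" for X Y
    by (rule rep_composable[OF that]) (simp add: Q_structure \<psi>1 \<Omega>.cmp_closed cmp)
  have morphism: "covering_morphism Q q \<Sigma> \<sigma> \<psi>"
    using \<psi>_cmp
    by (auto simp: covering_morphism_def kgraph_morphism_def is_functor_def eq_map_def comp_map_def
        Q_sel Q_structure q_sel \<psi>0 \<psi>1 ob mo \<Omega>.idm_closed \<Omega>.src_closed \<Omega>.rng_closed)
  have inj: "orb0 u = orb0 u'" if u: "u \<in> obj \<Omega>" "u' \<in> obj \<Omega>" and eq: "onob \<phi> u = onob \<phi> u'" for u u'
  proof -
    obtain a where a: "a \<in> mor \<G>" "src \<G> a = onob p v" "rng \<G> a = onob p u" "u = act a v"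
      using orbit_mapE[OF u(1)] .
    obtain b where b: "b \<in> mor \<G>" "src \<G> b = onob p v" "rng \<G> b = onob p u'" "u' = act b v"
      using orbit_mapE[OF u(2)] .
    have ab: "rng \<G> b = rng \<G> a" "\<Sigma>.act b y = \<Sigma>.act a y"
      using a b eq ob(3)[OF u(1)] ob(3)[OF u(2)] \<phi>_act by auto
    \<comment> \<open>This loop fixes \<open>y\<close> because \<open>a\<close> and \<open>b\<close>
      send \<open>y\<close> to the same vertex, and right translation by it takes \<open>a v\<close>
      to \<open>b v\<close>.\<close>
    let ?c = "\<Sigma>.\<G>.ginv a \<cdot>\<^bsub>\<G>\<^esub> b"
    note g = \<Sigma>.\<G>.ginv[OF a(1)]
    have "\<Sigma>.act ?c y = \<Sigma>.act (\<Sigma>.\<G>.ginv a) (\<Sigma>.act b y)" using g ab b by (intro \<Sigma>_cmp) simp_all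
    also have "\<dots> = \<Sigma>.act (\<Sigma>.\<G>.ginv a \<cdot>\<^bsub>\<G>\<^esub> a) y" using g(1-3) ab(2) a(1,2) by (simp add: \<Sigma>_cmp)
    also have "\<dots> = y" using g(5) a(2) \<Sigma>.act_idm[OF y(1)] y(2) by simp
    finally have c: "?c \<in> K"
      using g ab b a by (simp add: K_def fund_group_def \<Sigma>.\<G>.cmp_closed \<Sigma>.\<G>.src_cmp \<Sigma>.\<G>.rng_cmp)
    have "act0 u ?c = act (a \<cdot>\<^bsub>\<G>\<^esub> ?c) v" using a by (simp add: act0_act)
    also have "a \<cdot>\<^bsub>\<G>\<^esub> ?c = b"
      using a b ab g \<Sigma>.\<G>.idm_left[of b]
      by (subst \<Sigma>.\<G>.cmp_assoc[symmetric]) (simp_all del: \<Sigma>.\<Lambda>.fund_sel)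
    finally show ?thesis using orb0_act0[OF u(1) c] b by simp
  qed
  have "bij_betw (onob \<psi>) (obj Q) (obj \<Sigma>)"
    unfolding bij_betw_def
  proof
    show "inj_on (onob \<psi>) (obj Q)"
      by (simp add: inj_on_def Q_sel \<psi>0) (use inj in blast)
    \<comment> \<open>Connectedness of \<open>\<Sigma>\<close> enters here: every vertex is
      \<open>a y\<close> for some \<open>a\<close>, hence the image of \<open>a v\<close>.\<close>
    have "w \<in> onob \<psi> ` obj Q" if w: "w \<in> obj \<Sigma>" for w
    proof -
      obtain a where a: "a \<in> mor \<G>" "src \<G> a = onob p v" "\<Sigma>.act a y = w"
        using \<Sigma>.act_transitive[OF conn\<Sigma> w y(1)] y(2) by metis
      then have "act a v \<in> obj \<Omega>" "w = onob \<phi> (act a v)"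
        using act_closed[OF a(1) v] by (simp_all add: \<phi>_act)
      then show ?thesis
        by (intro image_eqI[of _ _ "orb0 (act a v)"]) (simp_all add: \<psi>0 Q_sel)
    qed
    then show "onob \<psi> ` obj Q = obj \<Sigma>" by (auto simp: Q_sel \<psi>0 ob)
  qed
  from covering_isomorphicI[OF covering_Q cov\<Sigma> morphism this] K show ?thesis by blast
qed

text \<open>The coverings \<open>\<Sigma>\<close> may live on arbitrary types, since
  \<open>universal_coveringD\<close> extends the universal property beyond the two types in its
  definition.\<close>

theorem theorem2p8:
  fixes k :: nat
    and \<Omega> :: "('u, 'a) kcat" and \<Lambda> :: "('o, 'm) kcat"
    and p :: "('u, 'a, 'o, 'm) cat_map"
  assumes "universal_covering k \<Omega> p \<Lambda>"
    and "x \<in> obj \<Lambda>"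
    and "v \<in> obj \<Omega>" and "onob p v = x"
    and "subgroup H (fund_group \<Lambda> x)"
  shows "connected_covering k (quotient_graph \<Omega> p \<Lambda> v H) (orbit_covering p) \<Lambda> \<and>
         H = onmor (fund_map (quotient_graph \<Omega> p \<Lambda> v H) \<Lambda> (orbit_covering p)) `
               carrier (fund_group (quotient_graph \<Omega> p \<Lambda> v H)
                                   (orbit (right_act_ob \<Omega> p \<Lambda> v) H v)) \<and>
         (\<forall>(\<Sigma> :: ('w, 'b) kcat) (\<sigma> :: ('w, 'b, 'o, 'm) cat_map).
            connected_covering k \<Sigma> \<sigma> \<Lambda> \<longrightarrow>
            (\<exists>K. subgroup K (fund_group \<Lambda> x) \<and>
                 covering_isomorphic \<Sigma> \<sigma> (quotient_graph \<Omega> p \<Lambda> v K) (orbit_covering p)))"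
proof -
  interpret universal_quotient k \<Omega> p \<Lambda> v H
    using assms
    by (intro universal_quotient.intro covering_context.intro universal_quotient_axioms.intro)
      (simp_all add: universal_covering_def connected_covering_def)
  show ?thesis
    using connected_covering_Q fund_map_image_Q covering_isomorphic_quotient[OF assms(1,3)]
    unfolding assms(4) by blast
qed

end
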